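(* Let $\bar{\mathsf{z}}$ be the optimal control of the fractional optimal control problem, let $\bar{\mathsf{u}}=\mathbf{S}\bar{\mathsf{z}}$ be the optimal state and $\bar{\mathsf{p}}=\mathbf{S}^\dagger(\mathbf{S}\bar{\mathsf{z}}-\mathsf{u}_{\rm d})$ the optimal adjoint state. If $\mathsf{u}_{\rm d}\in\mathbb{H}^{1-s}(\Omega)$, then $\bar{\mathsf{u}}\in\mathbb{H}^{l}(\Omega)$ with $l=\min\{1+2s,2\}$, and $\bar{\mathsf{p}}\in\mathbb{H}^{\varpi}(\Omega)$ with $\varpi=\min\{1+s,2\}$.
   Context: Let $n\ge 1$, let $\Omega\subset\mathbb{R}^n$ be a bounded, open, convex polytopal domain, and let $s\in(0,1)$. Let $\mathcal{L}w=-\mathrm{div}(A\nabla w)+c\,w$ with homogeneous Dirichlet boundary conditions, where $0\le c\in L^\infty(\Omega)$ and $A\in C^{0,1}(\Omega,\mathrm{GL}(n,\mathbb{R}))$ is symmetric and (uniformly) positive definite. Let $\{(\lambda_k,\varphi_k)\}_{k\in\mathbb{N}}\subset\mathbb{R}_+\times H_0^1(\Omega)$ be the eigenpairs of $\mathcal{L}$ ($\mathcal{L}\varphi_k=\lambda_k\varphi_k$ in $\Omega$, $\varphi_k=0$ on $\partial\Omega$), with $\{\varphi_k\}$ an orthonormal basis of $L^2(\Omega)$. For $w=\sum_k w_k\varphi_k$ with $w_k=\int_\Omega w\varphi_k\,dx'$, set $\mathcal{L}^s w=\sum_k\lambda_k^s w_k\varphi_k$ and, for $r\in(0,2]$, $\mathbb{H}^r(\Omega)=\{w\in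 L^2(\Omega):\|w\|_{\mathbb{H}^r(\Omega)}^2:=\sum_k\lambda_k^r|w_k|^2<\infty\}$; for $r\in(1,2]$ one has $\mathbb{H}^r(\Omega)=H^r(\Omega)\cap H_0^1(\Omega)$. $\mathcal{L}^s$ is an isomorphism from $\mathbb{H}^s(\Omega)$ onto its dual. The control to state map $\mathbf{S}$ sends $\mathsf{z}\in L^2(\Omega)$ to the unique solution $\mathsf{u}\in\mathbb{H}^s(\Omega)$ of $\mathcal{L}^s\mathsf{u}=\mathsf{z}$; $\mathbf{S}^\dagger$ denotes its $L^2(\Omega)$-adjoint (as an operator on $L^2(\Omega)$). Let $\sigma,\nu>0$, let $\mathsf{u}_{\rm d}\in L^2(\Omega)$, and let $\mathsf{a},\mathsf{b}\in\mathbb{R}$ with $\mathsf{a}<0<\mathsf{b}$. Set $$J(\mathsf{u},\mathsf{z})=\tfrac12\|\mathsf{u}-\mathsf{u}_{\rm d}\|_{L^2(\Omega)}^2+\tfrac{\sigma}{2}\|\mathsf{z}\|_{L^2(\Omega)}^2+\nu\|\mathsf{z}\|_{L^1(\Omega)},$$ $\mathsf{Z}_{\rm ad}=\{\mathsf{z}\in L^2(\Omega):\mathsf{a}\le\mathsf{z}(x')\le\mathsf{b}\text{ for a.e. }x'\in\Omega\}$. The fractional optimal control problem is to minimize $J(\mathbf{S}\mathsf{z},\mathsf{z})$ over $\mathsf{z}\in\mathsf{Z}_{\rm ad}$; it has a unique minimizer $\bar{\mathsf{z}}$ (the optimal control). *)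

theory Defs
  imports "HOL-Analysis.Analysis"
begin

text \<open>Functions on \<open>\<Omega>\<close> are represented by total functions; only their values on \<open>\<Omega>\<close>, up to
  \<open>lebesgue_on \<Omega>\<close>-null sets, matter. Elements of \<open>L\<^sup>2\<close> are thus representatives, not classes.\<close>

definition convex_polytopal_domain :: "(real^'n) set \<Rightarrow> bool" where
  "convex_polytopal_domain \<Omega> \<longleftrightarrow>
     \<Omega> \<noteq> {} \<and> open \<Omega> \<and> bounded \<Omega> \<and> convex \<Omega> \<and> polytope (closure \<Omega>)"

definition L2_space :: "(real^'n) set \<Rightarrow> (real^'n \<Rightarrow> real) set" where
  "L2_space \<Omega> =
     {w. w \<in> borel_measurable (lebesgue_on \<Omega>) \<and> integrable (lebesgue_on \<Omega>) (\<lambda>x. (w x)\<^sup>2)}"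

definition L2_inner :: "(real^'n) set \<Rightarrow> (real^'n \<Rightarrow> real) \<Rightarrow> (real^'n \<Rightarrow> real) \<Rightarrow> real" where
  "L2_inner \<Omega> v w = (LINT x|lebesgue_on \<Omega>. v x * w x)"

definition L2_norm :: "(real^'n) set \<Rightarrow> (real^'n \<Rightarrow> real) \<Rightarrow> real" where
  "L2_norm \<Omega> w = sqrt (LINT x|lebesgue_on \<Omega>. (w x)\<^sup>2)"

definition L1_norm :: "(real^'n) set \<Rightarrow> (real^'n \<Rightarrow> real) \<Rightarrow> real" where
  "L1_norm \<Omega> w = (LINT x|lebesgue_on \<Omega>. \<bar>w x\<bar>)"

definition Linfty_space :: "(real^'n) set \<Rightarrow> (real^'n \<Rightarrow> real) set" where
  "Linfty_space \<Omega> =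
     {w. w \<in> borel_measurable (lebesgue_on \<Omega>) \<and> (\<exists>M. AE x in lebesgue_on \<Omega>. \<bar>w x\<bar> \<le> M)}"

definition partial_deriv :: "'n \<Rightarrow> (real^'n \<Rightarrow> real) \<Rightarrow> real^'n \<Rightarrow> real" where
  "partial_deriv i f x = frechet_derivative f (at x) (axis i 1)"

primrec Ck :: "nat \<Rightarrow> (real^'n \<Rightarrow> real) \<Rightarrow> bool" where
  "Ck 0 f \<longleftrightarrow> continuous_on UNIV f"
| "Ck (Suc k) f \<longleftrightarrow> f differentiable_on UNIV \<and> (\<forall>i. Ck k (partial_deriv i f))"

definition test_functions :: "(real^'n) set \<Rightarrow> (real^'n \<Rightarrow> real) set" where
  "test_functions \<Omega> =
     {\<psi>. (\<forall>k. Ck k \<psi>) \<and> compact (closure {x. \<psi> x \<noteq> 0}) \<and> closure {x. \<psi> x \<noteq> 0} \<subseteq> \<Omega>}"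

text \<open>\<open>has_weak_gradient \<Omega> w G\<close> says that \<open>w \<in> H\<^sup>1(\<Omega>)\<close> and \<open>\<nabla>w = G\<close>. The gradient is unique
  only almost everywhere, hence a relation.\<close>

definition has_weak_gradient ::
    "(real^'n) set \<Rightarrow> (real^'n \<Rightarrow> real) \<Rightarrow> (real^'n \<Rightarrow> real^'n) \<Rightarrow> bool" where
  "has_weak_gradient \<Omega> w G \<longleftrightarrow>
     w \<in> L2_space \<Omega> \<and> (\<forall>i. (\<lambda>x. G x $ i) \<in> L2_space \<Omega>) \<and>
     (\<forall>\<psi>\<in>test_functions \<Omega>. \<forall>i.
        L2_inner \<Omega> w (partial_deriv i \<psi>) = - L2_inner \<Omega> (\<lambda>x. G x $ i) \<psi>)"

text \<open>\<open>H\<^sub>0\<^sup>1(\<Omega>)\<close> is the closure of the test functions in \<open>H\<^sup>1(\<Omega>)\<close>.\<close>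

definition H01 :: "(real^'n) set \<Rightarrow> (real^'n \<Rightarrow> real) set" where
  "H01 \<Omega> =
     {w. \<exists>G. has_weak_gradient \<Omega> w G \<and>
        (\<exists>\<psi> :: nat \<Rightarrow> real^'n \<Rightarrow> real. (\<forall>m. \<psi> m \<in> test_functions \<Omega>) \<and>
           (\<lambda>m. L2_norm \<Omega> (\<lambda>x. \<psi> m x - w x)) \<longlonglongrightarrow> 0 \<and>
           (\<forall>i. (\<lambda>m. L2_norm \<Omega> (\<lambda>x. partial_deriv i (\<psi> m) x - G x $ i)) \<longlonglongrightarrow> 0))}"

definition admissible_coefficients ::
    "(real^'n) set \<Rightarrow> (real^'n \<Rightarrow> real^'n^'n) \<Rightarrow> (real^'n \<Rightarrow> real) \<Rightarrow> bool" where
  "admissible_coefficients \<Omega> A c \<longleftrightarrow>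
     (\<exists>C. C-lipschitz_on \<Omega> A) \<and>
     (\<forall>x\<in>\<Omega>. invertible (A x) \<and> transpose (A x) = A x) \<and>
     (\<exists>\<alpha>>0. \<forall>x\<in>\<Omega>. \<forall>\<xi>. \<alpha> * (norm \<xi>)\<^sup>2 \<le> \<xi> \<bullet> (A x *v \<xi>)) \<and>
     c \<in> Linfty_space \<Omega> \<and> (AE x in lebesgue_on \<Omega>. 0 \<le> c x)"

text \<open>Weak form of \<open>- div (A \<nabla>\<phi>) + c \<phi> = \<mu> \<phi>\<close> in \<open>\<Omega>\<close>, \<open>\<phi> = 0\<close> on the boundary.\<close>

definition dirichlet_eigenpair ::
    "(real^'n) set \<Rightarrow> (real^'n \<Rightarrow> real^'n^'n) \<Rightarrow> (real^'n \<Rightarrow> real) \<Rightarrow>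
     real \<Rightarrow> (real^'n \<Rightarrow> real) \<Rightarrow> bool" where
  "dirichlet_eigenpair \<Omega> A c \<mu> \<phi> \<longleftrightarrow>
     \<phi> \<in> H01 \<Omega> \<and> L2_norm \<Omega> \<phi> \<noteq> 0 \<and>
     (\<forall>G v H. has_weak_gradient \<Omega> \<phi> G \<longrightarrow> v \<in> H01 \<Omega> \<longrightarrow> has_weak_gradient \<Omega> v H \<longrightarrow>
        (LINT x|lebesgue_on \<Omega>. (A x *v G x) \<bullet> H x + c x * \<phi> x * v x) = \<mu> * L2_inner \<Omega> \<phi> v)"

definition L2_orthonormal_basis :: "(real^'n) set \<Rightarrow> (nat \<Rightarrow> real^'n \<Rightarrow> real) \<Rightarrow> bool" where
  "L2_orthonormal_basis \<Omega> \<phi> \<longleftrightarrow>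
     (\<forall>k. \<phi> k \<in> L2_space \<Omega>) \<and>
     (\<forall>j k. L2_inner \<Omega> (\<phi> j) (\<phi> k) = (if j = k then 1 else 0)) \<and>
     (\<forall>w\<in>L2_space \<Omega>.
        (\<lambda>N. L2_norm \<Omega> (\<lambda>x. w x - (\<Sum>k<N. L2_inner \<Omega> w (\<phi> k) * \<phi> k x))) \<longlonglongrightarrow> 0)"

definition dirichlet_eigenbasis ::
    "(real^'n) set \<Rightarrow> (real^'n \<Rightarrow> real^'n^'n) \<Rightarrow> (real^'n \<Rightarrow> real) \<Rightarrow>
     (nat \<Rightarrow> real) \<Rightarrow> (nat \<Rightarrow> real^'n \<Rightarrow> real) \<Rightarrow> bool" where
  "dirichlet_eigenbasis \<Omega> A c \<mu> \<phi> \<longleftrightarrow>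
     (\<forall>k. 0 < \<mu> k \<and> dirichlet_eigenpair \<Omega> A c (\<mu> k) (\<phi> k)) \<and> L2_orthonormal_basis \<Omega> \<phi>"

definition Hspec ::
    "(real^'n) set \<Rightarrow> (nat \<Rightarrow> real) \<Rightarrow> (nat \<Rightarrow> real^'n \<Rightarrow> real) \<Rightarrow> real \<Rightarrow> (real^'n \<Rightarrow> real) set" where
  "Hspec \<Omega> \<mu> \<phi> r =
     {w \<in> L2_space \<Omega>. summable (\<lambda>k. \<mu> k powr r * (L2_inner \<Omega> w (\<phi> k))\<^sup>2)}"

text \<open>For \<open>w\<close> in \<open>Hspec \<Omega> \<mu> \<phi> s\<close>, the series \<open>\<Sum>k. \<mu>\<^sub>k\<^sup>s w\<^sub>k \<phi>\<^sub>k\<close> defining \<open>\<L>\<^sup>s w\<close> converges in the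
  dual of \<open>Hspec \<Omega> \<mu> \<phi> s\<close>; it is represented by its action on elements \<open>v\<close> of that space (where
  the series below converges absolutely).\<close>

definition frac_op ::
    "(real^'n) set \<Rightarrow> (nat \<Rightarrow> real) \<Rightarrow> (nat \<Rightarrow> real^'n \<Rightarrow> real) \<Rightarrow> real \<Rightarrow>
     (real^'n \<Rightarrow> real) \<Rightarrow> (real^'n \<Rightarrow> real) \<Rightarrow> real" where
  "frac_op \<Omega> \<mu> \<phi> s w v =
     (\<Sum>k. \<mu> k powr s * L2_inner \<Omega> w (\<phi> k) * L2_inner \<Omega> v (\<phi> k))"

definition solves_state ::
    "(real^'n) set \<Rightarrow> (nat \<Rightarrow> real) \<Rightarrow> (nat \<Rightarrow> real^'n \<Rightarrow> real) \<Rightarrow> real \<Rightarrow>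
     (real^'n \<Rightarrow> real) \<Rightarrow> (real^'n \<Rightarrow> real) \<Rightarrow> bool" where
  "solves_state \<Omega> \<mu> \<phi> s z u \<longleftrightarrow>
     u \<in> Hspec \<Omega> \<mu> \<phi> s \<and> (\<forall>v\<in>Hspec \<Omega> \<mu> \<phi> s. frac_op \<Omega> \<mu> \<phi> s u v = L2_inner \<Omega> z v)"

text \<open>The solution, and likewise the adjoint below, is unique only up to null sets, so \<open>SOME\<close>
  rather than \<open>THE\<close> selects a representative.\<close>

definition control_to_state ::
    "(real^'n) set \<Rightarrow> (nat \<Rightarrow> real) \<Rightarrow> (nat \<Rightarrow> real^'n \<Rightarrow> real) \<Rightarrow> real \<Rightarrow>
     (real^'n \<Rightarrow> real) \<Rightarrow> (real^'n \<Rightarrow> real)" where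
  "control_to_state \<Omega> \<mu> \<phi> s z = (SOME u. solves_state \<Omega> \<mu> \<phi> s z u)"

definition L2_adjoint ::
    "(real^'n) set \<Rightarrow> ((real^'n \<Rightarrow> real) \<Rightarrow> (real^'n \<Rightarrow> real)) \<Rightarrow>
     (real^'n \<Rightarrow> real) \<Rightarrow> (real^'n \<Rightarrow> real)" where
  "L2_adjoint \<Omega> T w =
     (SOME p. p \<in> L2_space \<Omega> \<and> (\<forall>z\<in>L2_space \<Omega>. L2_inner \<Omega> (T z) w = L2_inner \<Omega> z p))"

definition cost ::
    "(real^'n) set \<Rightarrow> real \<Rightarrow> real \<Rightarrow> (real^'n \<Rightarrow> real) \<Rightarrow>
     (real^'n \<Rightarrow> real) \<Rightarrow> (real^'n \<Rightarrow> real) \<Rightarrow> real" where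
  "cost \<Omega> \<sigma> \<nu> u\<^sub>d u z =
     1/2 * (L2_norm \<Omega> (\<lambda>x. u x - u\<^sub>d x))\<^sup>2 + \<sigma>/2 * (L2_norm \<Omega> z)\<^sup>2 + \<nu> * L1_norm \<Omega> z"

definition admissible_controls :: "(real^'n) set \<Rightarrow> real \<Rightarrow> real \<Rightarrow> (real^'n \<Rightarrow> real) set" where
  "admissible_controls \<Omega> a b =
     {z \<in> L2_space \<Omega>. AE x in lebesgue_on \<Omega>. a \<le> z x \<and> z x \<le> b}"

definition optimal_control ::
    "(real^'n) set \<Rightarrow> ((real^'n \<Rightarrow> real) \<Rightarrow> (real^'n \<Rightarrow> real)) \<Rightarrow> real \<Rightarrow> real \<Rightarrow>
     (real^'n \<Rightarrow> real) \<Rightarrow> real \<Rightarrow> real \<Rightarrow> (real^'n \<Rightarrow> real) \<Rightarrow> bool" where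
  "optimal_control \<Omega> S \<sigma> \<nu> u\<^sub>d a b z \<longleftrightarrow>
     z \<in> admissible_controls \<Omega> a b \<and>
     (\<forall>y\<in>admissible_controls \<Omega> a b. cost \<Omega> \<sigma> \<nu> u\<^sub>d (S z) z \<le> cost \<Omega> \<sigma> \<nu> u\<^sub>d (S y) y)"

end

theory Submission
  imports Defs
begin

text \<open>
  The optimal control \<open>z\<close> is shown to lie in \<open>\<H>\<^sup>1\<close> in one step, without the projection
  formula and without a bootstrapping argument. Let \<open>R = (1 + \<epsilon> \<L>)\<^sup>-\<^sup>1\<close>. This resolvent is
  sub-Markovian: it preserves the bounds \<open>a \<le> z \<le> b\<close> and does not increase the \<open>L\<^sup>1\<close> norm, because
  truncation decreases both the energy of \<open>\<L>\<close> and the distance to \<open>z\<close>. Hence \<open>R z\<close> is an admissible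
  competitor, and the first-order optimality condition in the direction \<open>R z - z\<close> reads
  \<open>\<sigma> \<langle>z, (1 - R) z\<rangle> + \<langle>\<L>\<^sup>-\<^sup>2\<^sup>s z, (1 - R) z\<rangle> \<le> \<langle>d, (1 - R) z\<rangle>\<close> with \<open>d = \<L>\<^sup>-\<^sup>s u\<^sub>d \<in> \<H>\<^sup>1\<close>. All operators
  commute, so \<open>\<sigma>\<^sup>2 \<langle>z, (1 - R) z\<rangle> \<le> \<langle>d, (1 - R) d\<rangle>\<close>; dividing by \<open>\<epsilon>\<close> and letting \<open>\<epsilon> \<rightarrow> 0\<close> gives
  \<open>z \<in> \<H>\<^sup>1\<close>. The regularity of state and adjoint is then read off from their Fourier coefficients.
\<close>

subsection \<open>Square-integrable functions\<close>

text \<open>Truncation meets an obstacle: the truncation of a test function is no longer smooth. So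
  the minimiser of the quadratic functional behind R is never truncated itself. Test functions that
  nearly minimise it are passed through a smooth clamp, which does not increase the energy and
  misses the true truncation by at most 2 \<delta>; a quadratic gap in the functional then forces
  the clamped functions towards R z. The L1 term of the cost is not differentiable, but on the
  segment from \<open>z\<close> to R z convexity and the L1 contraction keep it below its value at
  \<open>z\<close>, so it drops out of the first-order condition. The eigenvalues come without
  ordering or growth; a Poincare inequality gives the positive lower bound that makes weaker
  spectral weights summable. Orders: a power \<open>\<L>\<^sup>-\<^sup>s\<close> raises the spectral
  order by 2s. Thus d has order (1-s) + 2s = 1+s, which is more than 1; the state has order 1 + 2s;
  and the adjoint, built from the state minus \<open>u\<^sub>d\<close>, has order (1-s) + 2s =
  1+s.\<close>

lemma L2_space_zero [simp]: "(\<lambda>x. 0) \<in> L2_space \<Omega>"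
  by (simp add: L2_space_def)

lemma L2_space_mult_integrable:
  assumes "v \<in> L2_space \<Omega>" "w \<in> L2_space \<Omega>"
  shows "integrable (lebesgue_on \<Omega>) (\<lambda>x. v x * w x)"
proof (rule Bochner_Integration.integrable_bound)
  show "integrable (lebesgue_on \<Omega>) (\<lambda>x. (v x)\<^sup>2 + (w x)\<^sup>2)"
    using assms by (auto simp: L2_space_def)
  show "(\<lambda>x. v x * w x) \<in> borel_measurable (lebesgue_on \<Omega>)"
    using assms by (auto simp: L2_space_def)
  have "\<bar>v x * w x\<bar> \<le> (v x)\<^sup>2 + (w x)\<^sup>2" for x
  proof -
    have "2 * \<bar>v x * w x\<bar> \<le> (v x)\<^sup>2 + (w x)\<^sup>2"
      using sum_squares_bound[of "\<bar>v x\<bar>" "\<bar>w x\<bar>"] by (simp add: abs_mult)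
    then show ?thesis by linarith
  qed
  then show "AE x in lebesgue_on \<Omega>. norm (v x * w x) \<le> norm ((v x)\<^sup>2 + (w x)\<^sup>2)"
    by simp
qed

lemma L2_space_scale:
  assumes "v \<in> L2_space \<Omega>"
  shows "(\<lambda>x. r * v x) \<in> L2_space \<Omega>"
  using assms by (auto simp: L2_space_def power_mult_distrib)

lemma L2_space_add:
  assumes "v \<in> L2_space \<Omega>" "w \<in> L2_space \<Omega>"
  shows "(\<lambda>x. v x + w x) \<in> L2_space \<Omega>"
proof -
  have "integrable (lebesgue_on \<Omega>) (\<lambda>x. (v x)\<^sup>2 + (w x)\<^sup>2 + 2 * (v x * w x))"
    using assms L2_space_mult_integrable[OF assms] by (auto simp: L2_space_def)
  then show ?thesis
    using assms by (auto simp: L2_space_def power2_sum algebra_simps)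
qed

lemma L2_space_diff:
  assumes "v \<in> L2_space \<Omega>" "w \<in> L2_space \<Omega>"
  shows "(\<lambda>x. v x - w x) \<in> L2_space \<Omega>"
  using L2_space_add[OF assms(1) L2_space_scale[OF assms(2), of "-1"]] by simp

lemma L2_space_sum:
  assumes "\<And>i. i \<in> I \<Longrightarrow> f i \<in> L2_space \<Omega>"
  shows "(\<lambda>x. \<Sum>i\<in>I. f i x) \<in> L2_space \<Omega>"
  using assms by (induction I rule: infinite_finite_induct) (auto intro: L2_space_add)

lemma L2_space_dominated:
  assumes "w \<in> L2_space \<Omega>" "v \<in> borel_measurable (lebesgue_on \<Omega>)"
    "AE x in lebesgue_on \<Omega>. \<bar>v x\<bar> \<le> \<bar>w x\<bar>"
  shows "v \<in> L2_space \<Omega>"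
proof -
  have "integrable (lebesgue_on \<Omega>) (\<lambda>x. (v x)\<^sup>2)"
    by (rule Bochner_Integration.integrable_bound[of _ "\<lambda>x. (w x)\<^sup>2"])
       (use assms in \<open>auto simp: L2_space_def abs_le_square_iff\<close>)
  then show ?thesis using assms by (simp add: L2_space_def)
qed

lemma L2_inner_commute: "L2_inner \<Omega> v w = L2_inner \<Omega> w v"
  by (simp add: L2_inner_def mult.commute)

lemma L2_inner_add_left:
  assumes "u \<in> L2_space \<Omega>" "v \<in> L2_space \<Omega>" "w \<in> L2_space \<Omega>"
  shows "L2_inner \<Omega> (\<lambda>x. u x + v x) w = L2_inner \<Omega> u w + L2_inner \<Omega> v w"
  using assms by (simp add: L2_inner_def distrib_right L2_space_mult_integrable)

lemma L2_inner_diff_left: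
  assumes "u \<in> L2_space \<Omega>" "v \<in> L2_space \<Omega>" "w \<in> L2_space \<Omega>"
  shows "L2_inner \<Omega> (\<lambda>x. u x - v x) w = L2_inner \<Omega> u w - L2_inner \<Omega> v w"
  using assms by (simp add: L2_inner_def left_diff_distrib L2_space_mult_integrable)

lemma L2_inner_scale_left: "L2_inner \<Omega> (\<lambda>x. r * v x) w = r * L2_inner \<Omega> v w"
  by (simp add: L2_inner_def mult.assoc)

lemma L2_inner_sum_left:
  assumes "\<And>i. i \<in> I \<Longrightarrow> f i \<in> L2_space \<Omega>" "w \<in> L2_space \<Omega>"
  shows "L2_inner \<Omega> (\<lambda>x. \<Sum>i\<in>I. f i x) w = (\<Sum>i\<in>I. L2_inner \<Omega> (f i) w)"
proof -
  have "L2_inner \<Omega> (\<lambda>x. 0) w = 0" by (simp add: L2_inner_def)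
  then show ?thesis
    using assms
    by (induction I rule: infinite_finite_induct) (auto simp: L2_inner_add_left L2_space_sum)
qed

lemma L2_norm_nonneg [simp]: "0 \<le> L2_norm \<Omega> w"
  by (simp add: L2_norm_def)

lemma L2_norm_sq: "(L2_norm \<Omega> w)\<^sup>2 = L2_inner \<Omega> w w"
  by (simp add: L2_norm_def L2_inner_def power2_eq_square)

lemma L2_inner_add_right:
  assumes "u \<in> L2_space \<Omega>" "v \<in> L2_space \<Omega>" "w \<in> L2_space \<Omega>"
  shows "L2_inner \<Omega> w (\<lambda>x. u x + v x) = L2_inner \<Omega> w u + L2_inner \<Omega> w v"
  using L2_inner_add_left[OF assms] by (simp only: L2_inner_commute[of \<Omega> w])

lemma L2_inner_scale_right: "L2_inner \<Omega> v (\<lambda>x. r * w x) = r * L2_inner \<Omega> v w"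
  using L2_inner_scale_left[of \<Omega> r w v] by (simp only: L2_inner_commute[of \<Omega> v])

lemma L2_norm_sq_add:
  assumes "v \<in> L2_space \<Omega>" "w \<in> L2_space \<Omega>"
  shows "(L2_norm \<Omega> (\<lambda>x. v x + w x))\<^sup>2 = (L2_norm \<Omega> v)\<^sup>2 + 2 * L2_inner \<Omega> v w + (L2_norm \<Omega> w)\<^sup>2"
  unfolding L2_norm_sq using assms L2_inner_commute[of \<Omega> w v]
  by (simp add: L2_inner_add_left L2_inner_add_right L2_space_add)

lemma L2_norm_scale: "L2_norm \<Omega> (\<lambda>x. r * w x) = \<bar>r\<bar> * L2_norm \<Omega> w"
  by (simp add: L2_norm_def power_mult_distrib real_sqrt_mult)

lemma L2_norm_sq_diff:
  assumes "v \<in> L2_space \<Omega>" "w \<in> L2_space \<Omega>"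
  shows "(L2_norm \<Omega> (\<lambda>x. v x - w x))\<^sup>2 = (L2_norm \<Omega> v)\<^sup>2 - 2 * L2_inner \<Omega> v w + (L2_norm \<Omega> w)\<^sup>2"
proof -
  have "L2_inner \<Omega> v (\<lambda>x. - 1 * w x) = - L2_inner \<Omega> v w"
    by (simp only: L2_inner_scale_right)
  then show ?thesis
    using L2_norm_sq_add[OF assms(1) L2_space_scale[OF assms(2), of "-1"]] L2_norm_scale[of \<Omega> "-1" w]
    by simp
qed

lemma L2_Cauchy_Schwarz:
  assumes "v \<in> L2_space \<Omega>" "w \<in> L2_space \<Omega>"
  shows "\<bar>L2_inner \<Omega> v w\<bar> \<le> L2_norm \<Omega> v * L2_norm \<Omega> w"
proof (rule power2_le_imp_le)
  define p q r where "p = (L2_norm \<Omega> v)\<^sup>2" and "q = L2_inner \<Omega> v w" and "r = (L2_norm \<Omega> w)\<^sup>2"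
  have *: "0 \<le> p + 2 * t * q + t\<^sup>2 * r" for t
    using L2_norm_sq_add[OF assms(1) L2_space_scale[OF assms(2), of t]]
      zero_le_power2[of "L2_norm \<Omega> (\<lambda>x. v x + t * w x)"]
    by (simp add: L2_norm_scale power_mult_distrib L2_inner_scale_right p_def q_def r_def mult.assoc)
  have "q\<^sup>2 \<le> p * r"
  proof (cases "r = 0")
    case True
    have "q = 0"
    proof (rule ccontr)
      assume "q \<noteq> 0"
      \<comment> \<open>With r = 0 the quadratic is affine in t, and this t gives it the value
        -1.\<close>
      then show False using *[of "- (p + 1) / (2 * q)"] True by (simp add: field_simps)
    qed
    then show ?thesis using True by simp
  next
    case False
    then have "r > 0" by (simp add: r_def)
    \<comment> \<open>The minimiser of the quadratic in t, where its value is p - q^2 / r.\<close>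
    then show ?thesis using *[of "- q / r"] by (simp add: field_simps power2_eq_square)
  qed
  then show "\<bar>L2_inner \<Omega> v w\<bar>\<^sup>2 \<le> (L2_norm \<Omega> v * L2_norm \<Omega> w)\<^sup>2"
    by (simp add: p_def q_def r_def power_mult_distrib)
qed simp

lemma L2_norm_triangle:
  assumes "v \<in> L2_space \<Omega>" "w \<in> L2_space \<Omega>"
  shows "L2_norm \<Omega> (\<lambda>x. v x + w x) \<le> L2_norm \<Omega> v + L2_norm \<Omega> w"
proof (rule power2_le_imp_le)
  show "(L2_norm \<Omega> (\<lambda>x. v x + w x))\<^sup>2 \<le> (L2_norm \<Omega> v + L2_norm \<Omega> w)\<^sup>2"
    using L2_Cauchy_Schwarz[OF assms] by (simp add: L2_norm_sq_add[OF assms] power2_sum)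
qed simp

lemma L2_norm_sum_le:
  assumes "\<And>i. i \<in> I \<Longrightarrow> f i \<in> L2_space \<Omega>"
  shows "L2_norm \<Omega> (\<lambda>x. \<Sum>i\<in>I. f i x) \<le> (\<Sum>i\<in>I. L2_norm \<Omega> (f i))"
proof -
  have "L2_norm \<Omega> (\<lambda>x. 0) = 0" by (simp add: L2_norm_def)
  then show ?thesis
    using assms
    by (induction I rule: infinite_finite_induct)
       (auto intro!: order_trans[OF L2_norm_triangle] L2_space_sum)
qed

lemma L2_norm_mono:
  assumes "w \<in> L2_space \<Omega>" "v \<in> borel_measurable (lebesgue_on \<Omega>)"
    "AE x in lebesgue_on \<Omega>. \<bar>v x\<bar> \<le> \<bar>w x\<bar>"
  shows "L2_norm \<Omega> v \<le> L2_norm \<Omega> w"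
  unfolding L2_norm_def
  by (rule real_sqrt_le_mono, rule integral_mono_AE)
     (use L2_space_dominated[OF assms] assms in \<open>auto simp: L2_space_def abs_le_square_iff\<close>)

lemma L2_inner_tendsto_left:
  assumes "\<And>m. v m \<in> L2_space \<Omega>" "w \<in> L2_space \<Omega>" "f \<in> L2_space \<Omega>"
    and lim: "(\<lambda>m. L2_norm \<Omega> (\<lambda>x. v m x - w x)) \<longlonglongrightarrow> 0"
  shows "(\<lambda>m. L2_inner \<Omega> (v m) f) \<longlonglongrightarrow> L2_inner \<Omega> w f"
proof (rule LIM_zero_cancel, rule Lim_null_comparison)
  show "\<forall>\<^sub>F m in sequentially. norm (L2_inner \<Omega> (v m) f - L2_inner \<Omega> w f)
      \<le> L2_norm \<Omega> (\<lambda>x. v m x - w x) * L2_norm \<Omega> f"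
    using L2_Cauchy_Schwarz[OF L2_space_diff[OF assms(1,2)] assms(3)] assms(1-3)
    by (simp add: L2_inner_diff_left)
  show "(\<lambda>m. L2_norm \<Omega> (\<lambda>x. v m x - w x) * L2_norm \<Omega> f) \<longlonglongrightarrow> 0"
    using tendsto_mult_right[OF lim, of "L2_norm \<Omega> f"] by simp
qed

subsection \<open>Fourier coefficients\<close>

locale L2_basis =
  fixes \<Omega> :: "(real^'n) set" and \<phi> :: "nat \<Rightarrow> real^'n \<Rightarrow> real"
  assumes basis: "L2_orthonormal_basis \<Omega> \<phi>"
begin

abbreviation coeff :: "(real^'n \<Rightarrow> real) \<Rightarrow> nat \<Rightarrow> real" where
  "coeff w k \<equiv> L2_inner \<Omega> w (\<phi> k)"

lemma basis_L2 [simp]: "\<phi> k \<in> L2_space \<Omega>"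
  using basis by (simp add: L2_orthonormal_basis_def)

lemma coeff_basis [simp]: "coeff (\<phi> j) k = (if j = k then 1 else 0)"
  using basis by (simp add: L2_orthonormal_basis_def)

lemma combination_L2 [simp]: "(\<lambda>x. \<Sum>k\<in>K. c k * \<phi> k x) \<in> L2_space \<Omega>"
  by (intro L2_space_sum L2_space_scale) simp

lemma inner_combination:
  assumes "w \<in> L2_space \<Omega>"
  shows "L2_inner \<Omega> (\<lambda>x. \<Sum>k\<in>K. c k * \<phi> k x) w = (\<Sum>k\<in>K. c k * coeff w k)"
  using assms L2_inner_commute[of \<Omega> w]
  by (simp add: L2_inner_sum_left L2_space_scale L2_inner_scale_left)

lemma coeff_combination:
  assumes "finite K"
  shows "coeff (\<lambda>x. \<Sum>k\<in>K. c k * \<phi> k x) j = (if j \<in> K then c j else 0)"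
  using assms by (simp add: inner_combination if_distrib cong: if_cong)

lemma norm_combination:
  assumes "finite K"
  shows "(L2_norm \<Omega> (\<lambda>x. \<Sum>k\<in>K. c k * \<phi> k x))\<^sup>2 = (\<Sum>k\<in>K. (c k)\<^sup>2)"
  unfolding L2_norm_sq
  by (subst inner_combination) (auto simp: coeff_combination assms power2_eq_square intro!: sum.cong)

lemma norm_diff_partial_sum:
  assumes "w \<in> L2_space \<Omega>"
  shows "(L2_norm \<Omega> (\<lambda>x. w x - (\<Sum>k<N. coeff w k * \<phi> k x)))\<^sup>2
    = (L2_norm \<Omega> w)\<^sup>2 - (\<Sum>k<N. (coeff w k)\<^sup>2)"
  using inner_combination[OF assms, of "coeff w" "{..<N}"]
    L2_inner_commute[of \<Omega> w "\<lambda>x. \<Sum>k<N. coeff w k * \<phi> k x"]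
  by (subst L2_norm_sq_diff) (auto simp: assms norm_combination power2_eq_square[symmetric])

lemma Parseval:
  assumes "w \<in> L2_space \<Omega>"
  shows "(\<lambda>k. (coeff w k)\<^sup>2) sums (L2_norm \<Omega> w)\<^sup>2"
proof -
  have "(\<lambda>N. L2_norm \<Omega> (\<lambda>x. w x - (\<Sum>k<N. coeff w k * \<phi> k x))) \<longlonglongrightarrow> 0"
    using basis assms by (simp add: L2_orthonormal_basis_def)
  from tendsto_power[OF this, of 2]
  have "(\<lambda>N. (L2_norm \<Omega> w)\<^sup>2 - (\<Sum>k<N. (coeff w k)\<^sup>2)) \<longlonglongrightarrow> 0"
    by (simp add: norm_diff_partial_sum assms)
  from tendsto_diff[OF tendsto_const this, of "(L2_norm \<Omega> w)\<^sup>2"]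
  show ?thesis by (simp add: sums_def)
qed

text \<open>Polarisation of \<open>Parseval\<close>, applied to v, w and v + w.\<close>

lemma Parseval_inner:
  assumes "v \<in> L2_space \<Omega>" "w \<in> L2_space \<Omega>"
  shows "(\<lambda>k. coeff v k * coeff w k) sums L2_inner \<Omega> v w"
proof -
  have "(\<lambda>k. ((coeff (\<lambda>x. v x + w x) k)\<^sup>2 - (coeff v k)\<^sup>2 - (coeff w k)\<^sup>2) / 2) sums
      (((L2_norm \<Omega> (\<lambda>x. v x + w x))\<^sup>2 - (L2_norm \<Omega> v)\<^sup>2 - (L2_norm \<Omega> w)\<^sup>2) / 2)"
    by (intro sums_divide sums_diff Parseval L2_space_add assms)
  then show ?thesis
    using assms by (simp add: L2_inner_add_left power2_sum L2_norm_sq_add)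
qed

text \<open>\<open>control_to_state\<close> chooses representatives, so it is linear only up to null
  sets. Its values are compared through their coefficients, and this lemma turns such a comparison
  into one of norms.\<close>

lemma coeff_eq_imp_norm_eq:
  assumes "v \<in> L2_space \<Omega>" "w \<in> L2_space \<Omega>" "\<And>k. coeff v k = coeff w k"
  shows "L2_norm \<Omega> v = L2_norm \<Omega> w"
proof (rule power2_eq_imp_eq)
  have "(\<lambda>k. (coeff w k)\<^sup>2) sums (L2_norm \<Omega> v)\<^sup>2"
    using Parseval[OF assms(1)] assms(3) by simp
  then show "(L2_norm \<Omega> v)\<^sup>2 = (L2_norm \<Omega> w)\<^sup>2"
    using Parseval[OF assms(2)] by (rule sums_unique2)
qed simp_all


text \<open>The classical completeness argument: a subsequence of the partial sums has increments
  with geometrically small norms, so it converges absolutely almost everywhere under a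
  square-integrable majorant, and dominated convergence carries the coefficients to the
  limit.\<close>

theorem Riesz_Fischer:
  assumes c: "summable (\<lambda>k. (c k)\<^sup>2)"
  obtains w where "w \<in> L2_space \<Omega>" "\<And>k. coeff w k = c k"
proof -
  define M where "M = lebesgue_on \<Omega>"
  define P where "P N x = (\<Sum>k<N. c k * \<phi> k x)" for N :: nat and x
  have P_L2 [simp]: "P N \<in> L2_space \<Omega>" for N
    unfolding P_def by simp
  have P_diff: "P n x - P m x = (\<Sum>k\<in>{m..<n}. c k * \<phi> k x)" if "m \<le> n" for m n x
    using sum_diff_nat_ivl[of 0 m n "\<lambda>k. c k * \<phi> k x"] that by (simp add: P_def lessThan_atLeast0)
  \<comment> \<open>The square of (1/2)^j: the tails bound squared norms, and the norms themselves
    have to be summable.\<close>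
  have "\<exists>N. \<forall>m\<ge>N. \<forall>n. \<bar>\<Sum>k\<in>{m..<n}. (c k)\<^sup>2\<bar> < (1/4)^j" for j :: nat
    using c unfolding summable_Cauchy real_norm_def by (rule allE[of _ "(1/4)^j"]) simp
  then obtain N where N: "\<And>j m n. m \<ge> N j \<Longrightarrow> \<bar>\<Sum>k\<in>{m..<n}. (c k)\<^sup>2\<bar> < (1/4::real)^j"
    by metis
  \<comment> \<open>The sum makes \<open>n\<close> monotone and at least \<open>N j\<close>; the
    summand j makes it unbounded, so that every coefficient is eventually reached.\<close>
  define n where "n j = j + (\<Sum>i\<le>j. N i)" for j
  have n_mono: "n j \<le> n (Suc j)" and n_ge: "j \<le> n j" and n_N: "N j \<le> n j" for j
    by (auto simp: n_def intro: trans_le_add2 member_le_sum)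
  define f where "f j x = P (n (Suc j)) x - P (n j) x" for j x
  have f_L2 [simp]: "f j \<in> L2_space \<Omega>" for j
    unfolding f_def by (intro L2_space_diff P_L2)
  have f_norm: "L2_norm \<Omega> (f j) \<le> (1/2)^j" for j
  proof (rule power2_le_imp_le)
    have "f j = (\<lambda>x. \<Sum>k\<in>{n j..<n (Suc j)}. c k * \<phi> k x)"
      using P_diff[OF n_mono] by (auto simp: f_def)
    then have "(L2_norm \<Omega> (f j))\<^sup>2 = (\<Sum>k\<in>{n j..<n (Suc j)}. (c k)\<^sup>2)"
      by (simp add: norm_combination)
    also have "\<dots> \<le> (1/4)^j" using N[OF n_N, of j "n (Suc j)"] by linarith
    also have "\<dots> = ((1/2)^j)\<^sup>2" by (simp add: power2_eq_square power_mult_distrib[symmetric])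
    finally show "(L2_norm \<Omega> (f j))\<^sup>2 \<le> ((1/2)^j)\<^sup>2" .
  qed simp
  \<comment> \<open>An increasing majorant of the subsequence, by telescoping.\<close>
  define h where "h J x = \<bar>P (n 0) x\<bar> + (\<Sum>j<J. \<bar>f j x\<bar>)" for J x
  have abs_L2: "(\<lambda>x. \<bar>v x\<bar>) \<in> L2_space \<Omega>" if "v \<in> L2_space \<Omega>" for v
    using that by (auto simp: L2_space_def)
  have norm_abs: "L2_norm \<Omega> (\<lambda>x. \<bar>v x\<bar>) = L2_norm \<Omega> v" for v
    by (simp add: L2_norm_def)
  have h_L2: "h J \<in> L2_space \<Omega>" for J
    unfolding h_def by (intro L2_space_add L2_space_sum abs_L2) auto
  \<comment> \<open>The 2 is the sum of the geometric series of the (1/2)^j.\<close>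
  define K where "K = L2_norm \<Omega> (P (n 0)) + 2"
  have h_norm: "L2_norm \<Omega> (h J) \<le> K" for J
  proof -
    have "L2_norm \<Omega> (h J) \<le> L2_norm \<Omega> (P (n 0)) + L2_norm \<Omega> (\<lambda>x. \<Sum>j<J. \<bar>f j x\<bar>)"
      unfolding h_def
      using L2_norm_triangle[OF abs_L2[OF P_L2] L2_space_sum[OF abs_L2[OF f_L2]]]
      by (simp add: norm_abs)
    also have "L2_norm \<Omega> (\<lambda>x. \<Sum>j<J. \<bar>f j x\<bar>) \<le> (\<Sum>j<J. L2_norm \<Omega> (f j))"
      using L2_norm_sum_le[of "{..<J}" "\<lambda>j x. \<bar>f j x\<bar>" \<Omega>, OF abs_L2[OF f_L2]]
      by (simp add: norm_abs)
    also have "\<dots> \<le> (\<Sum>j<J. (1/2)^j)" by (intro sum_mono f_norm)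
    also have "\<dots> \<le> 2" using sum_le_suminf[of "\<lambda>j. (1/2::real)^j" "{..<J}"]
      by (simp add: suminf_geometric summable_geometric)
    finally show ?thesis by (simp add: K_def)
  qed
  have h_nonneg: "0 \<le> h J x" for J x
    by (simp add: h_def sum_nonneg)
  have h_mono: "h J x \<le> h J' x" if "J \<le> J'" for J J' x
    unfolding h_def using that by (auto intro!: add_left_mono sum_mono2)
  have h_meas [measurable]: "h J \<in> borel_measurable M" for J
    using h_L2 by (auto simp: L2_space_def M_def)
  have f_meas [measurable]: "f J \<in> borel_measurable M" for J
    using f_L2 by (auto simp: L2_space_def M_def)
  have P_meas [measurable]: "P J \<in> borel_measurable M" for J
    using P_L2 by (auto simp: L2_space_def M_def)
  have h_int: "(\<integral>\<^sup>+x. ennreal ((h J x)\<^sup>2) \<partial>M) \<le> ennreal (K\<^sup>2)" for J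
  proof -
    have "(\<integral>\<^sup>+x. ennreal ((h J x)\<^sup>2) \<partial>M) = ennreal ((L2_norm \<Omega> (h J))\<^sup>2)"
      using h_L2[of J] by (subst nn_integral_eq_integral) (auto simp: L2_space_def L2_norm_def M_def)
    also have "\<dots> \<le> ennreal (K\<^sup>2)"
      by (intro ennreal_leI power_mono h_norm) simp
    finally show ?thesis .
  qed
  have SUP_int: "(\<integral>\<^sup>+x. (SUP J. ennreal ((h J x)\<^sup>2)) \<partial>M) \<le> ennreal (K\<^sup>2)"
    by (subst nn_integral_monotone_convergence_SUP)
       (auto intro!: SUP_least h_int simp: incseq_def le_fun_def h_mono h_nonneg ennreal_leI power_mono)
  have AE_fin: "AE x in M. (SUP J. ennreal ((h J x)\<^sup>2)) \<noteq> \<infinity>"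
    using SUP_int by (intro nn_integral_PInf_AE) (auto simp: top_unique)
  \<comment> \<open>The square of the limit of the majorants. \<open>enn2real\<close> returns 0
    where the supremum is infinite, which is a null set by \<open>AE_fin\<close>.\<close>
  define H where "H x = enn2real (SUP J. ennreal ((h J x)\<^sup>2))" for x
  have H_meas [measurable]: "H \<in> borel_measurable M"
    unfolding H_def by measurable
  have H_nonneg: "0 \<le> H x" for x by (simp add: H_def)
  have H_integrable: "integrable M H"
  proof (rule integrableI_bounded)
    have "(\<integral>\<^sup>+x. ennreal (norm (H x)) \<partial>M) \<le> (\<integral>\<^sup>+x. (SUP J. ennreal ((h J x)\<^sup>2)) \<partial>M)"
      by (intro nn_integral_mono) (simp add: H_def ennreal_enn2real_if)
    also have "\<dots> < \<infinity>" using SUP_int by (simp add: order_le_less_trans)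
    finally show "(\<integral>\<^sup>+x. ennreal (norm (H x)) \<partial>M) < \<infinity>" .
  qed simp
  have h_le_H: "AE x in M. \<forall>J. h J x \<le> sqrt (H x)"
    using AE_fin
  proof eventually_elim
    case (elim x)
    show ?case
    proof
      fix J
      have "ennreal ((h J x)\<^sup>2) \<le> (SUP J. ennreal ((h J x)\<^sup>2))" by (rule SUP_upper) simp
      also have "\<dots> = ennreal (H x)" 
        unfolding H_def using elim by (metis ennreal_enn2real less_top infinity_ennreal_def)
      finally have "(h J x)\<^sup>2 \<le> H x" by (simp add: H_nonneg)
      then show "h J x \<le> sqrt (H x)" by (rule real_le_rsqrt)
    qed
  qed
  have P_telescope: "P (n j) x = P (n 0) x + (\<Sum>i<j. f i x)" for j x
    by (induction j) (auto simp: f_def)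
  have P_le_h: "\<bar>P (n j) x\<bar> \<le> h j x" for j x
    unfolding h_def P_telescope[of j] by (intro order_trans[OF abs_triangle_ineq] add_left_mono sum_abs)
  \<comment> \<open>Where the subsequence diverges, the value of \<open>lim\<close> is arbitrary;
    this happens only on a null set.\<close>
  define w where "w x = lim (\<lambda>j. P (n j) x)" for x
  have w_lim: "AE x in M. (\<lambda>j. P (n j) x) \<longlonglongrightarrow> w x"
    using h_le_H
  proof eventually_elim
    case (elim x)
    have "summable (\<lambda>j. \<bar>f j x\<bar>)"
    proof (rule summableI_nonneg_bounded)
      show "(\<Sum>i<j. \<bar>f i x\<bar>) \<le> sqrt (H x)" for j
        using elim[rule_format, of j] by (simp add: h_def)
    qed simp
    then have "summable (\<lambda>j. f j x)" by (rule summable_rabs_cancel)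
    then have "(\<lambda>j. P (n 0) x + (\<Sum>i<j. f i x)) \<longlonglongrightarrow> P (n 0) x + (\<Sum>i. f i x)"
      by (intro tendsto_add tendsto_const summable_LIMSEQ)
    then have "convergent (\<lambda>j. P (n j) x)"
      unfolding P_telescope[symmetric] convergent_def by blast
    then show ?case by (simp add: w_def convergent_LIMSEQ_iff)
  qed
  have w_meas [measurable]: "w \<in> borel_measurable M"
    unfolding w_def by (rule borel_measurable_lim_metric) simp
  have sqrtH: "(\<lambda>x. sqrt (H x)) \<in> L2_space \<Omega>"
    using H_integrable H_meas by (auto simp: L2_space_def M_def H_nonneg)
  have w_le: "AE x in M. \<bar>w x\<bar> \<le> sqrt (H x)"
    using w_lim h_le_H
  proof eventually_elim
    case (elim x)
    show ?case
      by (rule LIMSEQ_le_const2[OF tendsto_rabs[OF elim(1)]])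
         (use P_le_h elim(2) order_trans in blast)
  qed
  have w_L2: "w \<in> L2_space \<Omega>"
    by (rule L2_space_dominated[OF sqrtH]) (use w_meas[unfolded M_def] w_le[unfolded M_def] H_nonneg in simp_all)
  have "coeff w k = c k" for k
  proof -
    have \<phi>_meas [measurable]: "\<phi> k \<in> borel_measurable M"
      using basis_L2[of k] by (auto simp: L2_space_def M_def)
    have "(\<lambda>j. integral\<^sup>L M (\<lambda>x. P (n j) x * \<phi> k x)) \<longlonglongrightarrow> integral\<^sup>L M (\<lambda>x. w x * \<phi> k x)"
    proof (rule integral_dominated_convergence)
      show "integrable M (\<lambda>x. sqrt (H x) * \<bar>\<phi> k x\<bar>)"
        unfolding M_def by (rule L2_space_mult_integrable[OF sqrtH abs_L2]) simp
      show "AE x in M. (\<lambda>j. P (n j) x * \<phi> k x) \<longlonglongrightarrow> w x * \<phi> k x"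
        using w_lim by eventually_elim (intro tendsto_mult tendsto_const)
      show "AE x in M. norm (P (n j) x * \<phi> k x) \<le> sqrt (H x) * \<bar>\<phi> k x\<bar>" for j
        using h_le_H
      proof eventually_elim
        case (elim x)
        have "\<bar>P (n j) x\<bar> \<le> sqrt (H x)" using P_le_h elim order_trans by blast
        then show ?case by (simp add: abs_mult mult_right_mono)
      qed
    qed simp_all
    then have "(\<lambda>j. coeff (P (n j)) k) \<longlonglongrightarrow> coeff w k"
      by (simp add: L2_inner_def M_def)
    moreover have "coeff (P (n j)) k = c k" if "Suc k \<le> j" for j
    proof -
      have "k < n j" using n_ge[of j] that by linarith
      then show ?thesis unfolding P_def by (simp only: coeff_combination finite_lessThan lessThan_iff if_True)
    qed
    then have "(\<lambda>j. coeff (P (n j)) k) \<longlonglongrightarrow> c k"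
      by (intro tendsto_eventually eventually_sequentiallyI)
    ultimately show ?thesis by (rule LIMSEQ_unique)
  qed
  with w_L2 that show ?thesis by blast
qed

end

subsection \<open>Differential calculus\<close>

lemma partial_deriv_eq:
  assumes "(f has_derivative D) (at x)"
  shows "partial_deriv i f x = D (axis i 1)"
  using frechet_derivative_at[OF assms] by (simp add: partial_deriv_def)

lemma has_derivative_frechet:
  assumes "f differentiable_on UNIV"
  shows "(f has_derivative frechet_derivative f (at x)) (at x)"
  using assms by (simp add: differentiable_on_def frechet_derivative_works)

lemma partial_deriv_add:
  assumes "f differentiable_on UNIV" "g differentiable_on UNIV"
  shows "partial_deriv i (\<lambda>x. f x + g x) = (\<lambda>x. partial_deriv i f x + partial_deriv i g x)"
  using partial_deriv_eq[OF has_derivative_add[OF assms[THEN has_derivative_frechet]]]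
  by (auto simp: partial_deriv_def)

lemma partial_deriv_mult:
  assumes "f differentiable_on UNIV" "g differentiable_on UNIV"
  shows "partial_deriv i (\<lambda>x. f x * g x) = (\<lambda>x. f x * partial_deriv i g x + partial_deriv i f x * g x)"
  using partial_deriv_eq[OF has_derivative_mult[OF assms[THEN has_derivative_frechet]]]
  by (auto simp: partial_deriv_def)

lemma partial_deriv_const: "partial_deriv i (\<lambda>x. r) = (\<lambda>x. 0)"
  using partial_deriv_eq[OF has_derivative_const] by auto

lemma partial_deriv_component: "partial_deriv i (\<lambda>x. x $ j) = (\<lambda>x. if i = j then 1 else 0)"
proof
  fix x :: "real^'a"
  have "((\<lambda>x. x $ j) has_derivative (\<lambda>x. x $ j)) (at x)"
    by (intro bounded_linear_imp_has_derivative bounded_linear_vec_nth)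
  then show "partial_deriv i (\<lambda>x. x $ j) x = (if i = j then 1 else 0)"
    by (simp add: partial_deriv_eq axis_def)
qed

lemma has_derivative_chain_real:
  assumes "(f has_derivative D) (at x)" "(g has_real_derivative g') (at (f x))"
  shows "((\<lambda>x. g (f x)) has_derivative (\<lambda>v. g' * D v)) (at x)"
  using has_derivative_compose[OF assms(1) assms(2)[unfolded has_field_derivative_def]] .

lemma partial_deriv_chain:
  assumes "f differentiable_on UNIV" "\<And>x. (g has_real_derivative g' (f x)) (at (f x))"
  shows "partial_deriv i (\<lambda>x. g (f x)) = (\<lambda>x. g' (f x) * partial_deriv i f x)"
  using partial_deriv_eq[OF has_derivative_chain_real[OF has_derivative_frechet[OF assms(1)] assms(2)]]
  by (auto simp: partial_deriv_def)

section \<open>Smoothness classes under algebraic operations and square roots\<close>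

lemma Ck_SucD: "Ck (Suc k) f \<Longrightarrow> Ck k f"
  by (induction k arbitrary: f) (auto intro: differentiable_imp_continuous_on)

lemma Ck_const: "Ck k (\<lambda>x. r)"
  by (induction k arbitrary: r) (auto simp: partial_deriv_const)

lemma Ck_component: "Ck k (\<lambda>x. x $ j)"
  by (cases k)
     (auto simp: partial_deriv_component Ck_const continuous_on_component
       intro!: linear_imp_differentiable_on bounded_linear.linear bounded_linear_vec_nth)

lemma Ck_add: "Ck k f \<Longrightarrow> Ck k g \<Longrightarrow> Ck k (\<lambda>x. f x + g x)"
  by (induction k arbitrary: f g)
     (auto simp: partial_deriv_add intro: continuous_on_add differentiable_on_add)

lemma Ck_mult: "Ck k f \<Longrightarrow> Ck k g \<Longrightarrow> Ck k (\<lambda>x. f x * g x)"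
proof (induction k arbitrary: f g)
  case 0
  then show ?case by (auto intro: continuous_on_mult)
next
  case (Suc k)
  have "Ck k f" "Ck k g" using Suc.prems by (blast intro: Ck_SucD)+
  then show ?case using Suc by (auto simp: partial_deriv_mult intro!: Ck_add differentiable_on_mult)
qed

lemma differentiable_on_chain_real:
  assumes "f differentiable_on UNIV" "\<And>x. (g has_real_derivative g' (f x)) (at (f x))"
  shows "(\<lambda>x. g (f x)) differentiable_on UNIV"
  using has_derivative_chain_real[OF has_derivative_frechet[OF assms(1)] assms(2)]
  by (auto simp: differentiable_on_def differentiable_def)

text \<open>The function \<open>q = f\<^sup>-\<^sup>1\<^sup>/\<^sup>2\<close> satisfies \<open>\<partial>\<^sub>i q = - q\<^sup>3 \<partial>\<^sub>i f / 2\<close>, so its regularity bootstraps.\<close>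

lemma Ck_inverse_sqrt:
  assumes "\<And>x. f x > 0" "Ck k f"
  shows "Ck k (\<lambda>x. inverse (sqrt (f x)))"
  using assms(2)
proof (induction k)
  case 0
  then show ?case using assms(1) less_imp_neq[OF assms(1)]
    by (auto intro!: continuous_intros)
next
  case (Suc k)
  have diff: "f differentiable_on UNIV" and dk: "Ck k (partial_deriv i f)" for i
    using Suc.prems by auto
  have der: "((\<lambda>y. inverse (sqrt y)) has_real_derivative - (1/2) * inverse (sqrt (f x)) ^ 3) (at (f x))" for x
    using assms(1)[of x]
    by (auto intro!: derivative_eq_intros simp: field_simps power3_eq_cube power2_eq_square)
  have "Ck k (\<lambda>x. - (1/2) * inverse (sqrt (f x)) ^ 3 * partial_deriv i f x)" for i
    unfolding power3_eq_cube
    by (intro Ck_mult Ck_const Suc.IH[OF Ck_SucD[OF Suc.prems]] dk)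
  then show ?case
    using partial_deriv_chain[OF diff, of _ "\<lambda>y. - (1/2) * inverse (sqrt y) ^ 3", OF der]
      differentiable_on_chain_real[OF diff, of _ "\<lambda>y. - (1/2) * inverse (sqrt y) ^ 3", OF der]
    by simp
qed

text \<open>The root is f times f^(-1/2), so the bootstrapped smoothness of
  \<open>Ck_inverse_sqrt\<close> suffices.\<close>

lemma Ck_sqrt:
  assumes "\<And>x. f x > 0" "Ck k f"
  shows "Ck k (\<lambda>x. sqrt (f x))"
proof -
  have "sqrt (f x) = f x * inverse (sqrt (f x))" for x
    using assms(1)[of x] by (simp add: field_simps)
  then show ?thesis
    using Ck_mult[OF assms(2) Ck_inverse_sqrt[OF assms]] by simp
qed

definition gradient :: "(real^'n \<Rightarrow> real) \<Rightarrow> real^'n \<Rightarrow> real^'n" where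
  "gradient f x = (\<chi> i. partial_deriv i f x)"

lemma gradient_component [simp]: "gradient f x $ i = partial_deriv i f x"
  by (simp add: gradient_def)

lemma partial_deriv_outside_support:
  assumes "x \<notin> closure {x. f x \<noteq> 0}"
  shows "partial_deriv i f x = 0"
proof -
  have "(f has_derivative (\<lambda>h. 0)) (at x)"
  proof (rule has_derivative_transform_within_open)
    show "((\<lambda>x. 0) has_derivative (\<lambda>h. 0)) (at x)" by simp
    show "open (- closure {x. f x \<noteq> 0})" "x \<in> - closure {x. f x \<noteq> 0}" using assms by auto
    show "0 = f y" if "y \<in> - closure {x. f x \<noteq> 0}" for y
      using that closure_subset[of "{x. f x \<noteq> 0}"] by auto
  qed
  then show ?thesis by (simp add: partial_deriv_eq)
qed

lemma continuous_L2_space: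
  assumes "open \<Omega>" "bounded \<Omega>" "continuous_on UNIV f"
  shows "f \<in> L2_space \<Omega>"
proof -
  have cont: "continuous_on (closure \<Omega>) f" using assms(3) continuous_on_subset by blast
  have "bounded (f ` closure \<Omega>)"
    using assms(2) by (intro compact_imp_bounded compact_continuous_image[OF cont]) (simp add: compact_closure)
  then obtain B where B: "\<And>x. x \<in> \<Omega> \<Longrightarrow> \<bar>f x\<bar> \<le> B"
    using closure_subset[of \<Omega>] by (fastforce simp: bounded_iff)
  have meas: "f \<in> borel_measurable (lebesgue_on \<Omega>)"
    using assms by (intro continuous_imp_measurable_on_sets_lebesgue continuous_on_subset[OF assms(3)]) auto
  have fin: "finite_measure (lebesgue_on \<Omega>)"
    using assms by (intro finite_measure_lebesgue_on bounded_set_imp_lmeasurable) auto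
  have "integrable (lebesgue_on \<Omega>) (\<lambda>x. (f x)\<^sup>2)"
  proof (rule finite_measure.integrable_const_bound[OF fin])
    show "AE x in lebesgue_on \<Omega>. norm ((f x)\<^sup>2) \<le> B\<^sup>2"
      using power_mono[OF B, of _ 2] by (intro AE_I2) simp
  qed (use meas in simp)
  with meas show ?thesis by (simp add: L2_space_def)
qed

text \<open>Translation invariance of Lebesgue measure makes every difference quotient integrate to
  0. The mean value theorem dominates the quotients by a constant on a fixed ball, so the limit may
  be taken under the integral. This is the source of integration by parts for test
  functions.\<close>

lemma integral_partial_deriv_zero:
  fixes f :: "real^'n \<Rightarrow> real"
  assumes diff: "f differentiable_on UNIV" and cont: "continuous_on UNIV (partial_deriv i f)"
    and supp: "compact (closure {x. f x \<noteq> 0})"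
  shows "(LINT x|lborel. partial_deriv i f x) = 0"
proof -
  define K where "K = closure {x. f x \<noteq> 0}"
  define e :: "real^'n" where "e = axis i 1"
  have f0: "f x = 0" if "x \<notin> K" for x
    using that closure_subset[of "{x. f x \<noteq> 0}"] by (auto simp: K_def)
  have d0: "partial_deriv i f x = 0" if "x \<notin> K" for x
    using that partial_deriv_outside_support unfolding K_def by blast
  have "bounded (partial_deriv i f ` K)"
    using supp by (intro compact_imp_bounded compact_continuous_image continuous_on_subset[OF cont]) (auto simp: K_def)
  then obtain B where "\<And>x. x \<in> K \<Longrightarrow> \<bar>partial_deriv i f x\<bar> \<le> B" and "0 < B"
    unfolding bounded_pos by auto
  then have B: "\<bar>partial_deriv i f x\<bar> \<le> B" for x
    using d0[of x] by (cases "x \<in> K") auto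
  have fcont: "continuous_on UNIV f" using diff by (rule differentiable_imp_continuous_on)
  have line: "((\<lambda>t. f (x + t *\<^sub>R e)) has_real_derivative partial_deriv i f (x + t *\<^sub>R e)) (at t)" for x t
  proof -
    let ?D = "frechet_derivative f (at (x + t *\<^sub>R e))"
    have lin: "linear ?D"
      using has_derivative_frechet[OF diff] has_derivative_linear by blast
    have "((\<lambda>t. f (x + t *\<^sub>R e)) has_derivative (\<lambda>h. ?D (h *\<^sub>R e))) (at t)"
      by (rule has_derivative_compose[OF _ has_derivative_frechet[OF diff]])
         (auto intro!: derivative_eq_intros)
    moreover have "(\<lambda>h. ?D (h *\<^sub>R e)) = (*) (partial_deriv i f (x + t *\<^sub>R e))"
      by (simp add: fun_eq_iff linear_cmul[OF lin]) (simp add: partial_deriv_def e_def)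
    ultimately show ?thesis by (simp add: has_field_derivative_def)
  qed
  define g where "g n x = (f (x + (1 / real (Suc n)) *\<^sub>R e) - f x) * real (Suc n)" for n x
  obtain R where R: "\<And>x. x \<in> K \<Longrightarrow> norm x \<le> R"
    using compact_imp_bounded[OF supp] unfolding K_def bounded_iff by auto
  have e1: "norm e = 1" by (simp add: e_def norm_axis_1)
  \<comment> \<open>The step 1/(n+1) along the unit vector \<open>e\<close> is at most 1, so outside
    radius R + 1 both points of the difference quotient avoid \<open>K\<close>.\<close>
  have g_bound: "\<bar>g n x\<bar> \<le> B * indicator (cball 0 (R + 1)) x" for n x
  proof (cases "x \<in> cball 0 (R + 1)")
    case True
    have "\<exists>z>0. z < 1 / real (Suc n) \<and>
      f (x + (1 / real (Suc n)) *\<^sub>R e) - f (x + 0 *\<^sub>R e)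
        = (1 / real (Suc n) - 0) * partial_deriv i f (x + z *\<^sub>R e)"
      by (rule MVT2) (use line in auto)
    then obtain z where "f (x + (1 / real (Suc n)) *\<^sub>R e) - f x
        = (1 / real (Suc n)) * partial_deriv i f (x + z *\<^sub>R e)"
      by auto
    then have "g n x = partial_deriv i f (x + z *\<^sub>R e)"
      by (simp only: g_def) simp
    with B True show ?thesis by simp
  next
    case False
    have "norm x \<le> norm (x + (1 / real (Suc n)) *\<^sub>R e) + norm ((1 / real (Suc n)) *\<^sub>R e)"
      using norm_triangle_ineq4[of "x + (1 / real (Suc n)) *\<^sub>R e" "(1 / real (Suc n)) *\<^sub>R e"]
      by (simp only: add_diff_cancel_right')
    moreover have "norm ((1 / real (Suc n)) *\<^sub>R e) \<le> 1" by (simp add: e1)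
    moreover have "R + 1 < norm x" using False by simp
    ultimately have "R < norm x" "R < norm (x + (1 / real (Suc n)) *\<^sub>R e)" by linarith+
    then have "x \<notin> K" "x + (1 / real (Suc n)) *\<^sub>R e \<notin> K"
      using R not_le by blast+
    then have "g n x = (0 - 0) * real (Suc n)" unfolding g_def by (metis f0)
    then have "g n x = 0" by simp
    with \<open>0 < B\<close> show ?thesis by (simp add: indicator_def)
  qed
  have [measurable]: "f \<in> borel_measurable borel" "partial_deriv i f \<in> borel_measurable borel"
    using fcont cont by (auto intro: borel_measurable_continuous_onI)
  have f_int: "integrable lborel f"
  proof -
    have "bounded (f ` K)"
      using supp by (intro compact_imp_bounded compact_continuous_image continuous_on_subset[OF fcont]) (auto simp: K_def)
    then obtain C where "\<And>x. x \<in> K \<Longrightarrow> \<bar>f x\<bar> \<le> C" by (auto simp: bounded_iff)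
    then have "norm (f x) \<le> norm (C * indicator K x)" for x
      using f0[of x] by (cases "x \<in> K") (auto intro: order_trans[OF _ abs_ge_self])
    moreover have "integrable lborel (\<lambda>x. C * indicator K x)"
      using emeasure_compact_finite[OF supp]
      by (intro integrable_mult_right integrable_real_indicator) (simp_all add: K_def)
    ultimately show ?thesis
      by (rule Bochner_Integration.integrable_bound[rotated 2, OF AE_I2]) simp
  qed
  have shift: "integrable lborel (\<lambda>x. f (x + v)) \<and> (LINT x|lborel. f (x + v)) = (LINT x|lborel. f x)" for v
  proof -
    have *: "distr lborel borel ((+) v) = lborel" by (rule lborel_distr_plus)
    have "integrable (distr lborel borel ((+) v)) f" unfolding * by (rule f_int)
    then have "integrable lborel (\<lambda>x. f (v + x))" by (subst (asm) integrable_distr_eq) auto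
    moreover have "(LINT x|distr lborel borel ((+) v). f x) = (LINT x|lborel. f (v + x))"
      by (subst integral_distr) auto
    ultimately show ?thesis unfolding * by (simp add: add.commute)
  qed
  have "(\<lambda>n. LINT x|lborel. g n x) \<longlonglongrightarrow> (LINT x|lborel. partial_deriv i f x)"
  proof (rule integral_dominated_convergence)
    show "integrable lborel (\<lambda>x::real^'n. B * indicator (cball 0 (R + 1)) x)"
      using emeasure_lborel_cball_finite[of "0::real^'n" "R + 1"]
      by (intro integrable_mult_right integrable_real_indicator) simp_all
    show "AE x in lborel. norm (g n x) \<le> B * indicator (cball 0 (R + 1)) x" for n
      using g_bound by simp
    show "AE x in lborel. (\<lambda>n. g n x) \<longlonglongrightarrow> partial_deriv i f x"
    proof (intro AE_I2)
      fix x
      have "((\<lambda>h. (f (x + h *\<^sub>R e) - f x) / h) \<longlongrightarrow> partial_deriv i f x) (at 0)"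
        using line[of x 0] by (simp add: DERIV_def)
      moreover have "filterlim (\<lambda>n. 1 / real (Suc n)) (at 0) sequentially"
        unfolding filterlim_at using LIMSEQ_Suc[OF lim_1_over_n] by simp
      ultimately have "(\<lambda>n. (f (x + (1 / real (Suc n)) *\<^sub>R e) - f x) / (1 / real (Suc n)))
          \<longlonglongrightarrow> partial_deriv i f x"
        by (rule filterlim_compose)
      then show "(\<lambda>n. g n x) \<longlonglongrightarrow> partial_deriv i f x" by (simp add: g_def)
    qed
  qed (simp_all add: g_def)
  moreover have "(LINT x|lborel. g n x) = 0" for n
  proof -
    have "(LINT x|lborel. f (x + v) - f x) = 0" for v
      using shift[of v] f_int by (subst Bochner_Integration.integral_diff) auto
    then show ?thesis by (simp only: g_def integral_mult_left_zero mult_zero_left)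
  qed
  ultimately have "(\<lambda>n::nat. 0) \<longlonglongrightarrow> (LINT x|lborel. partial_deriv i f x)" by simp
  then show ?thesis by (simp add: LIMSEQ_const_iff)
qed

lemma integral_lebesgue_on_support:
  fixes f :: "real^'n \<Rightarrow> real"
  assumes "open \<Omega>" "f \<in> borel_measurable borel" "\<And>x. x \<notin> \<Omega> \<Longrightarrow> f x = 0"
  shows "(LINT x|lebesgue_on \<Omega>. f x) = (LINT x|lborel. f x)"
proof -
  have "(LINT x|lebesgue_on \<Omega>. f x) = (LINT x|lebesgue. indicator \<Omega> x *\<^sub>R f x)"
    using assms(1) by (subst integral_restrict_space) auto
  also have "(\<lambda>x. indicator \<Omega> x *\<^sub>R f x) = f"
    using assms(3) by (auto simp: indicator_def fun_eq_iff)
  also have "(LINT x|lebesgue. f x) = (LINT x|lborel. f x)"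
    using assms(2) by (simp add: integral_completion)
  finally show ?thesis .
qed

subsection \<open>Test functions\<close>

lemma test_functions_Ck: "\<psi> \<in> test_functions \<Omega> \<Longrightarrow> Ck k \<psi>"
  by (simp add: test_functions_def)

lemma test_functions_differentiable: "\<psi> \<in> test_functions \<Omega> \<Longrightarrow> \<psi> differentiable_on UNIV"
  using test_functions_Ck[of \<psi> \<Omega> "Suc 0"] by simp

lemma test_functions_continuous: "\<psi> \<in> test_functions \<Omega> \<Longrightarrow> continuous_on UNIV \<psi>"
  using test_functions_Ck[of \<psi> \<Omega> 0] by simp

lemma test_functions_partial_continuous:
  "\<psi> \<in> test_functions \<Omega> \<Longrightarrow> continuous_on UNIV (partial_deriv i \<psi>)"
  using test_functions_Ck[of \<psi> \<Omega> "Suc 0"] by simp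

lemma test_functions_supportI:
  assumes "\<And>k. Ck k f" "compact K" "K \<subseteq> \<Omega>" "{x. f x \<noteq> 0} \<subseteq> K"
  shows "f \<in> test_functions \<Omega>"
proof -
  have "closure {x. f x \<noteq> 0} \<subseteq> K"
    using assms(2,4) by (intro closure_minimal compact_imp_closed)
  moreover have "bounded {x. f x \<noteq> 0}"
    using assms(2,4) by (metis bounded_subset compact_imp_bounded)
  ultimately show ?thesis
    using assms(1,3) unfolding test_functions_def by (simp add: compact_closure)
qed

lemma test_functionsI:
  assumes "\<psi> \<in> test_functions \<Omega>" "\<And>k. Ck k f" "\<And>x. \<psi> x = 0 \<Longrightarrow> f x = 0"
  shows "f \<in> test_functions \<Omega>"
proof (rule test_functions_supportI[OF assms(2)])
  show "compact (closure {x. \<psi> x \<noteq> 0})" "closure {x. \<psi> x \<noteq> 0} \<subseteq> \<Omega>"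
    using assms(1) by (simp_all add: test_functions_def)
  have "{x. f x \<noteq> 0} \<subseteq> {x. \<psi> x \<noteq> 0}" using assms(3) by auto
  then show "{x. f x \<noteq> 0} \<subseteq> closure {x. \<psi> x \<noteq> 0}"
    by (rule order_trans[OF _ closure_subset])
qed

lemma test_functions_scale:
  "\<psi> \<in> test_functions \<Omega> \<Longrightarrow> (\<lambda>x. r * \<psi> x) \<in> test_functions \<Omega>"
  by (rule test_functionsI) (auto intro: Ck_mult Ck_const test_functions_Ck)

lemma test_functions_zero: "(\<lambda>x. 0) \<in> test_functions \<Omega>"
  by (simp add: test_functions_def Ck_const)

lemma test_functions_add:
  assumes "\<psi> \<in> test_functions \<Omega>" "\<xi> \<in> test_functions \<Omega>"
  shows "(\<lambda>x. \<psi> x + \<xi> x) \<in> test_functions \<Omega>"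
proof (rule test_functions_supportI)
  show "Ck k (\<lambda>x. \<psi> x + \<xi> x)" for k
    by (intro Ck_add test_functions_Ck[OF assms(1)] test_functions_Ck[OF assms(2)])
  let ?K = "closure {x. \<psi> x \<noteq> 0} \<union> closure {x. \<xi> x \<noteq> 0}"
  show "compact ?K" "?K \<subseteq> \<Omega>"
    using assms by (simp_all add: test_functions_def compact_Un)
  have "{x. \<psi> x + \<xi> x \<noteq> 0} \<subseteq> {x. \<psi> x \<noteq> 0} \<union> {x. \<xi> x \<noteq> 0}" by auto
  then show "{x. \<psi> x + \<xi> x \<noteq> 0} \<subseteq> ?K"
    by (rule order_trans) (intro Un_mono closure_subset)
qed

text \<open>The product of \<open>v\<close> with a test function is again a test function, so its
  partial derivatives integrate to 0; the product rule does the rest.\<close>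

lemma test_functions_has_weak_gradient:
  assumes \<Omega>: "open \<Omega>" "bounded \<Omega>" and v: "v \<in> test_functions \<Omega>"
  shows "has_weak_gradient \<Omega> v (gradient v)"
  unfolding has_weak_gradient_def
proof (intro conjI allI ballI)
  show v_L2: "v \<in> L2_space \<Omega>" and dv_L2: "(\<lambda>x. gradient v x $ i) \<in> L2_space \<Omega>" for i
    using v \<Omega> by (auto intro: continuous_L2_space test_functions_continuous test_functions_partial_continuous)
  fix \<psi> i assume \<psi>: "\<psi> \<in> test_functions \<Omega>"
  then have \<psi>_L2: "\<psi> \<in> L2_space \<Omega>" "partial_deriv i \<psi> \<in> L2_space \<Omega>"
    using \<Omega> by (auto intro: continuous_L2_space test_functions_continuous test_functions_partial_continuous)
  let ?f = "\<lambda>x. v x * \<psi> x"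
  have vd: "v differentiable_on UNIV" and \<psi>d: "\<psi> differentiable_on UNIV"
    using v \<psi> by (auto intro: test_functions_differentiable)
  have f: "?f \<in> test_functions \<Omega>"
    by (rule test_functionsI[OF v]) (auto intro: Ck_mult test_functions_Ck v \<psi>)
  then have supp: "compact (closure {x. ?f x \<noteq> 0})" "closure {x. ?f x \<noteq> 0} \<subseteq> \<Omega>"
    unfolding test_functions_def by auto
  have "(LINT x|lebesgue_on \<Omega>. partial_deriv i ?f x) = (LINT x|lborel. partial_deriv i ?f x)"
    by (intro integral_lebesgue_on_support \<Omega> borel_measurable_continuous_onI
        test_functions_partial_continuous[OF f] partial_deriv_outside_support)
       (use supp(2) in blast)
  also have "\<dots> = 0"
    by (intro integral_partial_deriv_zero supp test_functions_differentiable[OF f]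
        test_functions_partial_continuous[OF f])
  finally have "L2_inner \<Omega> v (partial_deriv i \<psi>) + L2_inner \<Omega> (partial_deriv i v) \<psi> = 0"
    using L2_space_mult_integrable[OF v_L2 \<psi>_L2(2)] L2_space_mult_integrable[OF dv_L2 \<psi>_L2(1)]
    by (simp add: partial_deriv_mult[OF vd \<psi>d] L2_inner_def)
  then show "L2_inner \<Omega> v (partial_deriv i \<psi>) = - L2_inner \<Omega> (\<lambda>x. gradient v x $ i) \<psi>"
    by simp
qed

lemma test_functions_H01:
  assumes "open \<Omega>" "bounded \<Omega>" "v \<in> test_functions \<Omega>"
  shows "v \<in> H01 \<Omega>"
  unfolding H01_def mem_Collect_eq
proof (intro exI conjI)
  show "has_weak_gradient \<Omega> v (gradient v)" by (rule test_functions_has_weak_gradient[OF assms])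
  show "\<forall>m. (\<lambda>_::nat. v) m \<in> test_functions \<Omega>" using assms(3) by simp
qed (simp_all add: L2_norm_def)

subsection \<open>The energy form\<close>

text \<open>The entries of \<open>A\<close> and the function \<open>c\<close> all enter the energy
  as bounded weights, so this one estimate serves both integrability and continuity of every
  term.\<close>

lemma Linfty_mult_bound:
  assumes "b \<in> Linfty_space \<Omega>"
  obtains M where "M \<ge> 0"
    "\<And>v w. v \<in> L2_space \<Omega> \<Longrightarrow> w \<in> L2_space \<Omega> \<Longrightarrow>
       integrable (lebesgue_on \<Omega>) (\<lambda>x. b x * v x * w x) \<and>
       \<bar>LINT x|lebesgue_on \<Omega>. b x * v x * w x\<bar> \<le> M * L2_norm \<Omega> v * L2_norm \<Omega> w"
proof -
  from assms obtain M0 where b: "b \<in> borel_measurable (lebesgue_on \<Omega>)"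
    and M0: "AE x in lebesgue_on \<Omega>. \<bar>b x\<bar> \<le> M0"
    by (auto simp: Linfty_space_def)
  define M where "M = max M0 0"
  have M: "AE x in lebesgue_on \<Omega>. \<bar>b x\<bar> \<le> M"
    using M0 by eventually_elim (simp add: M_def)
  have "M \<ge> 0" by (simp add: M_def)
  moreover
  {
    fix v w assume v: "v \<in> L2_space \<Omega>" and w: "w \<in> L2_space \<Omega>"
    have meas: "(\<lambda>x. b x * v x) \<in> borel_measurable (lebesgue_on \<Omega>)"
      using b v by (auto simp: L2_space_def)
    have le: "AE x in lebesgue_on \<Omega>. \<bar>b x * v x\<bar> \<le> \<bar>M * v x\<bar>"
      using M by eventually_elim (use \<open>M \<ge> 0\<close> in \<open>simp add: abs_mult mult_right_mono\<close>)
    have bv: "(\<lambda>x. b x * v x) \<in> L2_space \<Omega>"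
      by (rule L2_space_dominated[OF L2_space_scale[OF v] meas le])
    have "L2_norm \<Omega> (\<lambda>x. b x * v x) \<le> M * L2_norm \<Omega> v"
      using L2_norm_mono[OF L2_space_scale[OF v] meas le] \<open>M \<ge> 0\<close> by (simp add: L2_norm_scale)
    then have "\<bar>L2_inner \<Omega> (\<lambda>x. b x * v x) w\<bar> \<le> M * L2_norm \<Omega> v * L2_norm \<Omega> w"
      using L2_Cauchy_Schwarz[OF bv w] by (meson L2_norm_nonneg mult_right_mono order_trans)
    then have "integrable (lebesgue_on \<Omega>) (\<lambda>x. b x * v x * w x) \<and>
       \<bar>LINT x|lebesgue_on \<Omega>. b x * v x * w x\<bar> \<le> M * L2_norm \<Omega> v * L2_norm \<Omega> w"
      using L2_space_mult_integrable[OF bv w] by (simp add: L2_inner_def)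
  }
  ultimately show ?thesis using that by blast
qed

lemma Linfty_mult_integrable:
  assumes "b \<in> Linfty_space \<Omega>" "v \<in> L2_space \<Omega>" "w \<in> L2_space \<Omega>"
  shows "integrable (lebesgue_on \<Omega>) (\<lambda>x. b x * v x * w x)"
  by (rule Linfty_mult_bound[OF assms(1)]) (simp add: assms(2,3))

definition L2_field :: "(real^'n) set \<Rightarrow> (real^'n \<Rightarrow> real^'n) \<Rightarrow> bool" where
  "L2_field \<Omega> G \<longleftrightarrow> (\<forall>i. (\<lambda>x. G x $ i) \<in> L2_space \<Omega>)"

lemma L2_field_add: "L2_field \<Omega> G \<Longrightarrow> L2_field \<Omega> H \<Longrightarrow> L2_field \<Omega> (\<lambda>x. G x + H x)"
  by (simp add: L2_field_def L2_space_add)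

lemma L2_field_scale: "L2_field \<Omega> G \<Longrightarrow> L2_field \<Omega> (\<lambda>x. r *\<^sub>R G x)"
  by (simp add: L2_field_def L2_space_scale)

lemma L2_field_sum: "(\<And>k. k \<in> K \<Longrightarrow> L2_field \<Omega> (G k)) \<Longrightarrow> L2_field \<Omega> (\<lambda>x. \<Sum>k\<in>K. G k x)"
  by (simp add: L2_field_def L2_space_sum)

text \<open>Gradients are explicit arguments because a weak gradient is determined only almost
  everywhere. Classical gradients of test functions and chosen gradients of eigenfunctions can then
  be mixed freely.\<close>

definition energy ::
    "(real^'n) set \<Rightarrow> (real^'n \<Rightarrow> real^'n^'n) \<Rightarrow> (real^'n \<Rightarrow> real) \<Rightarrow>
     (real^'n \<Rightarrow> real) \<Rightarrow> (real^'n \<Rightarrow> real^'n) \<Rightarrow> (real^'n \<Rightarrow> real) \<Rightarrow> (real^'n \<Rightarrow> real^'n) \<Rightarrow> real" where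
  "energy \<Omega> A c v G w H = (LINT x|lebesgue_on \<Omega>. (A x *v G x) \<bullet> H x + c x * v x * w x)"

locale elliptic =
  fixes \<Omega> :: "(real^'n) set" and A :: "real^'n \<Rightarrow> real^'n^'n" and c :: "real^'n \<Rightarrow> real"
  assumes open_\<Omega>: "open \<Omega>" and bounded_\<Omega>: "bounded \<Omega>"
    and coefficients: "admissible_coefficients \<Omega> A c"
begin

abbreviation "E \<equiv> energy \<Omega> A c"

lemma \<Omega>_sets [simp]: "\<Omega> \<in> sets lebesgue"
  using open_\<Omega> by simp

lemma c_Linfty: "c \<in> Linfty_space \<Omega>"
  and c_nonneg: "AE x in lebesgue_on \<Omega>. 0 \<le> c x"
  and A_symmetric: "x \<in> \<Omega> \<Longrightarrow> transpose (A x) = A x"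
  using coefficients by (auto simp: admissible_coefficients_def)

lemma A_entry_Linfty: "(\<lambda>x. A x $ i $ j) \<in> Linfty_space \<Omega>"
proof -
  obtain C where C: "C-lipschitz_on \<Omega> A"
    using coefficients by (auto simp: admissible_coefficients_def)
  have cont: "continuous_on \<Omega> (\<lambda>x. A x $ i $ j)"
    by (intro continuous_on_component lipschitz_on_continuous_on[OF C])
  have "\<exists>M. \<forall>x\<in>\<Omega>. \<bar>A x $ i $ j\<bar> \<le> M"
  proof -
    have "bounded (A ` \<Omega>)"
      using C bounded_\<Omega> by (intro bounded_uniformly_continuous_image lipschitz_on_uniformly_continuous)
    then obtain M where M: "\<forall>x\<in>\<Omega>. norm (A x) \<le> M" by (auto simp: bounded_iff)
    have "\<bar>A x $ i $ j\<bar> \<le> norm (A x)" for x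
      by (rule order_trans[OF component_le_norm_cart Finite_Cartesian_Product.norm_nth_le])
    with M show ?thesis by (meson order_trans)
  qed
  then obtain M where "\<forall>x\<in>\<Omega>. \<bar>A x $ i $ j\<bar> \<le> M" ..
  then have "AE x in lebesgue_on \<Omega>. \<bar>A x $ i $ j\<bar> \<le> M" by (intro AE_I2) simp
  with cont show ?thesis
    by (auto simp: Linfty_space_def intro!: continuous_imp_measurable_on_sets_lebesgue)
qed

lemma quadratic_form_expand:
  "((A x :: real^'n^'n) *v g) \<bullet> h = (\<Sum>i\<in>UNIV. \<Sum>j\<in>UNIV. A x $ i $ j * g $ j * h $ i)"
  by (simp add: inner_vec_def matrix_vector_mult_def sum_distrib_right)

lemma energy_integrable:
  assumes "v \<in> L2_space \<Omega>" "w \<in> L2_space \<Omega>" "L2_field \<Omega> G" "L2_field \<Omega> H"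
  shows "integrable (lebesgue_on \<Omega>) (\<lambda>x. (A x *v G x) \<bullet> H x + c x * v x * w x)"
  unfolding quadratic_form_expand
proof (intro Bochner_Integration.integrable_add Bochner_Integration.integrable_sum)
  show "integrable (lebesgue_on \<Omega>) (\<lambda>x. A x $ i $ j * G x $ j * H x $ i)" for i j
    using assms by (intro Linfty_mult_integrable A_entry_Linfty) (auto simp: L2_field_def)
  show "integrable (lebesgue_on \<Omega>) (\<lambda>x. c x * v x * w x)"
    using assms by (intro Linfty_mult_integrable c_Linfty)
qed

lemma energy_expand:
  assumes "v \<in> L2_space \<Omega>" "w \<in> L2_space \<Omega>" "L2_field \<Omega> G" "L2_field \<Omega> H"
  shows "E v G w H = (\<Sum>i\<in>UNIV. \<Sum>j\<in>UNIV. LINT x|lebesgue_on \<Omega>. A x $ i $ j * G x $ j * H x $ i)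
    + (LINT x|lebesgue_on \<Omega>. c x * v x * w x)"
proof -
  have "integrable (lebesgue_on \<Omega>) (\<lambda>x. A x $ i $ j * G x $ j * H x $ i)" for i j
    using assms by (intro Linfty_mult_integrable A_entry_Linfty) (auto simp: L2_field_def)
  moreover have "integrable (lebesgue_on \<Omega>) (\<lambda>x. c x * v x * w x)"
    using assms by (intro Linfty_mult_integrable c_Linfty)
  ultimately show ?thesis
    unfolding energy_def quadratic_form_expand
    by (simp add: Bochner_Integration.integral_add Bochner_Integration.integral_sum)
qed

lemma energy_commute: "E v G w H = E w H v G"
  unfolding energy_def
proof (rule Bochner_Integration.integral_cong)
  fix x assume "x \<in> space (lebesgue_on \<Omega>)"
  then have "x \<in> \<Omega>" by simp
  then have "(A x *v G x) \<bullet> H x = (A x *v H x) \<bullet> G x"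
    by (metis A_symmetric dot_lmul_matrix inner_commute vector_transpose_matrix)
  then show "(A x *v G x) \<bullet> H x + c x * v x * w x = (A x *v H x) \<bullet> G x + c x * w x * v x" by simp
qed simp

lemma energy_add_left:
  assumes "u \<in> L2_space \<Omega>" "v \<in> L2_space \<Omega>" "w \<in> L2_space \<Omega>"
    "L2_field \<Omega> F" "L2_field \<Omega> G" "L2_field \<Omega> H"
  shows "E (\<lambda>x. u x + v x) (\<lambda>x. F x + G x) w H = E u F w H + E v G w H"
proof -
  have "(A x *v (F x + G x)) \<bullet> H x + c x * (u x + v x) * w x
      = ((A x *v F x) \<bullet> H x + c x * u x * w x) + ((A x *v G x) \<bullet> H x + c x * v x * w x)" for x
    by (simp add: matrix_vector_right_distrib inner_add_left algebra_simps)
  then show ?thesis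
    unfolding energy_def
    by (simp only:) (intro Bochner_Integration.integral_add energy_integrable assms)
qed

lemma energy_scale_left: "E (\<lambda>x. r * v x) (\<lambda>x. r *\<^sub>R G x) w H = r * E v G w H"
  unfolding energy_def integral_mult_right_zero[symmetric]
  by (auto intro!: Bochner_Integration.integral_cong simp: matrix_vector_mult_scaleR algebra_simps)

lemma energy_zero_left: "E (\<lambda>x. 0) (\<lambda>x. 0) w H = 0"
  by (simp add: energy_def)

lemma energy_sum_left:
  assumes "\<And>k. k \<in> K \<Longrightarrow> v k \<in> L2_space \<Omega>" "\<And>k. k \<in> K \<Longrightarrow> L2_field \<Omega> (G k)"
    "w \<in> L2_space \<Omega>" "L2_field \<Omega> H"
  shows "E (\<lambda>x. \<Sum>k\<in>K. v k x) (\<lambda>x. \<Sum>k\<in>K. G k x) w H = (\<Sum>k\<in>K. E (v k) (G k) w H)"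
  using assms
  by (induction K rule: infinite_finite_induct)
     (auto simp: energy_add_left energy_zero_left L2_space_sum L2_field_sum)

lemma A_nonneg: "x \<in> \<Omega> \<Longrightarrow> 0 \<le> (A x *v \<xi>) \<bullet> \<xi>"
proof -
  assume "x \<in> \<Omega>"
  moreover obtain \<alpha> where "\<alpha> > 0" "\<forall>x\<in>\<Omega>. \<forall>\<xi>. \<alpha> * (norm \<xi>)\<^sup>2 \<le> \<xi> \<bullet> (A x *v \<xi>)"
    using coefficients by (auto simp: admissible_coefficients_def)
  ultimately show ?thesis
    by (metis inner_commute less_imp_le mult_nonneg_nonneg order_trans zero_le_power2)
qed

lemma energy_nonneg: "0 \<le> E v G v G"
  unfolding energy_def
proof (rule integral_nonneg_AE)
  have "AE x in lebesgue_on \<Omega>. x \<in> \<Omega>" by (intro AE_I2) simp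
  with c_nonneg show "AE x in lebesgue_on \<Omega>. 0 \<le> (A x *v G x) \<bullet> G x + c x * v x * v x"
  proof eventually_elim
    case (elim x)
    then show ?case using A_nonneg[of x "G x"] by (simp add: mult.assoc)
  qed
qed

text \<open>A single gradient component is enough, since the Poincare inequality below also uses a
  single coordinate direction. The \<open>c\<close> term is nonnegative and is dropped.\<close>

lemma energy_coercive:
  obtains \<alpha> where "\<alpha> > 0"
    "\<And>v G i. v \<in> L2_space \<Omega> \<Longrightarrow> L2_field \<Omega> G \<Longrightarrow> \<alpha> * (L2_norm \<Omega> (\<lambda>x. G x $ i))\<^sup>2 \<le> E v G v G"
proof -
  obtain \<alpha> where \<alpha>: "\<alpha> > 0" "\<And>x \<xi>. x \<in> \<Omega> \<Longrightarrow> \<alpha> * (norm \<xi>)\<^sup>2 \<le> \<xi> \<bullet> (A x *v \<xi>)"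
    using coefficients by (auto simp: admissible_coefficients_def)
  have "\<alpha> * (L2_norm \<Omega> (\<lambda>x. G x $ i))\<^sup>2 \<le> E v G v G"
    if v: "v \<in> L2_space \<Omega>" and G: "L2_field \<Omega> G" for v G i
  proof -
    have Gi: "integrable (lebesgue_on \<Omega>) (\<lambda>x. (G x $ i)\<^sup>2)"
      using G by (simp add: L2_field_def L2_space_def)
    have "AE x in lebesgue_on \<Omega>. x \<in> \<Omega>" by (intro AE_I2) simp
    with c_nonneg have "AE x in lebesgue_on \<Omega>. \<alpha> * (G x $ i)\<^sup>2 \<le> (A x *v G x) \<bullet> G x + c x * v x * v x"
    proof eventually_elim
      case (elim x)
      have "(G x $ i)\<^sup>2 \<le> (norm (G x))\<^sup>2"
        using component_le_norm_cart[of "G x" i] by (simp add: abs_le_square_iff[symmetric])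
      then have "\<alpha> * (G x $ i)\<^sup>2 \<le> \<alpha> * (norm (G x))\<^sup>2" using \<alpha>(1) by simp
      also have "\<dots> \<le> (A x *v G x) \<bullet> G x" using \<alpha>(2)[OF elim(2)] by (simp add: inner_commute)
      finally show ?case using elim(1) by (simp add: mult.assoc add_increasing2)
    qed
    then have "(LINT x|lebesgue_on \<Omega>. \<alpha> * (G x $ i)\<^sup>2) \<le> E v G v G"
      unfolding energy_def using Gi energy_integrable[OF v v G G]
      by (intro integral_mono_AE) auto
    then show ?thesis by (simp add: L2_norm_def)
  qed
  then show ?thesis by (rule that[OF \<alpha>(1)])
qed

lemma energy_add_right:
  assumes "u \<in> L2_space \<Omega>" "v \<in> L2_space \<Omega>" "w \<in> L2_space \<Omega>"
    "L2_field \<Omega> F" "L2_field \<Omega> G" "L2_field \<Omega> H"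
  shows "E w H (\<lambda>x. u x + v x) (\<lambda>x. F x + G x) = E w H u F + E w H v G"
  using energy_add_left[OF assms] by (simp only: energy_commute[of w H])

lemma energy_sq_add:
  assumes "v \<in> L2_space \<Omega>" "w \<in> L2_space \<Omega>" "L2_field \<Omega> G" "L2_field \<Omega> H"
  shows "E (\<lambda>x. v x + w x) (\<lambda>x. G x + H x) (\<lambda>x. v x + w x) (\<lambda>x. G x + H x)
    = E v G v G + 2 * E v G w H + E w H w H"
  using assms energy_commute[of w H v G]
  by (simp add: energy_add_left energy_add_right L2_space_add L2_field_add)

lemma bounded_weight_tendsto:
  assumes b: "b \<in> Linfty_space \<Omega>"
    and f: "\<And>m. f m \<in> L2_space \<Omega>" "f' \<in> L2_space \<Omega>" "(\<lambda>m. L2_norm \<Omega> (\<lambda>x. f m x - f' x)) \<longlonglongrightarrow> 0"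
    and g: "\<And>m. g m \<in> L2_space \<Omega>" "g' \<in> L2_space \<Omega>" "(\<lambda>m. L2_norm \<Omega> (\<lambda>x. g m x - g' x)) \<longlonglongrightarrow> 0"
  shows "(\<lambda>m. LINT x|lebesgue_on \<Omega>. b x * f m x * g m x) \<longlonglongrightarrow> (LINT x|lebesgue_on \<Omega>. b x * f' x * g' x)"
proof -
  obtain M where M: "M \<ge> 0" "\<And>v w. v \<in> L2_space \<Omega> \<Longrightarrow> w \<in> L2_space \<Omega> \<Longrightarrow>
     \<bar>LINT x|lebesgue_on \<Omega>. b x * v x * w x\<bar> \<le> M * L2_norm \<Omega> v * L2_norm \<Omega> w"
    by (rule Linfty_mult_bound[OF b]) blast
  define df where "df m = L2_norm \<Omega> (\<lambda>x. f m x - f' x)" for m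
  define dg where "dg m = L2_norm \<Omega> (\<lambda>x. g m x - g' x)" for m
  \<comment> \<open>Splits f g - f' g' as (f - f') g + f' (g - g'); the norm of \<open>g m\<close>
    is at most that of \<open>g'\<close> plus \<open>dg m\<close>.\<close>
  have bound: "norm ((LINT x|lebesgue_on \<Omega>. b x * f m x * g m x) - (LINT x|lebesgue_on \<Omega>. b x * f' x * g' x))
      \<le> M * df m * (L2_norm \<Omega> g' + dg m) + M * L2_norm \<Omega> f' * dg m" for m
  proof -
    let ?f = "\<lambda>x. f m x - f' x" and ?g = "\<lambda>x. g m x - g' x"
    have L2: "?f \<in> L2_space \<Omega>" "?g \<in> L2_space \<Omega>"
      using f g by (simp_all add: L2_space_diff)
    have "(LINT x|lebesgue_on \<Omega>. b x * f m x * g m x) - (LINT x|lebesgue_on \<Omega>. b x * f' x * g' x)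
      = (LINT x|lebesgue_on \<Omega>. b x * f m x * g m x - b x * f' x * g' x)"
      by (intro Bochner_Integration.integral_diff[symmetric] Linfty_mult_integrable b f g)
    also have "\<dots> = (LINT x|lebesgue_on \<Omega>. b x * ?f x * g m x + b x * f' x * ?g x)"
      by (simp add: algebra_simps)
    also have "\<dots> = (LINT x|lebesgue_on \<Omega>. b x * ?f x * g m x) + (LINT x|lebesgue_on \<Omega>. b x * f' x * ?g x)"
      by (intro Bochner_Integration.integral_add Linfty_mult_integrable b f g L2)
    finally have "norm ((LINT x|lebesgue_on \<Omega>. b x * f m x * g m x) - (LINT x|lebesgue_on \<Omega>. b x * f' x * g' x))
      \<le> M * df m * L2_norm \<Omega> (g m) + M * L2_norm \<Omega> f' * dg m"
      using M(2)[OF L2(1) g(1)[of m]] M(2)[OF f(2) L2(2)] by (simp add: df_def dg_def)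
    also have "M * df m * L2_norm \<Omega> (g m) \<le> M * df m * (L2_norm \<Omega> g' + dg m)"
      using L2_norm_triangle[OF g(2) L2(2)] M(1) by (intro mult_left_mono) (auto simp: df_def dg_def)
    finally show ?thesis by simp
  qed
  have "(\<lambda>m. M * df m * (L2_norm \<Omega> g' + dg m) + M * L2_norm \<Omega> f' * dg m)
      \<longlonglongrightarrow> M * 0 * (L2_norm \<Omega> g' + 0) + M * L2_norm \<Omega> f' * 0"
    using f(3) g(3) unfolding df_def dg_def by (intro tendsto_add tendsto_mult tendsto_const)
  then have lim: "(\<lambda>m. M * df m * (L2_norm \<Omega> g' + dg m) + M * L2_norm \<Omega> f' * dg m) \<longlonglongrightarrow> 0"
    by simp
  show ?thesis
    by (rule LIM_zero_cancel, rule Lim_null_comparison[OF always_eventually lim]) (use bound in blast)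
qed

lemma energy_tendsto:
  assumes "\<And>m. v m \<in> L2_space \<Omega>" "\<And>m. L2_field \<Omega> (G m)" "v' \<in> L2_space \<Omega>" "L2_field \<Omega> G'"
    "(\<lambda>m. L2_norm \<Omega> (\<lambda>x. v m x - v' x)) \<longlonglongrightarrow> 0" "\<And>i. (\<lambda>m. L2_norm \<Omega> (\<lambda>x. G m x $ i - G' x $ i)) \<longlonglongrightarrow> 0"
  shows "(\<lambda>m. E (v m) (G m) (v m) (G m)) \<longlonglongrightarrow> E v' G' v' G'"
proof -
  have G: "(\<lambda>x. G m x $ i) \<in> L2_space \<Omega>" "(\<lambda>x. G' x $ i) \<in> L2_space \<Omega>" for m i
    using assms(2,4) by (simp_all add: L2_field_def)
  show ?thesis
    unfolding energy_expand[OF assms(1,1,2,2)] energy_expand[OF assms(3,3,4,4)]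
    by (intro tendsto_add tendsto_sum bounded_weight_tendsto A_entry_Linfty c_Linfty assms(1,3,5,6) G)
qed

end

subsection \<open>A smooth approximation of the truncation\<close>

text \<open>For a \<le> 0 \<le> b the truncation of x to [a, b] is half of |x - a| - |x - b| + |b| -
  |a|; each |y| is replaced by sqrt (y^2 + \<delta>^2). Smoothing the constant term in the same way
  keeps the value 0 at 0, so composition does not enlarge supports.\<close>

definition smooth_clamp :: "real \<Rightarrow> real \<Rightarrow> real \<Rightarrow> real \<Rightarrow> real" where
  "smooth_clamp a b \<delta> x =
     1/2 * (sqrt ((x - a)\<^sup>2 + \<delta>\<^sup>2) - sqrt ((x - b)\<^sup>2 + \<delta>\<^sup>2) + (sqrt (b\<^sup>2 + \<delta>\<^sup>2) - sqrt (a\<^sup>2 + \<delta>\<^sup>2)))"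

lemma smooth_clamp_zero [simp]: "smooth_clamp a b \<delta> 0 = 0"
  by (simp add: smooth_clamp_def)

lemma sqrt_add_square_bounds:
  fixes y \<delta> :: real
  assumes "\<delta> > 0"
  shows "\<bar>y\<bar> \<le> sqrt (y\<^sup>2 + \<delta>\<^sup>2)" "sqrt (y\<^sup>2 + \<delta>\<^sup>2) \<le> \<bar>y\<bar> + \<delta>"
proof -
  show "\<bar>y\<bar> \<le> sqrt (y\<^sup>2 + \<delta>\<^sup>2)"
    by (rule real_le_rsqrt) simp
  show "sqrt (y\<^sup>2 + \<delta>\<^sup>2) \<le> \<bar>y\<bar> + \<delta>"
    using assms by (intro real_le_lsqrt) (auto simp: power2_sum)
qed

text \<open>Each of the four smoothed absolute values errs by at most \<delta>, and the outer factor
  1/2 leaves 2 \<delta>.\<close>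

lemma smooth_clamp_approx:
  assumes "a \<le> 0" "0 \<le> b" "\<delta> > 0"
  shows "\<bar>smooth_clamp a b \<delta> x - max a (min b x)\<bar> \<le> 2 * \<delta>"
proof -
  have "max a (min b x) = 1/2 * (\<bar>x - a\<bar> - \<bar>x - b\<bar> + (\<bar>b\<bar> - \<bar>a\<bar>))"
    using assms(1,2) by (auto simp: max_def min_def abs_if)
  then show ?thesis
    using sqrt_add_square_bounds[OF assms(3), of "x - a"] sqrt_add_square_bounds[OF assms(3), of "x - b"]
      sqrt_add_square_bounds[OF assms(3), of a] sqrt_add_square_bounds[OF assms(3), of b]
    unfolding smooth_clamp_def by argo
qed

lemma DERIV_sqrt_add_square: fixes x r \<delta> :: real assumes "\<delta> > 0"
 shows "((\<lambda>x. sqrt ((x - r)\<^sup>2 + \<delta>\<^sup>2)) has_real_derivative (x - r) / sqrt ((x - r)\<^sup>2 + \<delta>\<^sup>2)) (at x)"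
proof -
  define g where "g x = (x - r)\<^sup>2 + \<delta>\<^sup>2" for x
  have "(g has_real_derivative 2 * (x - r)) (at x)"
    unfolding g_def by (auto intro!: derivative_eq_intros)
  moreover have "0 < g x" using assms by (simp add: g_def sum_power2_gt_zero_iff)
  ultimately have "((\<lambda>x. sqrt (g x)) has_real_derivative inverse (sqrt (g x)) / 2 * (2 * (x - r))) (at x)"
    using DERIV_chain2[where f = sqrt and g = g, OF DERIV_real_sqrt] by blast
  moreover have "inverse q / 2 * (2 * y) = y / q" for q y :: real
    unfolding divide_inverse by simp
  ultimately show ?thesis unfolding g_def by metis
qed

definition smooth_clamp' :: "real \<Rightarrow> real \<Rightarrow> real \<Rightarrow> real \<Rightarrow> real" where
  "smooth_clamp' a b \<delta> x =
     1/2 * ((x - a) / sqrt ((x - a)\<^sup>2 + \<delta>\<^sup>2) - (x - b) / sqrt ((x - b)\<^sup>2 + \<delta>\<^sup>2))"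

lemma smooth_clamp_deriv:
  assumes "\<delta> > 0"
  shows "(smooth_clamp a b \<delta> has_real_derivative smooth_clamp' a b \<delta> x) (at x)"
proof -
  show ?thesis
    using DERIV_cmult[OF DERIV_add[OF DERIV_diff[OF DERIV_sqrt_add_square[OF assms, of a] DERIV_sqrt_add_square[OF assms, of b]]
        DERIV_const[of "sqrt (b\<^sup>2 + \<delta>\<^sup>2) - sqrt (a\<^sup>2 + \<delta>\<^sup>2)"]], of "1/2"]
    unfolding smooth_clamp_def[abs_def] smooth_clamp'_def by (simp only: add_0_right)
qed

text \<open>With r y = y / sqrt (y^2 + \<delta>^2) the derivative is half of r (x - a) - r (x - b).
  It is nonnegative because r increases, and at most 1 because r takes values in [-1, 1].\<close>

lemma smooth_clamp'_bounds:
  assumes "\<delta> > 0" "a \<le> b"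
  shows "0 \<le> smooth_clamp' a b \<delta> x" "smooth_clamp' a b \<delta> x \<le> 1"
proof -
  define r where "r y = y / sqrt (y\<^sup>2 + \<delta>\<^sup>2)" for y :: real
  have pos: "0 < y\<^sup>2 + \<delta>\<^sup>2" for y :: real using assms(1) by (simp add: sum_power2_gt_zero_iff)
  have abs: "\<bar>r y\<bar> \<le> 1" for y
    using sqrt_add_square_bounds(1)[OF assms(1), of y] pos[of y] by (simp add: r_def)
  have deriv: "(r has_real_derivative \<delta>\<^sup>2 / sqrt (y\<^sup>2 + \<delta>\<^sup>2) ^ 3) (at y)" for y
  proof -
    have sq: "sqrt (y\<^sup>2 + \<delta>\<^sup>2) * sqrt (y\<^sup>2 + \<delta>\<^sup>2) = y\<^sup>2 + \<delta>\<^sup>2" using pos[of y] by simp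
    have "((\<lambda>y. y / sqrt (y\<^sup>2 + \<delta>\<^sup>2)) has_real_derivative
      (1 * sqrt (y\<^sup>2 + \<delta>\<^sup>2) - y * (y / sqrt (y\<^sup>2 + \<delta>\<^sup>2))) /
        (sqrt (y\<^sup>2 + \<delta>\<^sup>2) * sqrt (y\<^sup>2 + \<delta>\<^sup>2))) (at y)"
    proof (rule DERIV_divide[OF DERIV_ident])
      show "((\<lambda>y. sqrt (y\<^sup>2 + \<delta>\<^sup>2)) has_real_derivative y / sqrt (y\<^sup>2 + \<delta>\<^sup>2)) (at y)"
        using DERIV_sqrt_add_square[OF assms(1), of 0 y] by simp
      show "sqrt (y\<^sup>2 + \<delta>\<^sup>2) \<noteq> 0" using assms(1) by simp
    qed
    moreover have "(1 * q - y * (y / q)) / (q * q) = \<delta>\<^sup>2 / q ^ 3"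
      if "q * q = y\<^sup>2 + \<delta>\<^sup>2" "q > 0" for q :: real
    proof -
      have "(1 * q - y * (y / q)) / (q * q) = (q * q - y\<^sup>2) / q ^ 3"
        using that(2) by (simp add: field_simps power2_eq_square power3_eq_cube)
      then show ?thesis using that(1) by simp
    qed
    ultimately show ?thesis using sq pos[of y] unfolding r_def by simp
  qed
  have "r (x - b) \<le> r (x - a)"
    by (rule DERIV_nonneg_imp_nondecreasing) (use assms(2) deriv pos in \<open>auto intro!: exI\<close>)
  then show "0 \<le> smooth_clamp' a b \<delta> x" by (simp add: smooth_clamp'_def r_def)
  have "smooth_clamp' a b \<delta> x = 1/2 * (r (x - a) - r (x - b))"
    by (simp add: smooth_clamp'_def r_def)
  then show "smooth_clamp' a b \<delta> x \<le> 1"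
    using abs_le_D1[OF abs[of "x - a"]] abs_le_D2[OF abs[of "x - b"]] by simp
qed

text \<open>The clamp is 1-Lipschitz and fixes 0. This controls the zero-order term of the
  energy.\<close>

lemma smooth_clamp_abs_le:
  assumes "\<delta> > 0" "a \<le> b"
  shows "\<bar>smooth_clamp a b \<delta> x\<bar> \<le> \<bar>x\<bar>"
proof -
  have "norm (smooth_clamp a b \<delta> x - smooth_clamp a b \<delta> 0) \<le> 1 * norm (x - 0)"
  proof (rule field_differentiable_bound[of UNIV])
    show "(smooth_clamp a b \<delta> has_field_derivative smooth_clamp' a b \<delta> y) (at y within UNIV)" for y
      using smooth_clamp_deriv[OF assms(1)] by simp
    show "norm (smooth_clamp' a b \<delta> y) \<le> 1" for y
      using smooth_clamp'_bounds[OF assms] by simp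
  qed auto
  then show ?thesis by simp
qed

lemma Ck_smooth_clamp:
  assumes "\<delta> > 0" "Ck k f"
  shows "Ck k (\<lambda>x. smooth_clamp a b \<delta> (f x))"
proof -
  have root: "Ck k (\<lambda>x. sqrt ((f x - r)\<^sup>2 + \<delta>\<^sup>2))" for r
  proof (rule Ck_sqrt)
    have "Ck k (\<lambda>x. (f x + - r) * (f x + - r) + \<delta>\<^sup>2)"
      by (intro Ck_add Ck_mult Ck_const assms(2))
    then show "Ck k (\<lambda>x. (f x - r)\<^sup>2 + \<delta>\<^sup>2)" by (simp add: power2_eq_square)
  qed (use assms(1) in \<open>simp add: sum_power2_gt_zero_iff\<close>)
  have "Ck k (\<lambda>x. 1/2 * (sqrt ((f x - a)\<^sup>2 + \<delta>\<^sup>2) + - 1 * sqrt ((f x - b)\<^sup>2 + \<delta>\<^sup>2)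
      + (sqrt (b\<^sup>2 + \<delta>\<^sup>2) - sqrt (a\<^sup>2 + \<delta>\<^sup>2))))"
    by (intro Ck_add Ck_mult[OF Ck_const] Ck_const root)
  then show ?thesis by (simp add: smooth_clamp_def)
qed

subsection \<open>Functions in the closure of the test functions\<close>

text \<open>The approximation half of \<open>H01\<close>, with the limit gradient named. Leaving the
  identity of \<open>has_weak_gradient\<close> aside makes closure under linear combinations a
  matter of norms alone.\<close>

definition H1_limit :: "(real^'n) set \<Rightarrow> (real^'n \<Rightarrow> real) \<Rightarrow> (real^'n \<Rightarrow> real^'n) \<Rightarrow> bool" where
  "H1_limit \<Omega> v G \<longleftrightarrow> v \<in> L2_space \<Omega> \<and> L2_field \<Omega> G \<and>
     (\<exists>\<psi> :: nat \<Rightarrow> real^'n \<Rightarrow> real. (\<forall>m. \<psi> m \<in> test_functions \<Omega>) \<and>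
       (\<lambda>m. L2_norm \<Omega> (\<lambda>x. \<psi> m x - v x)) \<longlonglongrightarrow> 0 \<and>
       (\<forall>i. (\<lambda>m. L2_norm \<Omega> (\<lambda>x. partial_deriv i (\<psi> m) x - G x $ i)) \<longlonglongrightarrow> 0))"

lemma H01_D:
  assumes "v \<in> H01 \<Omega>"
  obtains G where "has_weak_gradient \<Omega> v G" "H1_limit \<Omega> v G"
  using assms unfolding H01_def H1_limit_def has_weak_gradient_def L2_field_def by blast

context elliptic begin

lemma test_L2: "\<psi> \<in> test_functions \<Omega> \<Longrightarrow> \<psi> \<in> L2_space \<Omega>"
  by (intro continuous_L2_space open_\<Omega> bounded_\<Omega> test_functions_continuous)

lemma test_partial_L2: "\<psi> \<in> test_functions \<Omega> \<Longrightarrow> partial_deriv i \<psi> \<in> L2_space \<Omega>"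
  by (intro continuous_L2_space open_\<Omega> bounded_\<Omega> test_functions_partial_continuous)

lemma test_gradient_L2: "\<psi> \<in> test_functions \<Omega> \<Longrightarrow> L2_field \<Omega> (gradient \<psi>)"
  by (simp add: L2_field_def test_partial_L2)

section \<open>Linear combinations of limits of test functions\<close>

lemma H1_limit_zero: "H1_limit \<Omega> (\<lambda>x. 0) (\<lambda>x. 0)"
  unfolding H1_limit_def L2_field_def
  by (auto intro!: exI[of _ "\<lambda>m x. 0"] simp: test_functions_zero partial_deriv_const L2_norm_def)

lemma H1_limit_scale:
  assumes "H1_limit \<Omega> v G"
  shows "H1_limit \<Omega> (\<lambda>x. r * v x) (\<lambda>x. r *\<^sub>R G x)"
proof -
  obtain \<psi> :: "nat \<Rightarrow> real^'n \<Rightarrow> real" where \<psi>: "\<And>m. \<psi> m \<in> test_functions \<Omega>"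
    "(\<lambda>m. L2_norm \<Omega> (\<lambda>x. \<psi> m x - v x)) \<longlonglongrightarrow> 0"
    "\<And>i. (\<lambda>m. L2_norm \<Omega> (\<lambda>x. partial_deriv i (\<psi> m) x - G x $ i)) \<longlonglongrightarrow> 0"
    using assms unfolding H1_limit_def by blast
  have pd: "partial_deriv i (\<lambda>x. r * \<psi> m x) = (\<lambda>x. r * partial_deriv i (\<psi> m) x)" for i m
    using partial_deriv_mult[OF differentiable_on_const test_functions_differentiable[OF \<psi>(1)], of i r m]
    by (simp add: partial_deriv_const)
  show ?thesis
    unfolding H1_limit_def
  proof (intro conjI exI[of _ "\<lambda>m x. r * \<psi> m x"] allI)
    show "(\<lambda>x. r * v x) \<in> L2_space \<Omega>" "L2_field \<Omega> (\<lambda>x. r *\<^sub>R G x)"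
      using assms by (simp_all add: H1_limit_def L2_space_scale L2_field_scale)
    show "(\<lambda>x. r * \<psi> m x) \<in> test_functions \<Omega>" for m
      by (rule test_functions_scale[OF \<psi>(1)])
    have "(\<lambda>m. \<bar>r\<bar> * L2_norm \<Omega> (\<lambda>x. \<psi> m x - v x)) \<longlonglongrightarrow> \<bar>r\<bar> * 0"
      by (rule tendsto_mult_left[OF \<psi>(2)])
    then show "(\<lambda>m. L2_norm \<Omega> (\<lambda>x. r * \<psi> m x - r * v x)) \<longlonglongrightarrow> 0"
      by (simp only: right_diff_distrib[symmetric] L2_norm_scale mult_zero_right)
    fix i
    have "(\<lambda>m. \<bar>r\<bar> * L2_norm \<Omega> (\<lambda>x. partial_deriv i (\<psi> m) x - G x $ i)) \<longlonglongrightarrow> \<bar>r\<bar> * 0"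
      by (rule tendsto_mult_left[OF \<psi>(3)])
    then show "(\<lambda>m. L2_norm \<Omega> (\<lambda>x. partial_deriv i (\<lambda>x. r * \<psi> m x) x - (r *\<^sub>R G x) $ i)) \<longlonglongrightarrow> 0"
      by (simp only: pd vector_scaleR_component real_scaleR_def right_diff_distrib[symmetric] L2_norm_scale mult_zero_right)
  qed
qed

lemma L2_norm_diff_add_tendsto_zero:
  assumes "\<And>m. f m \<in> L2_space \<Omega>" "f' \<in> L2_space \<Omega>" "\<And>m. g m \<in> L2_space \<Omega>" "g' \<in> L2_space \<Omega>"
    and lim: "(\<lambda>m. L2_norm \<Omega> (\<lambda>x. f m x - f' x)) \<longlonglongrightarrow> 0" "(\<lambda>m. L2_norm \<Omega> (\<lambda>x. g m x - g' x)) \<longlonglongrightarrow> 0"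
  shows "(\<lambda>m. L2_norm \<Omega> (\<lambda>x. (f m x + g m x) - (f' x + g' x))) \<longlonglongrightarrow> 0"
proof (rule Lim_null_comparison[OF always_eventually])
  show "(\<lambda>m. L2_norm \<Omega> (\<lambda>x. f m x - f' x) + L2_norm \<Omega> (\<lambda>x. g m x - g' x)) \<longlonglongrightarrow> 0"
    using tendsto_add[OF lim] by simp
  show "\<forall>m. norm (L2_norm \<Omega> (\<lambda>x. (f m x + g m x) - (f' x + g' x)))
      \<le> L2_norm \<Omega> (\<lambda>x. f m x - f' x) + L2_norm \<Omega> (\<lambda>x. g m x - g' x)"
    using L2_norm_triangle[OF L2_space_diff[OF assms(1,2)] L2_space_diff[OF assms(3,4)]]
    by (simp add: add_diff_add)
qed

lemma H1_limit_add:
  assumes "H1_limit \<Omega> v G" "H1_limit \<Omega> w H"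
  shows "H1_limit \<Omega> (\<lambda>x. v x + w x) (\<lambda>x. G x + H x)"
proof -
  obtain \<psi> :: "nat \<Rightarrow> real^'n \<Rightarrow> real" where \<psi>: "\<And>m. \<psi> m \<in> test_functions \<Omega>"
    "(\<lambda>m. L2_norm \<Omega> (\<lambda>x. \<psi> m x - v x)) \<longlonglongrightarrow> 0"
    "\<And>i. (\<lambda>m. L2_norm \<Omega> (\<lambda>x. partial_deriv i (\<psi> m) x - G x $ i)) \<longlonglongrightarrow> 0"
    using assms(1) unfolding H1_limit_def by blast
  obtain \<xi> :: "nat \<Rightarrow> real^'n \<Rightarrow> real" where \<xi>: "\<And>m. \<xi> m \<in> test_functions \<Omega>"
    "(\<lambda>m. L2_norm \<Omega> (\<lambda>x. \<xi> m x - w x)) \<longlonglongrightarrow> 0"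
    "\<And>i. (\<lambda>m. L2_norm \<Omega> (\<lambda>x. partial_deriv i (\<xi> m) x - H x $ i)) \<longlonglongrightarrow> 0"
    using assms(2) unfolding H1_limit_def by blast
  have vw: "v \<in> L2_space \<Omega>" "w \<in> L2_space \<Omega>" "L2_field \<Omega> G" "L2_field \<Omega> H"
    using assms by (simp_all add: H1_limit_def)
  have pd: "partial_deriv i (\<lambda>x. \<psi> m x + \<xi> m x) = (\<lambda>x. partial_deriv i (\<psi> m) x + partial_deriv i (\<xi> m) x)" for i m
    by (intro partial_deriv_add test_functions_differentiable[OF \<psi>(1)] test_functions_differentiable[OF \<xi>(1)])
  show ?thesis
    unfolding H1_limit_def
  proof (intro conjI exI[of _ "\<lambda>m x. \<psi> m x + \<xi> m x"] allI)
    show "(\<lambda>x. v x + w x) \<in> L2_space \<Omega>" "L2_field \<Omega> (\<lambda>x. G x + H x)"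
      using vw by (simp_all add: L2_space_add L2_field_add)
    show "(\<lambda>x. \<psi> m x + \<xi> m x) \<in> test_functions \<Omega>" for m
      by (rule test_functions_add[OF \<psi>(1) \<xi>(1)])
    show "(\<lambda>m. L2_norm \<Omega> (\<lambda>x. \<psi> m x + \<xi> m x - (v x + w x))) \<longlonglongrightarrow> 0"
      by (intro L2_norm_diff_add_tendsto_zero test_L2 \<psi> \<xi> vw)
    fix i
    show "(\<lambda>m. L2_norm \<Omega> (\<lambda>x. partial_deriv i (\<lambda>x. \<psi> m x + \<xi> m x) x - (G x + H x) $ i)) \<longlonglongrightarrow> 0"
      unfolding pd vector_add_component
      by (intro L2_norm_diff_add_tendsto_zero test_partial_L2 \<psi> \<xi> vw(3,4)[unfolded L2_field_def, rule_format])
  qed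
qed

lemma H1_limit_sum:
  assumes "\<And>k. k \<in> K \<Longrightarrow> H1_limit \<Omega> (v k) (G k)"
  shows "H1_limit \<Omega> (\<lambda>x. \<Sum>k\<in>K. v k x) (\<lambda>x. \<Sum>k\<in>K. G k x)"
  using assms
  by (induction K rule: infinite_finite_induct) (auto intro: H1_limit_zero H1_limit_add)

text \<open>The weak gradient is tested against \<open>x\<^sub>i \<psi>\<close> with \<open>\<psi> \<rightarrow> v\<close>, which gives
  \<open>\<parallel>v\<parallel>\<^sup>2 = - 2 \<langle>x\<^sub>i v, \<partial>\<^sub>i v\<rangle>\<close>.\<close>

lemma Poincare:
  obtains R where "R > 0"
    "\<And>v G i. has_weak_gradient \<Omega> v G \<Longrightarrow> H1_limit \<Omega> v G \<Longrightarrow>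
       L2_norm \<Omega> v \<le> R * L2_norm \<Omega> (\<lambda>x. G x $ i)"
proof -
  obtain R where R: "R > 0" "\<And>x. x \<in> \<Omega> \<Longrightarrow> norm x \<le> R"
    using bounded_\<Omega> unfolding bounded_pos by blast
  \<comment> \<open>The 2 comes from the identity for the squared norm, the R from the bound of
    |x_i| on \<Omega>; one factor \<open>L2_norm \<Omega> v\<close> is cancelled at the end.\<close>
  have "L2_norm \<Omega> v \<le> 2 * R * L2_norm \<Omega> (\<lambda>x. G x $ i)"
    if wg: "has_weak_gradient \<Omega> v G" and lim: "H1_limit \<Omega> v G" for v G i
  proof -
    obtain \<psi> :: "nat \<Rightarrow> real^'n \<Rightarrow> real" where \<psi>: "\<And>m. \<psi> m \<in> test_functions \<Omega>"
      "(\<lambda>m. L2_norm \<Omega> (\<lambda>x. \<psi> m x - v x)) \<longlonglongrightarrow> 0"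
      "\<And>i. (\<lambda>m. L2_norm \<Omega> (\<lambda>x. partial_deriv i (\<psi> m) x - G x $ i)) \<longlonglongrightarrow> 0"
      using lim unfolding H1_limit_def by blast
    have v: "v \<in> L2_space \<Omega>" and Gi: "(\<lambda>x. G x $ i) \<in> L2_space \<Omega>"
      using lim by (simp_all add: H1_limit_def L2_field_def)
    have mult: "(\<lambda>x. x $ i * f x) \<in> L2_space \<Omega>" "L2_norm \<Omega> (\<lambda>x. x $ i * f x) \<le> R * L2_norm \<Omega> f"
      if f: "f \<in> L2_space \<Omega>" for f
    proof -
      have "continuous_on \<Omega> (\<lambda>x. x $ i)" by (intro continuous_intros)
      then have "(\<lambda>x. x $ i) \<in> borel_measurable (lebesgue_on \<Omega>)"
        by (rule continuous_imp_measurable_on_sets_lebesgue) simp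
      then have meas: "(\<lambda>x. x $ i * f x) \<in> borel_measurable (lebesgue_on \<Omega>)"
        using f by (auto simp: L2_space_def)
      have le: "AE x in lebesgue_on \<Omega>. \<bar>x $ i * f x\<bar> \<le> \<bar>R * f x\<bar>"
      proof (intro AE_I2)
        fix x assume "x \<in> space (lebesgue_on \<Omega>)"
        then have "\<bar>x $ i\<bar> \<le> \<bar>R\<bar>"
          using R order_trans[OF component_le_norm_cart[of x i], of R] by simp
        then show "\<bar>x $ i * f x\<bar> \<le> \<bar>R * f x\<bar>" by (simp add: abs_mult mult_right_mono)
      qed
      show "(\<lambda>x. x $ i * f x) \<in> L2_space \<Omega>"
        by (rule L2_space_dominated[OF L2_space_scale[OF f] meas le])
      show "L2_norm \<Omega> (\<lambda>x. x $ i * f x) \<le> R * L2_norm \<Omega> f"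
        using L2_norm_mono[OF L2_space_scale[OF f] meas le] R(1) by (simp add: L2_norm_scale)
    qed
    have swap: "L2_inner \<Omega> f (\<lambda>x. x $ i * g x) = L2_inner \<Omega> g (\<lambda>x. x $ i * f x)" for f g
      unfolding L2_inner_def by (simp add: mult_ac)
    have eq: "L2_inner \<Omega> (partial_deriv i (\<psi> m)) (\<lambda>x. x $ i * v x) + L2_inner \<Omega> (\<psi> m) v
        = - L2_inner \<Omega> (\<psi> m) (\<lambda>x. x $ i * G x $ i)" for m
    proof -
      have test: "(\<lambda>x. x $ i * \<psi> m x) \<in> test_functions \<Omega>"
        by (rule test_functionsI[OF \<psi>(1)]) (auto intro: Ck_mult Ck_component test_functions_Ck[OF \<psi>(1)])
      have diff: "(\<lambda>x::real^'n. x $ i) differentiable_on UNIV"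
        using Ck_component[of "Suc 0" i] by simp
      have "partial_deriv i (\<lambda>x. x $ i * \<psi> m x) = (\<lambda>x. x $ i * partial_deriv i (\<psi> m) x + \<psi> m x)"
        using partial_deriv_mult[OF diff test_functions_differentiable[OF \<psi>(1)], of i m]
        by (simp add: partial_deriv_component)
      then have "L2_inner \<Omega> v (\<lambda>x. x $ i * partial_deriv i (\<psi> m) x + \<psi> m x)
          = - L2_inner \<Omega> (\<lambda>x. G x $ i) (\<lambda>x. x $ i * \<psi> m x)"
        using wg test unfolding has_weak_gradient_def by metis
      then show ?thesis
        using L2_inner_add_right[OF mult(1)[OF test_partial_L2[OF \<psi>(1)]] test_L2[OF \<psi>(1)] v, of i m m]
        by (simp add: swap[of v] swap[of "\<lambda>x. G x $ i"] L2_inner_commute[of \<Omega> v "\<psi> m"])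
    qed
    have "(\<lambda>m. L2_inner \<Omega> (partial_deriv i (\<psi> m)) (\<lambda>x. x $ i * v x) + L2_inner \<Omega> (\<psi> m) v)
      \<longlonglongrightarrow> L2_inner \<Omega> (\<lambda>x. G x $ i) (\<lambda>x. x $ i * v x) + L2_inner \<Omega> v v"
      by (intro tendsto_add L2_inner_tendsto_left test_L2 test_partial_L2 \<psi> v Gi mult(1))
    moreover have "(\<lambda>m. - L2_inner \<Omega> (\<psi> m) (\<lambda>x. x $ i * G x $ i))
      \<longlonglongrightarrow> - L2_inner \<Omega> v (\<lambda>x. x $ i * G x $ i)"
      by (intro tendsto_minus L2_inner_tendsto_left test_L2 \<psi> v Gi mult(1))
    ultimately have "L2_inner \<Omega> (\<lambda>x. G x $ i) (\<lambda>x. x $ i * v x) + L2_inner \<Omega> v v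
        = - L2_inner \<Omega> v (\<lambda>x. x $ i * G x $ i)"
      unfolding eq by (rule LIMSEQ_unique)
    then have "(L2_norm \<Omega> v)\<^sup>2 = - 2 * L2_inner \<Omega> (\<lambda>x. G x $ i) (\<lambda>x. x $ i * v x)"
      by (simp add: L2_norm_sq swap[of v])
    also have "\<dots> \<le> 2 * (L2_norm \<Omega> (\<lambda>x. G x $ i) * L2_norm \<Omega> (\<lambda>x. x $ i * v x))"
      using L2_Cauchy_Schwarz[OF Gi mult(1)[OF v]] by linarith
    also have "\<dots> \<le> 2 * (L2_norm \<Omega> (\<lambda>x. G x $ i) * (R * L2_norm \<Omega> v))"
      using mult(2)[OF v] by (intro mult_left_mono) auto
    finally have "L2_norm \<Omega> v * L2_norm \<Omega> v \<le> (2 * R * L2_norm \<Omega> (\<lambda>x. G x $ i)) * L2_norm \<Omega> v"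
      by (simp add: power2_eq_square mult_ac)
    then show ?thesis
      using R(1) L2_norm_nonneg[of \<Omega> v] by (cases "L2_norm \<Omega> v = 0") auto
  qed
  then show ?thesis using R(1) by (intro that[of "2 * R"]) auto
qed

text \<open>By the chain rule the clamp multiplies the gradient by a factor t in [0, 1], hence the
  nonnegative quadratic form by t^2; the \<open>c\<close> term shrinks because the clamp does not
  increase absolute values.\<close>

lemma energy_truncation:
  assumes \<psi>: "\<psi> \<in> test_functions \<Omega>" and ab: "a \<le> 0" "0 \<le> b" and "\<delta> > 0"
  obtains g where "g \<in> test_functions \<Omega>" "E g (gradient g) g (gradient g) \<le> E \<psi> (gradient \<psi>) \<psi> (gradient \<psi>)"
    "\<And>x. \<bar>g x - max a (min b (\<psi> x))\<bar> \<le> 2 * \<delta>"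
proof
  let ?g = "\<lambda>x. smooth_clamp a b \<delta> (\<psi> x)"
  show g: "?g \<in> test_functions \<Omega>"
    by (rule test_functionsI[OF \<psi>]) (auto intro: Ck_smooth_clamp \<open>\<delta> > 0\<close> test_functions_Ck[OF \<psi>])
  show "\<bar>?g x - max a (min b (\<psi> x))\<bar> \<le> 2 * \<delta>" for x
    by (rule smooth_clamp_approx[OF ab \<open>\<delta> > 0\<close>])
  have grad: "gradient ?g x = smooth_clamp' a b \<delta> (\<psi> x) *\<^sub>R gradient \<psi> x" for x
    by (simp add: vec_eq_iff partial_deriv_chain[OF test_functions_differentiable[OF \<psi>]
          smooth_clamp_deriv[OF \<open>\<delta> > 0\<close>]])
  show "E ?g (gradient ?g) ?g (gradient ?g) \<le> E \<psi> (gradient \<psi>) \<psi> (gradient \<psi>)"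
    unfolding energy_def
  proof (rule integral_mono_AE)
    show "integrable (lebesgue_on \<Omega>) (\<lambda>x. (A x *v gradient ?g x) \<bullet> gradient ?g x + c x * ?g x * ?g x)"
      by (intro energy_integrable test_L2 test_gradient_L2 g)
    show "integrable (lebesgue_on \<Omega>) (\<lambda>x. (A x *v gradient \<psi> x) \<bullet> gradient \<psi> x + c x * \<psi> x * \<psi> x)"
      by (intro energy_integrable test_L2 test_gradient_L2 \<psi>)
    have "AE x in lebesgue_on \<Omega>. x \<in> \<Omega>" by (intro AE_I2) simp
    with c_nonneg show "AE x in lebesgue_on \<Omega>. (A x *v gradient ?g x) \<bullet> gradient ?g x + c x * ?g x * ?g x
        \<le> (A x *v gradient \<psi> x) \<bullet> gradient \<psi> x + c x * \<psi> x * \<psi> x"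
    proof eventually_elim
      case (elim x)
      define t where "t = smooth_clamp' a b \<delta> (\<psi> x)"
      have t: "0 \<le> t" "t \<le> 1"
        using smooth_clamp'_bounds[OF \<open>\<delta> > 0\<close>, of a b "\<psi> x"] ab by (auto simp: t_def)
      then have "t * t \<le> 1" by (simp add: mult_le_one)
      have "(A x *v gradient ?g x) \<bullet> gradient ?g x = (t * t) * ((A x *v gradient \<psi> x) \<bullet> gradient \<psi> x)"
        by (simp add: grad t_def matrix_vector_mult_scaleR)
      also have "\<dots> \<le> 1 * ((A x *v gradient \<psi> x) \<bullet> gradient \<psi> x)"
        by (rule mult_right_mono[OF \<open>t * t \<le> 1\<close> A_nonneg[OF elim(2)]])
      finally have 1: "(A x *v gradient ?g x) \<bullet> gradient ?g x \<le> (A x *v gradient \<psi> x) \<bullet> gradient \<psi> x" by simp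
      have "(?g x)\<^sup>2 \<le> (\<psi> x)\<^sup>2"
        using smooth_clamp_abs_le[OF \<open>\<delta> > 0\<close>, of a b "\<psi> x"] ab by (simp add: abs_le_square_iff)
      then have "c x * (?g x)\<^sup>2 \<le> c x * (\<psi> x)\<^sup>2" using elim(1) by (rule mult_left_mono)
      with 1 show ?case by (simp add: power2_eq_square mult.assoc)
    qed
  qed
qed

end

subsection \<open>The spectral decomposition and the resolvent\<close>

locale dirichlet_problem = elliptic \<Omega> A c
  for \<Omega> :: "(real^'n) set" and A :: "real^'n \<Rightarrow> real^'n^'n" and c :: "real^'n \<Rightarrow> real" +
  fixes \<mu> :: "nat \<Rightarrow> real" and \<phi> :: "nat \<Rightarrow> real^'n \<Rightarrow> real"
  assumes eigenbasis: "dirichlet_eigenbasis \<Omega> A c \<mu> \<phi>"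
begin

sublocale L2_basis \<Omega> \<phi>
  using eigenbasis by unfold_locales (simp add: dirichlet_eigenbasis_def)

lemma \<mu>_pos [simp]: "0 < \<mu> k"
  using eigenbasis by (simp add: dirichlet_eigenbasis_def)

text \<open>One gradient is fixed per eigenfunction. It must be a weak gradient, for the eigenvalue
  identity, and also a limit of gradients of test functions, for approximating finite
  combinations.\<close>

definition D\<phi> :: "nat \<Rightarrow> real^'n \<Rightarrow> real^'n" where
  "D\<phi> k = (SOME G. has_weak_gradient \<Omega> (\<phi> k) G \<and> H1_limit \<Omega> (\<phi> k) G)"

lemma D\<phi>: "has_weak_gradient \<Omega> (\<phi> k) (D\<phi> k)" "H1_limit \<Omega> (\<phi> k) (D\<phi> k)"
proof -
  have "\<phi> k \<in> H01 \<Omega>"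
    using eigenbasis by (simp add: dirichlet_eigenbasis_def dirichlet_eigenpair_def)
  then have "\<exists>G. has_weak_gradient \<Omega> (\<phi> k) G \<and> H1_limit \<Omega> (\<phi> k) G"
    by (rule H01_D) blast
  from someI_ex[OF this] show "has_weak_gradient \<Omega> (\<phi> k) (D\<phi> k)" "H1_limit \<Omega> (\<phi> k) (D\<phi> k)"
    by (simp_all add: D\<phi>_def)
qed

lemma D\<phi>_L2 [simp]: "L2_field \<Omega> (D\<phi> k)"
  using D\<phi>(2) by (simp add: H1_limit_def)

lemma energy_eigenfunction:
  assumes "v \<in> H01 \<Omega>" "has_weak_gradient \<Omega> v H"
  shows "E (\<phi> k) (D\<phi> k) v H = \<mu> k * coeff v k"
  using eigenbasis D\<phi>(1)[of k] assms
  unfolding dirichlet_eigenbasis_def dirichlet_eigenpair_def energy_def L2_inner_commute[of \<Omega> v] by blast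

lemma energy_eigenfunctions: "E (\<phi> j) (D\<phi> j) (\<phi> k) (D\<phi> k) = (if j = k then \<mu> k else 0)"
proof -
  have "\<phi> k \<in> H01 \<Omega>"
    using eigenbasis by (simp add: dirichlet_eigenbasis_def dirichlet_eigenpair_def)
  then show ?thesis by (simp add: energy_eigenfunction[OF _ D\<phi>(1)])
qed

text \<open>An eigenvalue is the energy of its normalised eigenfunction; coercivity and the Poincare
  inequality bound this Rayleigh quotient from below, uniformly in k.\<close>

lemma \<mu>_bounded_below:
  obtains m where "m > 0" "\<And>k. m \<le> \<mu> k"
proof -
  obtain R where R: "R > 0" "\<And>v G i. has_weak_gradient \<Omega> v G \<Longrightarrow> H1_limit \<Omega> v G \<Longrightarrow>
       L2_norm \<Omega> v \<le> R * L2_norm \<Omega> (\<lambda>x. G x $ i)"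
    by (rule Poincare) blast
  obtain \<alpha> where \<alpha>: "\<alpha> > 0" "\<And>v G i. v \<in> L2_space \<Omega> \<Longrightarrow> L2_field \<Omega> G \<Longrightarrow>
       \<alpha> * (L2_norm \<Omega> (\<lambda>x. G x $ i))\<^sup>2 \<le> E v G v G"
    by (rule energy_coercive) blast
  have "\<alpha> / R\<^sup>2 \<le> \<mu> k" for k
  proof -
    \<comment> \<open>Any coordinate direction works; \<open>undefined\<close> merely names
      one.\<close>
    define q where "q = L2_norm \<Omega> (\<lambda>x. D\<phi> k x $ undefined)"
    have "(L2_norm \<Omega> (\<phi> k))\<^sup>2 = 1" by (simp add: L2_norm_sq)
    then have "L2_norm \<Omega> (\<phi> k) = 1" by (simp add: power2_eq_1_iff) (use L2_norm_nonneg[of \<Omega> "\<phi> k"] in linarith)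
    then have "1 \<le> R * q" using R(2)[OF D\<phi>(1)[of k] D\<phi>(2)[of k], of undefined] by (simp add: q_def)
    then have "1 \<le> (R * q)\<^sup>2" by (simp add: one_le_power)
    then have "\<alpha> \<le> \<alpha> * (R * q)\<^sup>2" using \<alpha>(1) by simp
    also have "\<dots> = R\<^sup>2 * (\<alpha> * q\<^sup>2)" by (simp add: power_mult_distrib)
    also have "\<dots> \<le> R\<^sup>2 * \<mu> k"
      using \<alpha>(2)[OF basis_L2[of k] D\<phi>_L2[of k], of undefined]
      by (intro mult_left_mono) (simp_all add: energy_eigenfunctions q_def)
    finally show ?thesis using R(1) by (simp add: pos_divide_le_eq mult.commute)
  qed
  moreover have "\<alpha> / R\<^sup>2 > 0" using \<alpha>(1) R(1) by simp
  ultimately show ?thesis using that by blast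
qed

lemma H1_limit_combination:
  "H1_limit \<Omega> (\<lambda>x. \<Sum>k\<in>K. d k * \<phi> k x) (\<lambda>x. \<Sum>k\<in>K. d k *\<^sub>R D\<phi> k x)"
  by (intro H1_limit_sum H1_limit_scale D\<phi>)

lemma combination_gradient_L2 [simp]: "L2_field \<Omega> (\<lambda>x. \<Sum>k\<in>K. d k *\<^sub>R D\<phi> k x)"
  using H1_limit_combination by (simp add: H1_limit_def)

lemma energy_combination_left:
  assumes "w \<in> L2_space \<Omega>" "L2_field \<Omega> H"
  shows "E (\<lambda>x. \<Sum>k\<in>K. d k * \<phi> k x) (\<lambda>x. \<Sum>k\<in>K. d k *\<^sub>R D\<phi> k x) w H
    = (\<Sum>k\<in>K. d k * E (\<phi> k) (D\<phi> k) w H)"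
  using assms by (simp add: energy_sum_left L2_space_scale L2_field_scale energy_scale_left)

lemma energy_combination:
  assumes "finite K"
  shows "E (\<lambda>x. \<Sum>k\<in>K. d k * \<phi> k x) (\<lambda>x. \<Sum>k\<in>K. d k *\<^sub>R D\<phi> k x)
      (\<lambda>x. \<Sum>k\<in>K. d k * \<phi> k x) (\<lambda>x. \<Sum>k\<in>K. d k *\<^sub>R D\<phi> k x) = (\<Sum>k\<in>K. \<mu> k * (d k)\<^sup>2)"
proof -
  have "E (\<phi> j) (D\<phi> j) (\<lambda>x. \<Sum>k\<in>K. d k * \<phi> k x) (\<lambda>x. \<Sum>k\<in>K. d k *\<^sub>R D\<phi> k x) = \<mu> j * d j"
    if "j \<in> K" for j
    using that assms
    by (subst energy_commute)
       (simp add: energy_combination_left energy_eigenfunctions if_distrib mult.commute cong: if_cong)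
  then show ?thesis
    by (simp add: energy_combination_left power2_eq_square mult_ac)
qed

text \<open>The energy of \<open>v\<close> minus its Fourier sum is nonnegative. The cross terms
  contribute -2 times the sum on the left and the square +1 times it. The minus sign sits in the
  coefficients so that \<open>energy_sq_add\<close> applies.\<close>

lemma energy_Bessel:
  assumes v: "v \<in> test_functions \<Omega>"
  shows "(\<Sum>k<N. \<mu> k * (coeff v k)\<^sup>2) \<le> E v (gradient v) v (gradient v)"
proof -
  let ?P = "\<lambda>x. \<Sum>k<N. (- coeff v k) * \<phi> k x" and ?D = "\<lambda>x. \<Sum>k<N. (- coeff v k) *\<^sub>R D\<phi> k x"
  have "E (\<phi> k) (D\<phi> k) v (gradient v) = \<mu> k * coeff v k" for k
    by (intro energy_eigenfunction test_functions_H01 test_functions_has_weak_gradient open_\<Omega> bounded_\<Omega> v)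
  then have *: "E v (gradient v) ?P ?D = - (\<Sum>k<N. \<mu> k * (coeff v k)\<^sup>2)"
    by (subst energy_commute, subst energy_combination_left)
       (simp_all add: test_L2 test_gradient_L2 v sum_negf[symmetric] power2_eq_square mult_ac)
  have "0 \<le> E (\<lambda>x. v x + ?P x) (\<lambda>x. gradient v x + ?D x) (\<lambda>x. v x + ?P x) (\<lambda>x. gradient v x + ?D x)"
    by (rule energy_nonneg)
  also have "\<dots> = E v (gradient v) v (gradient v) + 2 * E v (gradient v) ?P ?D + E ?P ?D ?P ?D"
    by (intro energy_sq_add test_L2 test_gradient_L2 v combination_L2 combination_gradient_L2)
  also have "\<dots> = E v (gradient v) v (gradient v) - (\<Sum>k<N. \<mu> k * (coeff v k)\<^sup>2)"
    by (subst *, subst energy_combination) simp_all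
  finally show ?thesis by simp
qed

text \<open>With \<open>w = (1 + \<epsilon> \<L>)\<^sup>-\<^sup>1 z\<close>, the functional \<open>F v = \<parallel>v - z\<parallel>\<^sup>2 + \<epsilon> E(v, v)\<close> satisfies
  \<open>F v \<ge> min F + \<parallel>v - w\<parallel>\<^sup>2\<close>.\<close>

context
  fixes \<epsilon> :: real and z w :: "real^'n \<Rightarrow> real"
  assumes \<epsilon>: "\<epsilon> > 0" and z: "z \<in> L2_space \<Omega>" and w: "w \<in> L2_space \<Omega>"
    and w_coeff: "\<And>k. coeff w k = coeff z k / (1 + \<epsilon> * \<mu> k)"
begin

text \<open>The minimum over d of (d - z_k)^2 + \<epsilon> \<mu>_k d^2, attained at the k-th
  coefficient of \<open>w\<close>; \<open>suminf F_term\<close> is the infimum of the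
  functional.\<close>

definition F_term :: "nat \<Rightarrow> real" where
  "F_term k = \<epsilon> * \<mu> k / (1 + \<epsilon> * \<mu> k) * (coeff z k)\<^sup>2"

definition F_val :: "(real^'n \<Rightarrow> real) \<Rightarrow> (real^'n \<Rightarrow> real^'n) \<Rightarrow> real" where
  "F_val v G = (L2_norm \<Omega> (\<lambda>x. v x - z x))\<^sup>2 + \<epsilon> * E v G v G"

lemma \<epsilon>\<mu>_pos: "0 < \<epsilon> * \<mu> k" using \<epsilon> by simp

lemma F_term_nonneg: "0 \<le> F_term k"
  using \<epsilon>\<mu>_pos[of k] by (simp add: F_term_def)

lemma F_term_summable: "summable F_term"
proof (rule summable_comparison_test')
  show "summable (\<lambda>k. (coeff z k)\<^sup>2)" using Parseval[OF z] by (rule sums_summable)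
  show "norm (F_term k) \<le> (coeff z k)\<^sup>2" for k
  proof -
    have "\<epsilon> * \<mu> k / (1 + \<epsilon> * \<mu> k) \<le> 1" using \<epsilon>\<mu>_pos[of k] by (simp add: divide_le_eq)
    then have "F_term k \<le> 1 * (coeff z k)\<^sup>2" unfolding F_term_def by (rule mult_right_mono) simp
    then show ?thesis using F_term_nonneg[of k] by simp
  qed
qed

text \<open>Completing the square in d. The leading coefficient is at least 1, which is where the
  quadratic gap comes from.\<close>

lemma F_term_eq: "(d - coeff z k)\<^sup>2 + \<epsilon> * \<mu> k * d\<^sup>2 = F_term k + (1 + \<epsilon> * \<mu> k) * (d - coeff w k)\<^sup>2"
proof -
  have zk: "coeff z k = (1 + \<epsilon> * \<mu> k) * coeff w k"
    using \<epsilon>\<mu>_pos[of k] by (simp add: w_coeff)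
  have "F_term k = \<epsilon> * \<mu> k * (1 + \<epsilon> * \<mu> k) * (coeff w k)\<^sup>2"
    unfolding F_term_def zk using \<epsilon>\<mu>_pos[of k] by (simp add: power_mult_distrib power2_eq_square)
  then show ?thesis unfolding zk by (simp add: power2_eq_square algebra_simps)
qed

text \<open>\<open>F_term_eq\<close> gives the gap coefficient by coefficient. Bessel inequalities
  for the norm and for the energy bound the partial sums, which then pass to the limit.\<close>

lemma F_lower_bound:
  assumes v: "v \<in> test_functions \<Omega>"
  shows "suminf F_term + (L2_norm \<Omega> (\<lambda>x. v x - w x))\<^sup>2 \<le> F_val v (gradient v)"
proof -
  have vL2: "v \<in> L2_space \<Omega>" by (rule test_L2[OF v])
  have "(\<lambda>k. F_term k + (coeff (\<lambda>x. v x - w x) k)\<^sup>2) sums (suminf F_term + (L2_norm \<Omega> (\<lambda>x. v x - w x))\<^sup>2)"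
    by (intro sums_add summable_sums F_term_summable Parseval L2_space_diff vL2 w)
  moreover have "(\<Sum>k<N. F_term k + (coeff (\<lambda>x. v x - w x) k)\<^sup>2) \<le> F_val v (gradient v)" for N
  proof -
    have "F_term k + (coeff (\<lambda>x. v x - w x) k)\<^sup>2
        \<le> (coeff (\<lambda>x. v x - z x) k)\<^sup>2 + \<epsilon> * (\<mu> k * (coeff v k)\<^sup>2)" for k
    proof -
      have "1 * (coeff v k - coeff w k)\<^sup>2 \<le> (1 + \<epsilon> * \<mu> k) * (coeff v k - coeff w k)\<^sup>2"
        using \<epsilon>\<mu>_pos[of k] by (intro mult_right_mono) auto
      then show ?thesis
        using F_term_eq[of "coeff v k" k] by (simp add: L2_inner_diff_left vL2 w z mult.assoc)
    qed
    then have "(\<Sum>k<N. F_term k + (coeff (\<lambda>x. v x - w x) k)\<^sup>2)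
        \<le> (\<Sum>k<N. (coeff (\<lambda>x. v x - z x) k)\<^sup>2 + \<epsilon> * (\<mu> k * (coeff v k)\<^sup>2))"
      by (intro sum_mono)
    also have "\<dots> = (\<Sum>k<N. (coeff (\<lambda>x. v x - z x) k)\<^sup>2) + \<epsilon> * (\<Sum>k<N. \<mu> k * (coeff v k)\<^sup>2)"
      by (simp add: sum.distrib sum_distrib_left)
    also have "\<dots> \<le> F_val v (gradient v)"
      unfolding F_val_def
    proof (intro add_mono mult_left_mono energy_Bessel v)
      show "(\<Sum>k<N. (coeff (\<lambda>x. v x - z x) k)\<^sup>2) \<le> (L2_norm \<Omega> (\<lambda>x. v x - z x))\<^sup>2"
        using norm_diff_partial_sum[OF L2_space_diff[OF vL2 z], of N]
          zero_le_power2[of "L2_norm \<Omega> (\<lambda>x. (v x - z x) - (\<Sum>k<N. coeff (\<lambda>x. v x - z x) k * \<phi> k x))"]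
        by linarith
    qed (use \<epsilon> in simp)
    finally show ?thesis .
  qed
  ultimately show ?thesis
    unfolding sums_def by (intro LIMSEQ_le_const2) auto
qed

text \<open>Two approximations: Fourier sums of \<open>w\<close> drive the functional to its
  infimum, and a fixed Fourier sum is a limit of test functions along which the functional is
  continuous.\<close>

lemma F_infimum:
  assumes "\<delta> > 0"
  obtains \<psi> where "\<psi> \<in> test_functions \<Omega>" "F_val \<psi> (gradient \<psi>) < suminf F_term + \<delta>"
proof -
  define W where "W N x = (\<Sum>k<N. coeff w k * \<phi> k x)" for N and x
  define D where "D N x = (\<Sum>k<N. coeff w k *\<^sub>R D\<phi> k x)" for N and x
  \<comment> \<open>The coordinates up to N contribute their minima; the others are 0 in
    \<open>W N\<close> and contribute the tail of the squared norm of \<open>z\<close>.\<close>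
  have "F_val (W N) (D N) = (L2_norm \<Omega> z)\<^sup>2 - (\<Sum>k<N. (coeff z k)\<^sup>2) + (\<Sum>k<N. F_term k)" for N
  proof -
    have F_term: "F_term k = (coeff w k - coeff z k)\<^sup>2 + \<epsilon> * (\<mu> k * (coeff w k)\<^sup>2)" for k
      using F_term_eq[of "coeff w k" k] by (simp add: mult.assoc)
    have "(L2_norm \<Omega> (\<lambda>x. W N x - z x))\<^sup>2 = (\<Sum>k<N. (coeff w k)\<^sup>2) - 2 * (\<Sum>k<N. coeff w k * coeff z k) + (L2_norm \<Omega> z)\<^sup>2"
      unfolding W_def
      by (subst L2_norm_sq_diff) (simp_all add: z norm_combination inner_combination)
    moreover have "E (W N) (D N) (W N) (D N) = (\<Sum>k<N. \<mu> k * (coeff w k)\<^sup>2)"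
      unfolding W_def D_def by (rule energy_combination) simp
    ultimately show ?thesis
      unfolding F_val_def F_term power2_diff
      by (simp add: sum.distrib sum_subtractf sum_distrib_left mult_ac)
  qed
  moreover have "(\<lambda>N. (L2_norm \<Omega> z)\<^sup>2 - (\<Sum>k<N. (coeff z k)\<^sup>2) + (\<Sum>k<N. F_term k))
      \<longlonglongrightarrow> (L2_norm \<Omega> z)\<^sup>2 - (L2_norm \<Omega> z)\<^sup>2 + suminf F_term"
    using Parseval[OF z] F_term_summable
    by (intro tendsto_add tendsto_diff tendsto_const) (auto simp: sums_def[symmetric] summable_sums)
  ultimately have "(\<lambda>N. F_val (W N) (D N)) \<longlonglongrightarrow> suminf F_term" by simp
  then have "\<forall>\<^sub>F N in sequentially. F_val (W N) (D N) < suminf F_term + \<delta>"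
    by (rule order_tendstoD) (use assms in linarith)
  then obtain N where N: "F_val (W N) (D N) < suminf F_term + \<delta>"
    by (auto simp: eventually_sequentially)
  have H1: "H1_limit \<Omega> (W N) (D N)"
    unfolding W_def D_def by (rule H1_limit_combination)
  then obtain \<psi> :: "nat \<Rightarrow> real^'n \<Rightarrow> real" where \<psi>: "\<And>m. \<psi> m \<in> test_functions \<Omega>"
    "(\<lambda>m. L2_norm \<Omega> (\<lambda>x. \<psi> m x - W N x)) \<longlonglongrightarrow> 0"
    "\<And>i. (\<lambda>m. L2_norm \<Omega> (\<lambda>x. partial_deriv i (\<psi> m) x - D N x $ i)) \<longlonglongrightarrow> 0"
    unfolding H1_limit_def by blast
  have WD: "W N \<in> L2_space \<Omega>" "L2_field \<Omega> (D N)" using H1 by (simp_all add: H1_limit_def)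
  have "(\<lambda>m. L2_norm \<Omega> (\<lambda>x. (\<psi> m x - z x) - (W N x - z x))) \<longlonglongrightarrow> 0"
    using \<psi>(2) by simp
  \<comment> \<open>A squared norm is a weighted integral with weight 1, so
    \<open>bounded_weight_tendsto\<close> applies.\<close>
  then have "(\<lambda>m. LINT x|lebesgue_on \<Omega>. 1 * (\<psi> m x - z x) * (\<psi> m x - z x))
      \<longlonglongrightarrow> (LINT x|lebesgue_on \<Omega>. 1 * (W N x - z x) * (W N x - z x))"
    by (intro bounded_weight_tendsto L2_space_diff test_L2 \<psi>(1) WD(1) z) (auto simp: Linfty_space_def)
  then have norm_lim: "(\<lambda>m. (L2_norm \<Omega> (\<lambda>x. \<psi> m x - z x))\<^sup>2) \<longlonglongrightarrow> (L2_norm \<Omega> (\<lambda>x. W N x - z x))\<^sup>2"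
    by (simp add: L2_norm_sq L2_inner_def)
  have "(\<lambda>m. E (\<psi> m) (gradient (\<psi> m)) (\<psi> m) (gradient (\<psi> m))) \<longlonglongrightarrow> E (W N) (D N) (W N) (D N)"
    by (intro energy_tendsto test_L2 test_gradient_L2 \<psi>(1,2) WD) (simp add: \<psi>(3))
  with norm_lim have "(\<lambda>m. F_val (\<psi> m) (gradient (\<psi> m))) \<longlonglongrightarrow> F_val (W N) (D N)"
    unfolding F_val_def by (intro tendsto_add tendsto_mult tendsto_const)
  then have "\<forall>\<^sub>F m in sequentially. F_val (\<psi> m) (gradient (\<psi> m)) < suminf F_term + \<delta>"
    by (rule order_tendstoD) (rule N)
  then obtain m where "F_val (\<psi> m) (gradient (\<psi> m)) < suminf F_term + \<delta>"
    by (auto simp: eventually_sequentially)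
  with \<psi>(1) that show ?thesis by blast
qed

text \<open>Clamping a near-minimiser brings it no farther from \<open>z\<close>, whose values lie
  in [a, b], up to an error of order \<delta>, and does not raise its energy. The clamped function
  is again a near-minimiser, hence close to \<open>w\<close> by the quadratic gap, while its values
  are within 2 \<delta> of [a, b].\<close>

lemma resolvent_bounds:
  assumes ab: "a \<le> 0" "0 \<le> b" and z_ab: "AE x in lebesgue_on \<Omega>. a \<le> z x \<and> z x \<le> b"
  shows "AE x in lebesgue_on \<Omega>. a \<le> w x \<and> w x \<le> b"
proof -
  define M where "M = lebesgue_on \<Omega>"
  define V where "V = measure M (space M)"
  have fin: "finite_measure M"
    unfolding M_def using open_\<Omega> bounded_\<Omega>
    by (intro finite_measure_lebesgue_on bounded_set_imp_lmeasurable) auto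
  have const: "integrable M (\<lambda>x. r)" "(LINT x|M. r) = r * V" for r :: real
    using fin by (auto simp: V_def finite_measure.integrable_const)
  have sq_int: "integrable M (\<lambda>x. (f x)\<^sup>2)" "(LINT x|M. (f x)\<^sup>2) = (L2_norm \<Omega> f)\<^sup>2" if "f \<in> L2_space \<Omega>" for f
    using that by (auto simp: L2_space_def L2_norm_def M_def)
  define h where "h x = w x - max a (min b (w x))" for x
  have h_L2: "h \<in> L2_space \<Omega>"
  proof (rule L2_space_dominated[OF w])
    show "h \<in> borel_measurable (lebesgue_on \<Omega>)" unfolding h_def using w by (auto simp: L2_space_def)
    show "AE x in lebesgue_on \<Omega>. \<bar>h x\<bar> \<le> \<bar>w x\<bar>"
      using ab by (intro AE_I2) (auto simp: h_def max_def min_def)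
  qed
  \<comment> \<open>The bracket with b - a comes from (p + 2 \<delta>)^2 with p \<le> b - a; the
    factor 2 and the term 8 \<delta>^2 from (x + y)^2 \<le> 2 x^2 + 2 y^2 with y = 2
    \<delta>.\<close>
  have bound: "(L2_norm \<Omega> h)\<^sup>2 \<le> 2 * (\<delta> + (4 * \<delta> * (b - a) + 4 * \<delta>\<^sup>2) * V) + 8 * \<delta>\<^sup>2 * V" if "\<delta> > 0" for \<delta>
  proof -
    obtain \<psi> where \<psi>: "\<psi> \<in> test_functions \<Omega>" "F_val \<psi> (gradient \<psi>) < suminf F_term + \<delta>"
      using F_infimum[OF \<open>\<delta> > 0\<close>] .
    obtain g where g: "g \<in> test_functions \<Omega>" "E g (gradient g) g (gradient g) \<le> E \<psi> (gradient \<psi>) \<psi> (gradient \<psi>)"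
      and g_le: "\<And>x. \<bar>g x - max a (min b (\<psi> x))\<bar> \<le> 2 * \<delta>"
      using energy_truncation[OF \<psi>(1) ab \<open>\<delta> > 0\<close>] by metis
    have L2: "(\<lambda>x. g x - z x) \<in> L2_space \<Omega>" "(\<lambda>x. \<psi> x - z x) \<in> L2_space \<Omega>" "(\<lambda>x. g x - w x) \<in> L2_space \<Omega>"
      by (intro L2_space_diff test_L2[OF g(1)] test_L2[OF \<psi>(1)] z w)+
    have "(LINT x|M. (g x - z x)\<^sup>2) \<le> (LINT x|M. (\<psi> x - z x)\<^sup>2 + (4 * \<delta> * (b - a) + 4 * \<delta>\<^sup>2))"
    proof (rule integral_mono_AE)
      show "AE x in M. (g x - z x)\<^sup>2 \<le> (\<psi> x - z x)\<^sup>2 + (4 * \<delta> * (b - a) + 4 * \<delta>\<^sup>2)"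
        using z_ab unfolding M_def[symmetric]
      proof eventually_elim
        case (elim x)
        define p where "p = \<bar>max a (min b (\<psi> x)) - z x\<bar>"
        have p: "0 \<le> p" "p \<le> \<bar>\<psi> x - z x\<bar>" "p \<le> b - a"
          using elim by (auto simp: p_def max_def min_def)
        have "\<bar>g x - z x\<bar> \<le> p + 2 * \<delta>" using g_le[of x] by (simp add: p_def)
        then have "(g x - z x)\<^sup>2 \<le> (p + 2 * \<delta>)\<^sup>2" using power_mono[of "\<bar>g x - z x\<bar>" "p + 2 * \<delta>" 2] by simp
        also have "\<dots> = p\<^sup>2 + (4 * \<delta> * p + 4 * \<delta>\<^sup>2)" by (simp add: power2_eq_square algebra_simps)
        also have "\<dots> \<le> (\<psi> x - z x)\<^sup>2 + (4 * \<delta> * (b - a) + 4 * \<delta>\<^sup>2)"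
          using p \<open>\<delta> > 0\<close> power_mono[OF p(2,1), of 2] by (intro add_mono mult_left_mono) auto
        finally show ?case .
      qed
    qed (intro Bochner_Integration.integrable_add sq_int const L2)+
    then have "(L2_norm \<Omega> (\<lambda>x. g x - z x))\<^sup>2 \<le> (L2_norm \<Omega> (\<lambda>x. \<psi> x - z x))\<^sup>2 + (4 * \<delta> * (b - a) + 4 * \<delta>\<^sup>2) * V"
      using L2 by (simp add: Bochner_Integration.integral_add sq_int const(1) V_def mult_ac)
    moreover have "\<epsilon> * E g (gradient g) g (gradient g) \<le> \<epsilon> * E \<psi> (gradient \<psi>) \<psi> (gradient \<psi>)"
      using g(2) \<epsilon> by simp
    ultimately have gw: "(L2_norm \<Omega> (\<lambda>x. g x - w x))\<^sup>2 \<le> \<delta> + (4 * \<delta> * (b - a) + 4 * \<delta>\<^sup>2) * V"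
      using F_lower_bound[OF g(1)] \<psi>(2) unfolding F_val_def by linarith
    have "(LINT x|M. (h x)\<^sup>2) \<le> (LINT x|M. 2 * (g x - w x)\<^sup>2 + 8 * \<delta>\<^sup>2)"
    proof (rule integral_mono)
      fix x
      \<comment> \<open>|h x| is the distance from \<open>w x\<close> to [a, b], so no point of that
        interval is closer.\<close>
      have "\<bar>h x\<bar> \<le> \<bar>w x - max a (min b (\<psi> x))\<bar>"
        using ab by (auto simp: h_def max_def min_def)
      then have "\<bar>h x\<bar> \<le> \<bar>g x - w x\<bar> + 2 * \<delta>" using g_le[of x] by linarith
      then have "(h x)\<^sup>2 \<le> (\<bar>g x - w x\<bar> + 2 * \<delta>)\<^sup>2" using power_mono[of "\<bar>h x\<bar>" "\<bar>g x - w x\<bar> + 2 * \<delta>" 2] by simp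
      also have "\<dots> \<le> 2 * (\<bar>g x - w x\<bar>)\<^sup>2 + 2 * (2 * \<delta>)\<^sup>2"
        using zero_le_power2[of "\<bar>g x - w x\<bar> - 2 * \<delta>"] by (simp add: power2_sum power2_diff)
      finally show "(h x)\<^sup>2 \<le> 2 * (g x - w x)\<^sup>2 + 8 * \<delta>\<^sup>2" by simp
    qed (intro Bochner_Integration.integrable_add integrable_mult_right sq_int const L2 h_L2)+
    then have "(L2_norm \<Omega> h)\<^sup>2 \<le> 2 * (L2_norm \<Omega> (\<lambda>x. g x - w x))\<^sup>2 + 8 * \<delta>\<^sup>2 * V"
      using L2 h_L2 by (simp add: Bochner_Integration.integral_add sq_int const(1) V_def mult_ac)
    also have "2 * (L2_norm \<Omega> (\<lambda>x. g x - w x))\<^sup>2 \<le> 2 * (\<delta> + (4 * \<delta> * (b - a) + 4 * \<delta>\<^sup>2) * V)"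
      by (rule mult_left_mono[OF gw]) simp
    finally show ?thesis by simp
  qed
  have "(L2_norm \<Omega> h)\<^sup>2 \<le> 0"
  proof (rule tendsto_lowerbound)
    have "((\<lambda>\<delta>. 2 * (\<delta> + (4 * \<delta> * (b - a) + 4 * \<delta>\<^sup>2) * V) + 8 * \<delta>\<^sup>2 * V)
        \<longlongrightarrow> 2 * (0 + (4 * 0 * (b - a) + 4 * 0\<^sup>2) * V) + 8 * 0\<^sup>2 * V) (at_right 0)"
      by (intro tendsto_intros)
    then show "((\<lambda>\<delta>. 2 * (\<delta> + (4 * \<delta> * (b - a) + 4 * \<delta>\<^sup>2) * V) + 8 * \<delta>\<^sup>2 * V) \<longlongrightarrow> 0) (at_right 0)"
      by simp
    show "\<forall>\<^sub>F \<delta> in at_right 0. (L2_norm \<Omega> h)\<^sup>2 \<le> 2 * (\<delta> + (4 * \<delta> * (b - a) + 4 * \<delta>\<^sup>2) * V) + 8 * \<delta>\<^sup>2 * V"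
      using bound eventually_at_right_less[of 0] by (auto elim: eventually_mono)
  qed simp
  then have "(LINT x|M. (h x)\<^sup>2) = 0"
    using sq_int(2)[OF h_L2] by simp
  then have "AE x in M. (h x)\<^sup>2 = 0"
    using sq_int(1)[OF h_L2] by (subst (asm) integral_nonneg_eq_0_iff_AE) auto
  then show ?thesis
    unfolding M_def
  proof eventually_elim
    case (elim x)
    then have "w x = max a (min b (w x))" by (simp add: h_def)
    then show ?case using ab by (auto simp: max_def min_def split: if_splits)
  qed
qed

end


section \<open>Existence of the resolvent and its action on the L1 norm\<close>

lemma finite_measure_\<Omega>: "finite_measure (lebesgue_on \<Omega>)"
  using open_\<Omega> bounded_\<Omega> by (intro finite_measure_lebesgue_on bounded_set_imp_lmeasurable) auto

lemma bounded_L2_space: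
  assumes "f \<in> borel_measurable (lebesgue_on \<Omega>)" "\<And>x. \<bar>f x\<bar> \<le> B"
  shows "f \<in> L2_space \<Omega>"
proof -
  have "(f x)\<^sup>2 \<le> B\<^sup>2" for x using power_mono[OF assms(2), of x 2] by simp
  then have "integrable (lebesgue_on \<Omega>) (\<lambda>x. (f x)\<^sup>2)"
    using assms(1) by (intro finite_measure.integrable_const_bound[OF finite_measure_\<Omega>, of _ "B\<^sup>2"]) auto
  with assms(1) show ?thesis by (simp add: L2_space_def)
qed

lemma abs_integrable: "w \<in> L2_space \<Omega> \<Longrightarrow> integrable (lebesgue_on \<Omega>) (\<lambda>x. \<bar>w x\<bar>)"
  using L2_space_mult_integrable[OF _ bounded_L2_space[of "\<lambda>x. 1" 1], of w] by simp

lemma resolvent_exists: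
  assumes "\<epsilon> > 0" "z \<in> L2_space \<Omega>"
  obtains w where "w \<in> L2_space \<Omega>" "\<And>k. coeff w k = coeff z k / (1 + \<epsilon> * \<mu> k)"
proof (rule Riesz_Fischer)
  show "summable (\<lambda>k. (coeff z k / (1 + \<epsilon> * \<mu> k))\<^sup>2)"
  proof (rule summable_comparison_test')
    show "summable (\<lambda>k. (coeff z k)\<^sup>2)" using Parseval[OF assms(2)] by (rule sums_summable)
    have pos: "0 < \<epsilon> * \<mu> k" for k using assms(1) by simp
    show "norm ((coeff z k / (1 + \<epsilon> * \<mu> k))\<^sup>2) \<le> (coeff z k)\<^sup>2" for k
    proof -
      have "1 \<le> (1 + \<epsilon> * \<mu> k)\<^sup>2" using pos[of k] by (simp add: one_le_power)
      then have "(coeff z k)\<^sup>2 / (1 + \<epsilon> * \<mu> k)\<^sup>2 \<le> (coeff z k)\<^sup>2 / 1"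
        by (intro divide_left_mono) auto
      then show ?thesis by (simp add: power_divide)
    qed
  qed
qed (use that in blast)

text \<open>By duality: \<open>\<parallel>R z\<parallel>\<^sub>1 = \<langle>R z, sgn (R z)\<rangle> = \<langle>z, R sgn (R z)\<rangle>\<close>, and \<open>R\<close> preserves the bounds \<open>\<plusminus>1\<close>.\<close>

lemma resolvent_L1_contraction:
  assumes \<epsilon>: "\<epsilon> > 0" and z: "z \<in> L2_space \<Omega>" and w: "w \<in> L2_space \<Omega>"
    and w_coeff: "\<And>k. coeff w k = coeff z k / (1 + \<epsilon> * \<mu> k)"
  shows "L1_norm \<Omega> w \<le> L1_norm \<Omega> z"
proof -
  let ?g = "\<lambda>x. sgn (w x)"
  have g: "?g \<in> L2_space \<Omega>"
    by (rule bounded_L2_space[of _ 1]) (use w in \<open>auto simp: L2_space_def abs_sgn_eq\<close>)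
  obtain v where v: "v \<in> L2_space \<Omega>" "\<And>k. coeff v k = coeff ?g k / (1 + \<epsilon> * \<mu> k)"
    by (rule resolvent_exists[OF \<epsilon> g]) blast
  have v_bounds: "AE x in lebesgue_on \<Omega>. -1 \<le> v x \<and> v x \<le> 1"
    by (rule resolvent_bounds[OF \<epsilon> g v]) (auto simp: sgn_real_def intro!: AE_I2)
  have "L1_norm \<Omega> w = L2_inner \<Omega> w ?g"
    by (simp add: L1_norm_def L2_inner_def abs_sgn)
  also have "\<dots> = L2_inner \<Omega> z v"
  proof (rule sums_unique2)
    show "(\<lambda>k. coeff w k * coeff ?g k) sums L2_inner \<Omega> w ?g"
      by (rule Parseval_inner[OF w g])
    show "(\<lambda>k. coeff w k * coeff ?g k) sums L2_inner \<Omega> z v"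
      using Parseval_inner[OF z v(1)] by (simp add: w_coeff v(2))
  qed
  also have "\<dots> \<le> L1_norm \<Omega> z"
    unfolding L2_inner_def L1_norm_def
  proof (rule integral_mono_AE)
    show "integrable (lebesgue_on \<Omega>) (\<lambda>x. z x * v x)" by (rule L2_space_mult_integrable[OF z v(1)])
    show "integrable (lebesgue_on \<Omega>) (\<lambda>x. \<bar>z x\<bar>)" by (rule abs_integrable[OF z])
    show "AE x in lebesgue_on \<Omega>. z x * v x \<le> \<bar>z x\<bar>"
      using v_bounds
    proof eventually_elim
      case (elim x)
      have "z x * v x \<le> \<bar>z x\<bar> * \<bar>v x\<bar>" by (metis abs_ge_self abs_mult)
      also have "\<dots> \<le> \<bar>z x\<bar> * 1" using elim by (intro mult_left_mono) auto
      finally show ?case by simp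
    qed
  qed
  finally show ?thesis .
qed

subsection \<open>The state and adjoint equations in Fourier coefficients\<close>

text \<open>Since p - q \<le> 0, the power with exponent p - q is largest at the lower bound m of
  the eigenvalues, which gives C = m powr (p - q).\<close>

lemma \<mu>_powr_weight:
  assumes "p \<le> q"
  obtains C where "C > 0" "\<And>k. \<mu> k powr p \<le> C * \<mu> k powr q"
proof -
  obtain m where m: "m > 0" "\<And>k. m \<le> \<mu> k" by (rule \<mu>_bounded_below) blast
  have "\<mu> k powr p \<le> m powr (p - q) * \<mu> k powr q" for k
  proof -
    have "\<mu> k powr (p - q) \<le> m powr (p - q)"
      using m assms by (intro powr_mono2') auto
    then have "\<mu> k powr (p - q) * \<mu> k powr q \<le> m powr (p - q) * \<mu> k powr q"
      by (rule mult_right_mono) simp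
    then show ?thesis by (simp add: powr_add[symmetric])
  qed
  with m(1) show ?thesis by (intro that[of "m powr (p - q)"]) auto
qed

lemma summable_weaker_weight:
  assumes "summable (\<lambda>k. \<mu> k powr q * (x k)\<^sup>2)" "p \<le> q"
  shows "summable (\<lambda>k. \<mu> k powr p * (x k)\<^sup>2)"
proof -
  obtain C where C: "C > 0" "\<And>k. \<mu> k powr p \<le> C * \<mu> k powr q"
    by (rule \<mu>_powr_weight[OF assms(2)]) blast
  show ?thesis
  proof (rule summable_comparison_test')
    show "summable (\<lambda>k. C * (\<mu> k powr q * (x k)\<^sup>2))"
      by (intro summable_mult assms(1))
    show "norm (\<mu> k powr p * (x k)\<^sup>2) \<le> C * (\<mu> k powr q * (x k)\<^sup>2)" for k
      using mult_right_mono[OF C(2), of "(x k)\<^sup>2" k] by (simp add: mult.assoc)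
  qed
qed

text \<open>Multiplying coefficients by \<open>\<mu> k powr q\<close> shifts the spectral order by 2
  q. Exponents such as \<open>2 * - s\<close> below are left unsimplified to match this
  rule.\<close>

lemma weight_mult: "\<mu> k powr p * (\<mu> k powr q * x)\<^sup>2 = \<mu> k powr (p + 2 * q) * x\<^sup>2"
proof -
  have "\<mu> k powr (p + 2 * q) = \<mu> k powr p * (\<mu> k powr q * \<mu> k powr q)"
    by (simp only: mult_2 powr_add)
  then show ?thesis by (simp only: power2_eq_square mult_ac)
qed

lemma summable_coeff: "w \<in> L2_space \<Omega> \<Longrightarrow> summable (\<lambda>k. \<mu> k powr 0 * (coeff w k)\<^sup>2)"
  using sums_summable[OF Parseval] by (simp add: less_imp_neq[OF \<mu>_pos, symmetric])

lemma negative_power_exists: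
  assumes "s > 0" "z \<in> L2_space \<Omega>"
  obtains u where "u \<in> L2_space \<Omega>" "\<And>k. coeff u k = \<mu> k powr - s * coeff z k"
proof (rule Riesz_Fischer)
  have "summable (\<lambda>k. \<mu> k powr (- 2 * s) * (coeff z k)\<^sup>2)"
    using assms by (intro summable_weaker_weight[OF summable_coeff]) auto
  then show "summable (\<lambda>k. (\<mu> k powr - s * coeff z k)\<^sup>2)"
    using weight_mult[of _ 0 "-s"] by (simp add: less_imp_neq[OF \<mu>_pos, symmetric])
qed (use that in blast)

lemma basis_Hspec: "\<phi> k \<in> Hspec \<Omega> \<mu> \<phi> r"
proof -
  have "summable (\<lambda>j. \<mu> j powr r * (coeff (\<phi> k) j)\<^sup>2)"
    by (rule summable_finite[of "{k}"]) auto
  then show ?thesis by (simp add: Hspec_def)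
qed

text \<open>Testing with one eigenfunction collapses the series to one term and fixes each
  coefficient. Conversely these coefficients have finite weight of order s, because s - 2s \<le> 0,
  and the equation becomes Parseval's identity.\<close>

lemma solves_state_iff:
  assumes s: "s > 0" and z: "z \<in> L2_space \<Omega>"
  shows "solves_state \<Omega> \<mu> \<phi> s z u \<longleftrightarrow> u \<in> L2_space \<Omega> \<and> (\<forall>k. coeff u k = \<mu> k powr - s * coeff z k)"
proof
  assume u: "solves_state \<Omega> \<mu> \<phi> s z u"
  have "coeff u k = \<mu> k powr - s * coeff z k" for k
  proof -
    have "frac_op \<Omega> \<mu> \<phi> s u (\<phi> k) = (\<Sum>j\<in>{k}. \<mu> j powr s * coeff u j * coeff (\<phi> k) j)"
      unfolding frac_op_def by (rule suminf_finite) auto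
    then have "\<mu> k powr s * coeff u k = coeff z k"
      using u basis_Hspec[of k s] by (simp add: solves_state_def)
    then have "\<mu> k powr - s * coeff z k = \<mu> k powr (- s + s) * coeff u k"
      by (simp only: powr_add mult.assoc)
    then show ?thesis by (simp add: less_imp_neq[OF \<mu>_pos, symmetric])
  qed
  moreover have "u \<in> L2_space \<Omega>" using u by (simp add: solves_state_def Hspec_def)
  ultimately show "u \<in> L2_space \<Omega> \<and> (\<forall>k. coeff u k = \<mu> k powr - s * coeff z k)" by blast
next
  assume u: "u \<in> L2_space \<Omega> \<and> (\<forall>k. coeff u k = \<mu> k powr - s * coeff z k)"
  have "summable (\<lambda>k. \<mu> k powr (s + 2 * - s) * (coeff z k)\<^sup>2)"
    using s by (intro summable_weaker_weight[OF summable_coeff[OF z]]) auto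
  then have "u \<in> Hspec \<Omega> \<mu> \<phi> s"
    unfolding Hspec_def using u by (simp only: mem_Collect_eq weight_mult)
  moreover have "frac_op \<Omega> \<mu> \<phi> s u v = L2_inner \<Omega> z v" if v: "v \<in> L2_space \<Omega>" for v
  proof -
    have "\<mu> k powr s * coeff u k = coeff z k" for k
    proof -
      have "\<mu> k powr s * coeff u k = \<mu> k powr (s + - s) * coeff z k"
        using u by (simp only: powr_add mult.assoc)
      then show ?thesis by (simp add: less_imp_neq[OF \<mu>_pos, symmetric])
    qed
    then show ?thesis
      unfolding frac_op_def using sums_unique[OF Parseval_inner[OF z v]] by simp
  qed
  ultimately show "solves_state \<Omega> \<mu> \<phi> s z u"
    by (simp add: solves_state_def Hspec_def)
qed

lemma control_to_state_coeff:
  assumes "s > 0" "z \<in> L2_space \<Omega>"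
  shows "control_to_state \<Omega> \<mu> \<phi> s z \<in> L2_space \<Omega>"
    "coeff (control_to_state \<Omega> \<mu> \<phi> s z) k = \<mu> k powr - s * coeff z k"
proof -
  have "\<exists>u. solves_state \<Omega> \<mu> \<phi> s z u"
    unfolding solves_state_iff[OF assms] by (rule negative_power_exists[OF assms]) blast
  then have "solves_state \<Omega> \<mu> \<phi> s z (control_to_state \<Omega> \<mu> \<phi> s z)"
    unfolding control_to_state_def by (rule someI_ex)
  then show "control_to_state \<Omega> \<mu> \<phi> s z \<in> L2_space \<Omega>"
    "coeff (control_to_state \<Omega> \<mu> \<phi> s z) k = \<mu> k powr - s * coeff z k"
    by (simp_all add: solves_state_iff[OF assms])
qed

text \<open>The solution operator is diagonal with real entries, hence its own adjoint. Testing with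
  eigenfunctions determines the coefficients of whichever representative \<open>SOME\<close>
  picks.\<close>

lemma adjoint_coeff:
  assumes s: "s > 0" and w: "w \<in> L2_space \<Omega>"
  shows "L2_adjoint \<Omega> (control_to_state \<Omega> \<mu> \<phi> s) w \<in> L2_space \<Omega>"
    "coeff (L2_adjoint \<Omega> (control_to_state \<Omega> \<mu> \<phi> s) w) k = \<mu> k powr - s * coeff w k"
proof -
  let ?S = "control_to_state \<Omega> \<mu> \<phi> s" and ?p = "L2_adjoint \<Omega> (control_to_state \<Omega> \<mu> \<phi> s) w"
  obtain p where p: "p \<in> L2_space \<Omega>" "\<And>k. coeff p k = \<mu> k powr - s * coeff w k"
    by (rule negative_power_exists[OF s w]) blast
  have p_adj: "L2_inner \<Omega> (?S z) w = L2_inner \<Omega> z p" if z: "z \<in> L2_space \<Omega>" for z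
  proof (rule sums_unique2)
    show "(\<lambda>k. coeff (?S z) k * coeff w k) sums L2_inner \<Omega> (?S z) w"
      by (intro Parseval_inner control_to_state_coeff s z w)
    show "(\<lambda>k. coeff (?S z) k * coeff w k) sums L2_inner \<Omega> z p"
      using Parseval_inner[OF z p(1)] by (simp add: p(2) control_to_state_coeff[OF s z] mult_ac)
  qed
  have adj: "?p \<in> L2_space \<Omega> \<and> (\<forall>z\<in>L2_space \<Omega>. L2_inner \<Omega> (?S z) w = L2_inner \<Omega> z ?p)"
    unfolding L2_adjoint_def by (rule someI[of _ p]) (use p(1) p_adj in blast)
  then show "?p \<in> L2_space \<Omega>" by blast
  have "L2_inner \<Omega> (\<phi> k) ?p = L2_inner \<Omega> (\<phi> k) p"
    using adj p_adj[OF basis_L2] basis_L2 by metis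
  then show "coeff ?p k = \<mu> k powr - s * coeff w k"
    using p(2)[of k] by (simp only: L2_inner_commute[of \<Omega> _ "\<phi> k"])
qed

subsection \<open>Regularity of the optimal control\<close>

text \<open>The smooth part of the cost is quadratic along the segment from \<open>z\<close> to
  \<open>y\<close>; there convexity and the assumption on the L1 norms keep the L1 term at or below
  its value at \<open>z\<close>. Dividing by t and letting t tend to 0 leaves the linear
  term.\<close>

lemma optimality_condition:
  assumes s: "s > 0" and \<sigma>\<nu>: "\<nu> > 0" and u\<^sub>d: "u\<^sub>d \<in> L2_space \<Omega>"
    and S: "S = control_to_state \<Omega> \<mu> \<phi> s"
    and opt: "optimal_control \<Omega> S \<sigma> \<nu> u\<^sub>d a b z"
    and y: "y \<in> admissible_controls \<Omega> a b" and L1: "L1_norm \<Omega> y \<le> L1_norm \<Omega> z"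
  shows "0 \<le> L2_inner \<Omega> (\<lambda>x. S z x - u\<^sub>d x) (S (\<lambda>x. y x - z x)) + \<sigma> * L2_inner \<Omega> z (\<lambda>x. y x - z x)"
    (is "0 \<le> ?P")
proof -
  let ?e = "\<lambda>x. y x - z x" and ?U = "\<lambda>x. S z x - u\<^sub>d x"
  have z_adm: "z \<in> admissible_controls \<Omega> a b"
    and min: "\<And>y. y \<in> admissible_controls \<Omega> a b \<Longrightarrow> cost \<Omega> \<sigma> \<nu> u\<^sub>d (S z) z \<le> cost \<Omega> \<sigma> \<nu> u\<^sub>d (S y) y"
    using opt by (auto simp: optimal_control_def)
  have z: "z \<in> L2_space \<Omega>" and y_L2: "y \<in> L2_space \<Omega>"
    using z_adm y by (auto simp: admissible_controls_def)
  have e: "?e \<in> L2_space \<Omega>" by (intro L2_space_diff y_L2 z)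
  have S_L2: "S v \<in> L2_space \<Omega>" and S_coeff: "coeff (S v) k = \<mu> k powr - s * coeff v k"
    if "v \<in> L2_space \<Omega>" for v k
    using control_to_state_coeff[OF s that] by (simp_all add: S)
  have U: "?U \<in> L2_space \<Omega>" by (intro L2_space_diff S_L2 z u\<^sub>d)
  \<comment> \<open>The coefficient of t^2 in the quadratic part of the cost along the segment;
    \<open>?P\<close> is the coefficient of t.\<close>
  define Q where "Q = ((L2_norm \<Omega> (S ?e))\<^sup>2 + \<sigma> * (L2_norm \<Omega> ?e)\<^sup>2) / 2"
  have ineq: "0 \<le> ?P + t * Q" if t: "0 < t" "t < 1" for t
  proof -
    let ?y = "\<lambda>x. z x + t * ?e x"
    have te: "(\<lambda>x. t * ?e x) \<in> L2_space \<Omega>" "(\<lambda>x. t * S ?e x) \<in> L2_space \<Omega>"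
      by (intro L2_space_scale e S_L2)+
    have yt: "?y \<in> L2_space \<Omega>" by (intro L2_space_add z te)
    have convex: "?y x = (1 - t) * z x + t * y x" for x by (simp add: algebra_simps)
    have "AE x in lebesgue_on \<Omega>. a \<le> z x \<and> z x \<le> b" "AE x in lebesgue_on \<Omega>. a \<le> y x \<and> y x \<le> b"
      using z_adm y by (auto simp: admissible_controls_def)
    then have "AE x in lebesgue_on \<Omega>. a \<le> ?y x \<and> ?y x \<le> b"
    proof eventually_elim
      case (elim x)
      have "(1 - t) * a + t * a \<le> (1 - t) * z x + t * y x" "(1 - t) * z x + t * y x \<le> (1 - t) * b + t * b"
        using elim t by (intro add_mono mult_left_mono; simp)+
      then show ?case unfolding convex by (simp add: algebra_simps)
    qed
    with yt have "?y \<in> admissible_controls \<Omega> a b" by (simp add: admissible_controls_def)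
    from min[OF this]
    have cost: "cost \<Omega> \<sigma> \<nu> u\<^sub>d (S z) z \<le> cost \<Omega> \<sigma> \<nu> u\<^sub>d (S ?y) ?y" .
    have "L2_norm \<Omega> (\<lambda>x. S ?y x - u\<^sub>d x) = L2_norm \<Omega> (\<lambda>x. ?U x + t * S ?e x)"
    proof (rule coeff_eq_imp_norm_eq)
      show "coeff (\<lambda>x. S ?y x - u\<^sub>d x) k = coeff (\<lambda>x. ?U x + t * S ?e x) k" for k
        unfolding L2_inner_diff_left[OF S_L2[OF yt] u\<^sub>d basis_L2] S_coeff[OF yt]
          L2_inner_add_left[OF z te(1) basis_L2] L2_inner_add_left[OF U te(2) basis_L2]
          L2_inner_diff_left[OF S_L2[OF z] u\<^sub>d basis_L2] L2_inner_scale_left S_coeff[OF z] S_coeff[OF e]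
        by (simp add: algebra_simps)
    qed (intro L2_space_add L2_space_diff S_L2 yt u\<^sub>d U te)+
    then have state: "(L2_norm \<Omega> (\<lambda>x. S ?y x - u\<^sub>d x))\<^sup>2
        = (L2_norm \<Omega> ?U)\<^sup>2 + 2 * t * L2_inner \<Omega> ?U (S ?e) + t\<^sup>2 * (L2_norm \<Omega> (S ?e))\<^sup>2"
      using L2_norm_sq_add[OF U te(2)] by (simp add: L2_inner_scale_right L2_norm_scale power_mult_distrib)
    have control: "(L2_norm \<Omega> ?y)\<^sup>2 = (L2_norm \<Omega> z)\<^sup>2 + 2 * t * L2_inner \<Omega> z ?e + t\<^sup>2 * (L2_norm \<Omega> ?e)\<^sup>2"
      using L2_norm_sq_add[OF z te(1)] by (simp add: L2_inner_scale_right L2_norm_scale power_mult_distrib)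
    have "L1_norm \<Omega> ?y \<le> (LINT x|lebesgue_on \<Omega>. (1 - t) * \<bar>z x\<bar> + t * \<bar>y x\<bar>)"
      unfolding L1_norm_def
    proof (rule integral_mono)
      show "\<bar>?y x\<bar> \<le> (1 - t) * \<bar>z x\<bar> + t * \<bar>y x\<bar>" for x
        unfolding convex using t abs_triangle_ineq[of "(1 - t) * z x" "t * y x"] by (simp add: abs_mult)
    qed (intro abs_integrable yt Bochner_Integration.integrable_add integrable_mult_right z y_L2)+
    also have "\<dots> = (1 - t) * L1_norm \<Omega> z + t * L1_norm \<Omega> y"
      by (simp add: L1_norm_def abs_integrable z y_L2)
    also have "\<dots> \<le> (1 - t) * L1_norm \<Omega> z + t * L1_norm \<Omega> z"
      using L1 t by (intro add_left_mono mult_left_mono) auto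
    finally have "L1_norm \<Omega> ?y \<le> L1_norm \<Omega> z" by (simp add: algebra_simps)
    then have "\<nu> * L1_norm \<Omega> ?y \<le> \<nu> * L1_norm \<Omega> z" using \<sigma>\<nu> by simp
    then have "0 \<le> t * (?P + t * Q)"
      using cost unfolding cost_def state control Q_def by (simp add: algebra_simps power2_eq_square add_divide_distrib)
    then show ?thesis using t by (simp add: zero_le_mult_iff)
  qed
  show ?thesis
  proof (rule tendsto_lowerbound)
    have "((\<lambda>t. ?P + t * Q) \<longlongrightarrow> ?P + 0 * Q) (at_right 0)"
      by (intro tendsto_add tendsto_mult tendsto_const tendsto_ident_at)
    then show "((\<lambda>t. ?P + t * Q) \<longlongrightarrow> ?P) (at_right 0)" by simp
    show "\<forall>\<^sub>F t in at_right 0. 0 \<le> ?P + t * Q"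
      unfolding eventually_at_right_field using ineq by (intro exI[of _ 1]) auto
  qed simp
qed

lemma optimal_control_H1:
  assumes s: "s > 0" and \<sigma>: "\<sigma> > 0" and \<nu>: "\<nu> > 0" and ab: "a < 0" "0 < b"
    and u\<^sub>d: "u\<^sub>d \<in> Hspec \<Omega> \<mu> \<phi> (1 - s)"
    and opt: "optimal_control \<Omega> (control_to_state \<Omega> \<mu> \<phi> s) \<sigma> \<nu> u\<^sub>d a b z"
  shows "z \<in> Hspec \<Omega> \<mu> \<phi> 1"
proof -
  let ?S = "control_to_state \<Omega> \<mu> \<phi> s"
  have z: "z \<in> L2_space \<Omega>" and z_ab: "AE x in lebesgue_on \<Omega>. a \<le> z x \<and> z x \<le> b"
    using opt by (auto simp: optimal_control_def admissible_controls_def)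
  have u\<^sub>d_L2: "u\<^sub>d \<in> L2_space \<Omega>" using u\<^sub>d by (simp add: Hspec_def)
  define d where "d k = \<mu> k powr - s * coeff u\<^sub>d k" for k
  \<comment> \<open>Order 1 for \<open>d\<close> asks only for order 1 - 2s of
    \<open>u\<^sub>d\<close>, and 1 - 2s \<le> 1 - s.\<close>
  have "summable (\<lambda>k. \<mu> k powr (1 + 2 * - s) * (coeff u\<^sub>d k)\<^sup>2)"
  proof (rule summable_weaker_weight)
    show "summable (\<lambda>k. \<mu> k powr (1 - s) * (coeff u\<^sub>d k)\<^sup>2)"
      using u\<^sub>d by (simp add: Hspec_def)
  qed (use s in simp)
  then have "summable (\<lambda>k. \<mu> k powr 1 * (d k)\<^sup>2)"
    unfolding d_def by (simp only: weight_mult)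
  then have d_sum: "summable (\<lambda>k. \<mu> k * (d k)\<^sup>2)" by (simp add: less_imp_le)
  define K where "K = (\<Sum>k. \<mu> k * (d k)\<^sup>2)"
  have resolved: "(\<Sum>k<N. \<mu> k / (1 + \<epsilon> * \<mu> k) * (coeff z k)\<^sup>2) \<le> K / \<sigma>\<^sup>2" if \<epsilon>: "\<epsilon> > 0" for \<epsilon> N
  proof -
    obtain y where y: "y \<in> L2_space \<Omega>" "\<And>k. coeff y k = coeff z k / (1 + \<epsilon> * \<mu> k)"
      by (rule resolvent_exists[OF \<epsilon> z]) blast
    have pos: "0 < \<epsilon> * \<mu> k" for k using \<epsilon> by simp
    \<comment> \<open>The eigenvalues of 1 - R, so the direction \<open>?e\<close> has coefficients
      \<open>- \<theta> k * coeff z k\<close>.\<close>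
    define \<theta> where "\<theta> k = \<epsilon> * \<mu> k / (1 + \<epsilon> * \<mu> k)" for k
    have \<theta>: "0 \<le> \<theta> k" "\<theta> k \<le> \<epsilon> * \<mu> k" "\<theta> k \<le> 1" for k
    proof -
      have "0 \<le> x / (1 + x)" "x / (1 + x) \<le> x" "x / (1 + x) \<le> 1" if "0 < x" for x :: real
        using that by (simp_all add: divide_le_eq distrib_left)
      from this[OF pos[of k]] show "0 \<le> \<theta> k" "\<theta> k \<le> \<epsilon> * \<mu> k" "\<theta> k \<le> 1"
        by (simp_all add: \<theta>_def)
    qed
    let ?e = "\<lambda>x. y x - z x" and ?U = "\<lambda>x. ?S z x - u\<^sub>d x"
    have e: "?e \<in> L2_space \<Omega>" by (intro L2_space_diff y z)
    have U: "?U \<in> L2_space \<Omega>" by (intro L2_space_diff control_to_state_coeff s z u\<^sub>d_L2)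
    have e_coeff: "coeff ?e k = - \<theta> k * coeff z k" for k
      using pos[of k] by (simp add: L2_inner_diff_left y z \<theta>_def field_simps)
    have "y \<in> admissible_controls \<Omega> a b"
      unfolding admissible_controls_def using resolvent_bounds[OF \<epsilon> z y _ _ z_ab] ab y by simp
    then have n1: "0 \<le> L2_inner \<Omega> ?U (?S ?e) + \<sigma> * L2_inner \<Omega> z ?e"
      by (rule optimality_condition[OF s \<nu> u\<^sub>d_L2 refl opt])
         (rule resolvent_L1_contraction[OF \<epsilon> z y])
    have n2: "(\<lambda>k. coeff ?U k * coeff (?S ?e) k + \<sigma> * (coeff z k * coeff ?e k))
        sums (L2_inner \<Omega> ?U (?S ?e) + \<sigma> * L2_inner \<Omega> z ?e)"
      by (intro sums_add sums_mult Parseval_inner U z e control_to_state_coeff s)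
    \<comment> \<open>Young's inequality, from (d - \<sigma> \<zeta>)^2 \<ge> 0, splits the product
      of d and \<zeta>; the nonnegative term (q \<zeta>)^2 is discarded. The bound by \<epsilon>
      \<mu>_k is applied only to the d part, since the \<theta> in front of \<zeta>^2 carries the
      estimate for \<open>z\<close>.\<close>
    have n3: "coeff ?U k * coeff (?S ?e) k + \<sigma> * (coeff z k * coeff ?e k)
        \<le> \<epsilon> * (\<mu> k * (d k)\<^sup>2) / (2 * \<sigma>) - \<sigma> / 2 * (\<theta> k * (coeff z k)\<^sup>2)" for k
    proof -
      define \<zeta> where "\<zeta> = coeff z k"
      define q where "q = \<mu> k powr - s"
      have "coeff ?U k * coeff (?S ?e) k + \<sigma> * (coeff z k * coeff ?e k)
          = - \<theta> k * ((q * \<zeta>)\<^sup>2 - d k * \<zeta> + \<sigma> * \<zeta>\<^sup>2)"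
        by (simp add: L2_inner_diff_left[OF control_to_state_coeff(1)[OF s z] u\<^sub>d_L2 basis_L2]
              control_to_state_coeff[OF s z] control_to_state_coeff[OF s e] e_coeff d_def \<zeta>_def q_def
              power2_eq_square algebra_simps)
      also have "\<dots> \<le> \<theta> k * ((d k)\<^sup>2 / (2 * \<sigma>) - \<sigma> / 2 * \<zeta>\<^sup>2)"
      proof -
        have "0 \<le> (d k - \<sigma> * \<zeta>)\<^sup>2 / (2 * \<sigma>)" using \<sigma> by simp
        also have "\<dots> = (d k)\<^sup>2 / (2 * \<sigma>) - d k * \<zeta> + \<sigma> / 2 * \<zeta>\<^sup>2"
          using \<sigma> by (simp add: power2_diff field_simps power2_eq_square)
        finally have "d k * \<zeta> - \<sigma> * \<zeta>\<^sup>2 - (q * \<zeta>)\<^sup>2 \<le> (d k)\<^sup>2 / (2 * \<sigma>) - \<sigma> / 2 * \<zeta>\<^sup>2"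
          using zero_le_power2[of "q * \<zeta>"] by argo
        from mult_left_mono[OF this \<theta>(1)[of k]] show ?thesis by (simp add: algebra_simps)
      qed
      also have "\<dots> = \<theta> k * ((d k)\<^sup>2 / (2 * \<sigma>)) - \<sigma> / 2 * (\<theta> k * \<zeta>\<^sup>2)"
        by (simp add: algebra_simps)
      also have "\<theta> k * ((d k)\<^sup>2 / (2 * \<sigma>)) \<le> (\<epsilon> * \<mu> k) * ((d k)\<^sup>2 / (2 * \<sigma>))"
        using \<theta>(2) \<sigma> by (intro mult_right_mono) auto
      finally show ?thesis by (simp add: \<zeta>_def mult.assoc)
    qed
    have \<theta>z: "summable (\<lambda>k. \<theta> k * (coeff z k)\<^sup>2)"
    proof (rule summable_comparison_test')
      show "summable (\<lambda>k. (coeff z k)\<^sup>2)" using Parseval[OF z] by (rule sums_summable)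
      show "norm (\<theta> k * (coeff z k)\<^sup>2) \<le> (coeff z k)\<^sup>2" for k
        using \<theta>[of k] by (simp add: abs_mult mult_left_le_one_le)
    qed
    have n4: "(\<lambda>k. \<epsilon> * (\<mu> k * (d k)\<^sup>2) / (2 * \<sigma>) - \<sigma> / 2 * (\<theta> k * (coeff z k)\<^sup>2))
        sums (\<epsilon> * K / (2 * \<sigma>) - \<sigma> / 2 * (\<Sum>k. \<theta> k * (coeff z k)\<^sup>2))"
      unfolding K_def by (intro sums_diff sums_divide sums_mult summable_sums d_sum \<theta>z)
    have "0 \<le> \<epsilon> * K / (2 * \<sigma>) - \<sigma> / 2 * (\<Sum>k. \<theta> k * (coeff z k)\<^sup>2)"
      by (rule order_trans[OF n1 sums_le[OF n3 n2 n4]])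
    \<comment> \<open>Multiplication by 2 / \<sigma> turns K / (2 \<sigma>) into K /
      \<sigma>^2.\<close>
    then have "(\<Sum>k. \<theta> k * (coeff z k)\<^sup>2) \<le> \<epsilon> * (K / \<sigma>\<^sup>2)"
      using \<sigma> by (simp add: field_simps power2_eq_square)
    moreover have "(\<Sum>k<N. \<theta> k * (coeff z k)\<^sup>2) \<le> (\<Sum>k. \<theta> k * (coeff z k)\<^sup>2)"
      by (rule sum_le_suminf[OF \<theta>z]) (simp_all add: \<theta>(1))
    moreover have "(\<Sum>k<N. \<theta> k * (coeff z k)\<^sup>2) = \<epsilon> * (\<Sum>k<N. \<mu> k / (1 + \<epsilon> * \<mu> k) * (coeff z k)\<^sup>2)"
      by (simp add: \<theta>_def sum_distrib_left mult.assoc)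
    ultimately have "\<epsilon> * (\<Sum>k<N. \<mu> k / (1 + \<epsilon> * \<mu> k) * (coeff z k)\<^sup>2) \<le> \<epsilon> * (K / \<sigma>\<^sup>2)"
      by linarith
    then show ?thesis using \<epsilon> by (rule mult_left_le_imp_le)
  qed
  \<comment> \<open>For fixed N the sum is finite, so \<epsilon> may tend to 0 term by term; the
    bound does not depend on N.\<close>
  have "(\<Sum>k<N. \<mu> k * (coeff z k)\<^sup>2) \<le> K / \<sigma>\<^sup>2" for N
  proof (rule tendsto_upperbound)
    have "((\<lambda>\<epsilon>. \<Sum>k<N. \<mu> k / (1 + \<epsilon> * \<mu> k) * (coeff z k)\<^sup>2)
        \<longlongrightarrow> (\<Sum>k<N. \<mu> k / (1 + 0 * \<mu> k) * (coeff z k)\<^sup>2)) (at_right 0)"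
      by (intro tendsto_sum tendsto_mult tendsto_divide tendsto_add tendsto_const tendsto_ident_at) simp
    then show "((\<lambda>\<epsilon>. \<Sum>k<N. \<mu> k / (1 + \<epsilon> * \<mu> k) * (coeff z k)\<^sup>2)
        \<longlongrightarrow> (\<Sum>k<N. \<mu> k * (coeff z k)\<^sup>2)) (at_right 0)" by simp
    show "\<forall>\<^sub>F \<epsilon> in at_right 0. (\<Sum>k<N. \<mu> k / (1 + \<epsilon> * \<mu> k) * (coeff z k)\<^sup>2) \<le> K / \<sigma>\<^sup>2"
      using eventually_at_right_less[of "0::real"] by eventually_elim (rule resolved)
  qed simp
  then have "summable (\<lambda>k. \<mu> k * (coeff z k)\<^sup>2)"
    by (intro summableI_nonneg_bounded) (simp_all add: less_imp_le)
  then show ?thesis using z by (simp add: Hspec_def less_imp_le)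
qed

end

theorem corollary3p10:
  fixes \<Omega> :: "(real^'n) set"
    and A :: "real^'n \<Rightarrow> real^'n^'n"
    and c :: "real^'n \<Rightarrow> real"
    and \<mu> :: "nat \<Rightarrow> real"
    and \<phi> :: "nat \<Rightarrow> real^'n \<Rightarrow> real"
    and s \<sigma> \<nu> a b :: real
    and u\<^sub>d z_bar u_bar p_bar :: "real^'n \<Rightarrow> real"
    and S :: "(real^'n \<Rightarrow> real) \<Rightarrow> (real^'n \<Rightarrow> real)"
  assumes "convex_polytopal_domain \<Omega>"
    and "0 < s" and "s < 1"
    and "admissible_coefficients \<Omega> A c"
    and "dirichlet_eigenbasis \<Omega> A c \<mu> \<phi>"
    and "0 < \<sigma>" and "0 < \<nu>"
    and "a < 0" and "0 < b"
    and "u\<^sub>d \<in> L2_space \<Omega>"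
    and "S = control_to_state \<Omega> \<mu> \<phi> s"
    and "optimal_control \<Omega> S \<sigma> \<nu> u\<^sub>d a b z_bar"
    and "u_bar = S z_bar"
    and "p_bar = L2_adjoint \<Omega> S (\<lambda>x. S z_bar x - u\<^sub>d x)"
    and "u\<^sub>d \<in> Hspec \<Omega> \<mu> \<phi> (1 - s)"
  shows "u_bar \<in> Hspec \<Omega> \<mu> \<phi> (min (1 + 2 * s) 2) \<and>
         p_bar \<in> Hspec \<Omega> \<mu> \<phi> (min (1 + s) 2)"
proof -
  have "open \<Omega>" "bounded \<Omega>"
    using assms(1) by (simp_all add: convex_polytopal_domain_def)
  then interpret dirichlet_problem \<Omega> A c \<mu> \<phi>
    using assms(4,5) by unfold_locales
  note s = assms(2)
  have z1: "z_bar \<in> Hspec \<Omega> \<mu> \<phi> 1"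
    using optimal_control_H1[OF s assms(6,7,8,9,15)] assms(11,12) by simp
  then have z: "z_bar \<in> L2_space \<Omega>" and z_sum: "summable (\<lambda>k. \<mu> k powr 1 * (coeff z_bar k)\<^sup>2)"
    by (auto simp: Hspec_def)
  have d_sum: "summable (\<lambda>k. \<mu> k powr (1 - s) * (coeff u\<^sub>d k)\<^sup>2)"
    using assms(15) by (simp add: Hspec_def)
  have u: "u_bar \<in> L2_space \<Omega>" "coeff u_bar k = \<mu> k powr - s * coeff z_bar k" for k
    using control_to_state_coeff[OF s z] by (simp_all add: assms(11,13))
  have U: "(\<lambda>x. u_bar x - u\<^sub>d x) \<in> L2_space \<Omega>"
    by (intro L2_space_diff u assms(10))
  have p: "p_bar \<in> L2_space \<Omega>"
    "coeff p_bar k = \<mu> k powr - s * (\<mu> k powr - s * coeff z_bar k - coeff u\<^sub>d k)" for k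
  proof -
    have p_eq: "p_bar = L2_adjoint \<Omega> (control_to_state \<Omega> \<mu> \<phi> s) (\<lambda>x. u_bar x - u\<^sub>d x)"
      by (simp only: assms(11,13,14))
    show "p_bar \<in> L2_space \<Omega>" unfolding p_eq by (rule adjoint_coeff[OF s U])
    show "coeff p_bar k = \<mu> k powr - s * (\<mu> k powr - s * coeff z_bar k - coeff u\<^sub>d k)" for k
      unfolding p_eq adjoint_coeff(2)[OF s U] L2_inner_diff_left[OF u(1) assms(10) basis_L2] u(2) ..
  qed
  \<comment> \<open>The order required of the control is min (1 + 2s) 2 - 2s, which is at most
    1.\<close>
  have "summable (\<lambda>k. \<mu> k powr (min (1 + 2 * s) 2 + 2 * - s) * (coeff z_bar k)\<^sup>2)"
    by (rule summable_weaker_weight[OF z_sum]) simp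
  then have "u_bar \<in> Hspec \<Omega> \<mu> \<phi> (min (1 + 2 * s) 2)"
    using u by (simp only: Hspec_def mem_Collect_eq weight_mult)
  moreover
  \<comment> \<open>The order required of the state minus \<open>u\<^sub>d\<close>. It satisfies r
    \<le> 1 - s, as \<open>u\<^sub>d\<close> needs, and r - 2s \<le> 1, as the control
    needs.\<close>
  define r where "r = min (1 + s) 2 + 2 * - s"
  have "summable (\<lambda>k. 2 * (\<mu> k powr (r + 2 * - s) * (coeff z_bar k)\<^sup>2) + 2 * (\<mu> k powr r * (coeff u\<^sub>d k)\<^sup>2))"
    using s by (intro summable_add summable_mult summable_weaker_weight[OF z_sum]
        summable_weaker_weight[OF d_sum]) (auto simp: r_def)
  then have "summable (\<lambda>k. \<mu> k powr r * (\<mu> k powr - s * coeff z_bar k - coeff u\<^sub>d k)\<^sup>2)"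
  proof (rule summable_comparison_test')
    fix k
    let ?x = "\<mu> k powr - s * coeff z_bar k" and ?y = "coeff u\<^sub>d k"
    have "(?x - ?y)\<^sup>2 \<le> 2 * ?x\<^sup>2 + 2 * ?y\<^sup>2"
      using zero_le_power2[of "?x + ?y"] by (simp add: power2_sum power2_diff)
    from mult_left_mono[OF this, of "\<mu> k powr r"]
    have "\<mu> k powr r * (?x - ?y)\<^sup>2 \<le> 2 * (\<mu> k powr r * ?x\<^sup>2) + 2 * (\<mu> k powr r * ?y\<^sup>2)"
      by (simp add: distrib_left mult_ac)
    then show "norm (\<mu> k powr r * (?x - ?y)\<^sup>2)
        \<le> 2 * (\<mu> k powr (r + 2 * - s) * (coeff z_bar k)\<^sup>2) + 2 * (\<mu> k powr r * (coeff u\<^sub>d k)\<^sup>2)"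
      unfolding weight_mult by simp
  qed
  then have "p_bar \<in> Hspec \<Omega> \<mu> \<phi> (min (1 + s) 2)"
    using p unfolding r_def by (simp only: Hspec_def mem_Collect_eq weight_mult)
  ultimately show ?thesis ..
qed

end
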